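(* Let $(\mathfrak g,J,g)$ be a unimodular Hermitian Lie algebra containing an abelian ideal $\mathfrak a$ of real codimension two. Suppose that the holomorphic sectional curvature of the canonical metric connection $D^r_s$ is constant for some $(r,s)\in\Omega$, where $\Omega=\{(r,s)\in\mathbb R^2: s\neq 1\}\cup\{(0,1)\}$. If $(r,s)\neq(1,0)$, then $g$ is Kähler flat and $\mathfrak g/\mathfrak a$ is abelian. If $(r,s)=(1,0)$ (in which case $D^1_0=\nabla^c$ is the Chern connection), then $g$ is Chern flat.
   Context: A Hermitian Lie algebra $(\mathfrak g,J,g)$ is a real Lie algebra of finite even dimension $2n$ with a linear map $J$, $J^2=-1$, satisfying $[x,y]-[Jx,Jy]+J[Jx,y]+J[x,Jy]=0$ for all $x,y\in\mathfrak g$, and an inner product $g=\langle\cdot,\cdot\rangle$ with $\langle Jx,Jy\rangle=\langle x,y\rangle$. It is unimodular if $\mathrm{tr}(\mathrm{ad}_x)=0$ for all $x$. All geometric objects below are those of the corresponding left-invariant Hermitian structure on a Lie group with Lie algebra $\mathfrak g$, expressed on left-invariant vector fields. The inner product is extended complex bilinearly to $\mathfrak g_{\mathbb C}$, and $\mathfrak g^{1,0}=\{X\in\mathfrak g_{\mathbb C}:JX=\sqrt{-1}X\}$. Connections: $\nabla$ is the Levi-Civita connection; $\nabla^c$ (Chern) is the unique connection with $\nabla^cg=0$, $\nabla^cJ=0$ whose torsion satisfies $T(X,\overline Y)=0$ for all $X,Y\in\mathfrak g^{1,0}$; $\nabla^b$ (Bismut) is the unique connection with $\nabla^bg=0$,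 $\nabla^bJ=0$ and totally skew-symmetric torsion. Put $D^r=\frac12(1+r)\nabla^c+\frac12(1-r)\nabla^b$ and $D^r_s=(1-s)D^r+s\nabla$ for $(r,s)\in\Omega$. For a metric connection $D$, its curvature is $R^D_{XY}Z=D_XD_YZ-D_YD_XZ-D_{[X,Y]}Z$, and its holomorphic sectional curvature is $H^D(X)=\langle R^D_{X\overline X}X,\overline X\rangle/\langle X,\overline X\rangle^2$ for $0\ne X\in\mathfrak g^{1,0}$; it is constant if it does not depend on $X$. "Chern flat" means that the curvature of $\nabla^c$ vanishes; "Kähler flat" means that $g$ is Kähler (the Kähler form is closed, equivalently $\nabla J=0$) and the Levi-Civita curvature vanishes. *)

theory Defs
  imports "HOL-Analysis.Analysis"
begin

text \<open>
  The underlying inner product space of the Lie algebra is a type of class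
  \<^class>\<open>euclidean_space\<close>; the metric \<open>g\<close> is the inner product of that type.
\<close>

definition lie_bracket :: "('a::real_vector \<Rightarrow> 'a \<Rightarrow> 'a) \<Rightarrow> bool" where
  "lie_bracket br \<longleftrightarrow> bilinear br \<and> (\<forall>x. br x x = 0) \<and>
     (\<forall>x y z. br x (br y z) + br y (br z x) + br z (br x y) = 0)"

definition integrable_complex_structure ::
  "('a::real_vector \<Rightarrow> 'a \<Rightarrow> 'a) \<Rightarrow> ('a \<Rightarrow> 'a) \<Rightarrow> bool" where
  "integrable_complex_structure br J \<longleftrightarrow> linear J \<and> (\<forall>x. J (J x) = - x) \<and>
     (\<forall>x y. br x y - br (J x) (J y) + J (br (J x) y) + J (br x (J y)) = 0)"

definition hermitian_lie_algebra ::
  "('a::euclidean_space \<Rightarrow> 'a \<Rightarrow> 'a) \<Rightarrow> ('a \<Rightarrow> 'a) \<Rightarrow> bool" where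
  "hermitian_lie_algebra br J \<longleftrightarrow> even DIM('a) \<and> lie_bracket br \<and>
     integrable_complex_structure br J \<and> (\<forall>x y. J x \<bullet> J y = x \<bullet> y)"

definition linear_trace :: "('a::euclidean_space \<Rightarrow> 'a) \<Rightarrow> real" where
  "linear_trace f = (\<Sum>b\<in>Basis. f b \<bullet> b)"

definition unimodular :: "('a::euclidean_space \<Rightarrow> 'a \<Rightarrow> 'a) \<Rightarrow> bool" where
  "unimodular br \<longleftrightarrow> (\<forall>x. linear_trace (br x) = 0)"

definition lie_ideal :: "('a::real_vector \<Rightarrow> 'a \<Rightarrow> 'a) \<Rightarrow> 'a set \<Rightarrow> bool" where
  "lie_ideal br I \<longleftrightarrow> subspace I \<and> (\<forall>x. \<forall>u\<in>I. br x u \<in> I)"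

definition abelian_lie_ideal :: "('a::real_vector \<Rightarrow> 'a \<Rightarrow> 'a) \<Rightarrow> 'a set \<Rightarrow> bool" where
  "abelian_lie_ideal br I \<longleftrightarrow> lie_ideal br I \<and> (\<forall>u\<in>I. \<forall>v\<in>I. br u v = 0)"

text \<open>The quotient by an ideal \<open>I\<close>, with cosets as elements and zero element \<open>I\<close>.\<close>

definition quotient_carrier :: "'a::real_vector set \<Rightarrow> 'a set set" where
  "quotient_carrier I = range (\<lambda>x. (+) x ` I)"

definition quotient_bracket ::
  "('a::real_vector \<Rightarrow> 'a \<Rightarrow> 'a) \<Rightarrow> 'a set \<Rightarrow> 'a set \<Rightarrow> 'a set \<Rightarrow> 'a set" where
  "quotient_bracket br I P Q = (\<Union>x\<in>P. \<Union>y\<in>Q. (+) (br x y) ` I)"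

definition quotient_abelian :: "('a::real_vector \<Rightarrow> 'a \<Rightarrow> 'a) \<Rightarrow> 'a set \<Rightarrow> bool" where
  "quotient_abelian br I \<longleftrightarrow>
     (\<forall>P\<in>quotient_carrier I. \<forall>Q\<in>quotient_carrier I. quotient_bracket br I P Q = I)"

text \<open>
  The pair \<open>(x, y)\<close> stands for \<open>x + \<i> y\<close> in the complexification. Additive structure
  and zero are those of the product type.
\<close>

type_synonym 'a cx = "'a \<times> 'a"

definition cx_scale :: "complex \<Rightarrow> 'a::real_vector cx \<Rightarrow> 'a cx" where
  "cx_scale c X = (Re c *\<^sub>R fst X - Im c *\<^sub>R snd X, Re c *\<^sub>R snd X + Im c *\<^sub>R fst X)"

definition cx_conj :: "'a::real_vector cx \<Rightarrow> 'a cx" where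
  "cx_conj X = (fst X, - snd X)"

definition cx_linear_ext :: "('a::real_vector \<Rightarrow> 'a) \<Rightarrow> 'a cx \<Rightarrow> 'a cx" where
  "cx_linear_ext f X = (f (fst X), f (snd X))"

definition cx_bilinear_ext :: "('a::real_vector \<Rightarrow> 'a \<Rightarrow> 'a) \<Rightarrow> 'a cx \<Rightarrow> 'a cx \<Rightarrow> 'a cx" where
  "cx_bilinear_ext B X Y =
     (B (fst X) (fst Y) - B (snd X) (snd Y), B (fst X) (snd Y) + B (snd X) (fst Y))"

definition cx_inner :: "'a::real_inner cx \<Rightarrow> 'a cx \<Rightarrow> complex" where
  "cx_inner X Y =
     Complex (fst X \<bullet> fst Y - snd X \<bullet> snd Y) (fst X \<bullet> snd Y + snd X \<bullet> fst Y)"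

definition type_1_0 :: "('a::real_vector \<Rightarrow> 'a) \<Rightarrow> 'a cx set" where
  "type_1_0 J = {X. cx_linear_ext J X = cx_scale \<i> X}"

text \<open>
  A left-invariant connection is determined by its values on left-invariant fields, i.e. by
  a bilinear map \<open>D\<close> on the Lie algebra, \<open>D x y\<close> being the derivative of \<open>y\<close> along \<open>x\<close>.
  Torsion and curvature are stated for an arbitrary bracket and are used
  both on the Lie algebra and on its complexification.
\<close>

definition torsion ::
  "('v::ab_group_add \<Rightarrow> 'v \<Rightarrow> 'v) \<Rightarrow> ('v \<Rightarrow> 'v \<Rightarrow> 'v) \<Rightarrow> 'v \<Rightarrow> 'v \<Rightarrow> 'v" where
  "torsion br D x y = D x y - D y x - br x y"

definition curvature ::
  "('v::ab_group_add \<Rightarrow> 'v \<Rightarrow> 'v) \<Rightarrow> ('v \<Rightarrow> 'v \<Rightarrow> 'v) \<Rightarrow> 'v \<Rightarrow> 'v \<Rightarrow> 'v \<Rightarrow> 'v" where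
  "curvature br D x y z = D x (D y z) - D y (D x z) - D (br x y) z"

text \<open>Since \<open>g\<close> is constant on left-invariant fields, its covariant derivative
  has no term differentiating \<open>g y z\<close> as a function.\<close>

definition metric_connection :: "('a::real_inner \<Rightarrow> 'a \<Rightarrow> 'a) \<Rightarrow> bool" where
  "metric_connection D \<longleftrightarrow> bilinear D \<and> (\<forall>x y z. D x y \<bullet> z + y \<bullet> D x z = 0)"

definition hermitian_connection ::
  "('a::real_inner \<Rightarrow> 'a) \<Rightarrow> ('a \<Rightarrow> 'a \<Rightarrow> 'a) \<Rightarrow> bool" where
  "hermitian_connection J D \<longleftrightarrow> metric_connection D \<and> (\<forall>x y. D x (J y) = J (D x y))"

definition is_levi_civita ::
  "('a::real_inner \<Rightarrow> 'a \<Rightarrow> 'a) \<Rightarrow> ('a \<Rightarrow> 'a \<Rightarrow> 'a) \<Rightarrow> bool" where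
  "is_levi_civita br D \<longleftrightarrow> metric_connection D \<and> (\<forall>x y. torsion br D x y = 0)"

definition is_chern ::
  "('a::real_inner \<Rightarrow> 'a \<Rightarrow> 'a) \<Rightarrow> ('a \<Rightarrow> 'a) \<Rightarrow> ('a \<Rightarrow> 'a \<Rightarrow> 'a) \<Rightarrow> bool" where
  "is_chern br J D \<longleftrightarrow> hermitian_connection J D \<and>
     (\<forall>X\<in>type_1_0 J. \<forall>Y\<in>type_1_0 J.
        torsion (cx_bilinear_ext br) (cx_bilinear_ext D) X (cx_conj Y) = 0)"

definition is_bismut ::
  "('a::real_inner \<Rightarrow> 'a \<Rightarrow> 'a) \<Rightarrow> ('a \<Rightarrow> 'a) \<Rightarrow> ('a \<Rightarrow> 'a \<Rightarrow> 'a) \<Rightarrow> bool" where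
  "is_bismut br J D \<longleftrightarrow> hermitian_connection J D \<and>
     (\<forall>x y z. torsion br D x y \<bullet> z = - (torsion br D y x \<bullet> z) \<and>
              torsion br D x y \<bullet> z = - (torsion br D x z \<bullet> y))"

text \<open>Existence and uniqueness of the three connections are proved at the end of this theory.\<close>

definition levi_civita :: "('a::real_inner \<Rightarrow> 'a \<Rightarrow> 'a) \<Rightarrow> 'a \<Rightarrow> 'a \<Rightarrow> 'a" where
  "levi_civita br = (THE D. is_levi_civita br D)"

definition chern :: "('a::real_inner \<Rightarrow> 'a \<Rightarrow> 'a) \<Rightarrow> ('a \<Rightarrow> 'a) \<Rightarrow> 'a \<Rightarrow> 'a \<Rightarrow> 'a" where
  "chern br J = (THE D. is_chern br J D)"

definition bismut :: "('a::real_inner \<Rightarrow> 'a \<Rightarrow> 'a) \<Rightarrow> ('a \<Rightarrow> 'a) \<Rightarrow> 'a \<Rightarrow> 'a \<Rightarrow> 'a" where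
  "bismut br J = (THE D. is_bismut br J D)"

definition gauduchon_connection ::
  "('a::real_inner \<Rightarrow> 'a \<Rightarrow> 'a) \<Rightarrow> ('a \<Rightarrow> 'a) \<Rightarrow> real \<Rightarrow> 'a \<Rightarrow> 'a \<Rightarrow> 'a" where
  "gauduchon_connection br J r x y =
     ((1 + r) / 2) *\<^sub>R chern br J x y + ((1 - r) / 2) *\<^sub>R bismut br J x y"

definition canonical_connection ::
  "('a::real_inner \<Rightarrow> 'a \<Rightarrow> 'a) \<Rightarrow> ('a \<Rightarrow> 'a) \<Rightarrow> real \<Rightarrow> real \<Rightarrow> 'a \<Rightarrow> 'a \<Rightarrow> 'a" where
  "canonical_connection br J r s x y =
     (1 - s) *\<^sub>R gauduchon_connection br J r x y + s *\<^sub>R levi_civita br x y"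

definition Omega :: "(real \<times> real) set" where
  "Omega = {(r, s). s \<noteq> 1} \<union> {(0, 1)}"

definition hol_sec_curvature ::
  "('a::real_inner \<Rightarrow> 'a \<Rightarrow> 'a) \<Rightarrow> ('a \<Rightarrow> 'a \<Rightarrow> 'a) \<Rightarrow> 'a cx \<Rightarrow> complex" where
  "hol_sec_curvature br D X =
     cx_inner (curvature (cx_bilinear_ext br) (cx_bilinear_ext D) X (cx_conj X) X) (cx_conj X)
     / (cx_inner X (cx_conj X))\<^sup>2"

definition constant_hol_sec_curvature ::
  "('a::real_inner \<Rightarrow> 'a \<Rightarrow> 'a) \<Rightarrow> ('a \<Rightarrow> 'a) \<Rightarrow> ('a \<Rightarrow> 'a \<Rightarrow> 'a) \<Rightarrow> bool" where
  "constant_hol_sec_curvature br J D \<longleftrightarrow>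
     (\<exists>c. \<forall>X\<in>type_1_0 J. X \<noteq> 0 \<longrightarrow> hol_sec_curvature br D X = c)"

definition flat :: "('a::real_inner \<Rightarrow> 'a \<Rightarrow> 'a) \<Rightarrow> ('a \<Rightarrow> 'a \<Rightarrow> 'a) \<Rightarrow> bool" where
  "flat br D \<longleftrightarrow> (\<forall>x y z. curvature br D x y z = 0)"

definition kaehler_form :: "('a::real_inner \<Rightarrow> 'a) \<Rightarrow> 'a \<Rightarrow> 'a \<Rightarrow> real" where
  "kaehler_form J x y = J x \<bullet> y"

text \<open>Exterior derivative of a left-invariant 2-form, evaluated on left-invariant fields.\<close>

definition d_two_form ::
  "('a \<Rightarrow> 'a \<Rightarrow> 'a) \<Rightarrow> ('a \<Rightarrow> 'a \<Rightarrow> real) \<Rightarrow> 'a \<Rightarrow> 'a \<Rightarrow> 'a \<Rightarrow> real" where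
  "d_two_form br w x y z = - w (br x y) z + w (br x z) y - w (br y z) x"

definition kaehler :: "('a::real_inner \<Rightarrow> 'a \<Rightarrow> 'a) \<Rightarrow> ('a \<Rightarrow> 'a) \<Rightarrow> bool" where
  "kaehler br J \<longleftrightarrow> (\<forall>x y z. d_two_form br (kaehler_form J) x y z = 0)"

definition kaehler_flat :: "('a::real_inner \<Rightarrow> 'a \<Rightarrow> 'a) \<Rightarrow> ('a \<Rightarrow> 'a) \<Rightarrow> bool" where
  "kaehler_flat br J \<longleftrightarrow> kaehler br J \<and> flat br (levi_civita br)"

definition chern_flat :: "('a::real_inner \<Rightarrow> 'a \<Rightarrow> 'a) \<Rightarrow> ('a \<Rightarrow> 'a) \<Rightarrow> bool" where
  "chern_flat br J \<longleftrightarrow> flat br (chern br J)"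

lemma canonical_connection_1_0: "canonical_connection br J 1 0 = chern br J"
  by (simp add: fun_eq_iff canonical_connection_def gauduchon_connection_def)

lemma lie_bracket_anticommute:
  assumes "bilinear br" "\<And>x. br x x = 0"
  shows "br x y = - br y x"
proof -
  have "br (x + y) (x + y) = br x x + br x y + (br y x + br y y)"
    by (simp only: bilinear_ladd[OF assms(1)] bilinear_radd[OF assms(1)] ac_simps)
  then show ?thesis by (simp add: assms(2) eq_neg_iff_add_eq_0)
qed

lemma quotient_abelian_iff:
  assumes br: "bilinear br" "\<And>x. br x x = 0" and I: "lie_ideal br I"
  shows "quotient_abelian br I \<longleftrightarrow> (\<forall>x y. br x y \<in> I)"
proof -
  have sub: "subspace I" using I by (auto simp: lie_ideal_def)
  have coset: "(+) x ` I = I \<longleftrightarrow> x \<in> I" for x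
  proof
    assume "(+) x ` I = I"
    moreover have "x \<in> (+) x ` I" using subspace_0[OF sub] by (force intro: image_eqI[of _ _ 0])
    ultimately show "x \<in> I" by simp
  next
    assume x: "x \<in> I"
    have "y \<in> (+) x ` I" if "y \<in> I" for y
      using subspace_diff[OF sub that x] by (intro image_eqI[of _ _ "y - x"]) auto
    then show "(+) x ` I = I" using subspace_add[OF sub x] by auto
  qed
  show ?thesis
  proof
    assume q: "quotient_abelian br I"
    show "\<forall>x y. br x y \<in> I"
    proof (intro allI)
      fix x y
      have "br x y + 0 \<in> quotient_bracket br I ((+) x ` I) ((+) y ` I)"
        unfolding quotient_bracket_def using subspace_0[OF sub]
        by (intro UN_I[of x] UN_I[of y] imageI) (auto intro: image_eqI[of _ _ 0])
      then show "br x y \<in> I"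
        using q by (auto simp: quotient_abelian_def quotient_carrier_def)
    qed
  next
    assume "\<forall>x y. br x y \<in> I"
    then have *: "(+) (br x y) ` I = I" for x y using coset by blast
    have "quotient_bracket br I P Q = I" if "P \<noteq> {}" "Q \<noteq> {}" for P Q
      unfolding quotient_bracket_def * using that by auto
    moreover have "(+) x ` I \<noteq> {}" for x using subspace_0[OF sub] by blast
    ultimately show "quotient_abelian br I"
      by (auto simp: quotient_abelian_def quotient_carrier_def)
  qed
qed

lemma exists_connection:
  fixes K :: "'a::euclidean_space \<Rightarrow> 'a \<Rightarrow> 'a \<Rightarrow> real"
  assumes "\<And>y z. linear (\<lambda>x. K x y z)" "\<And>x z. linear (\<lambda>y. K x y z)" "\<And>x y. linear (K x y)"
  obtains D where "bilinear D" "\<And>x y z. D x y \<bullet> z = K x y z"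
proof
  let ?D = "\<lambda>x y. \<Sum>b\<in>Basis. K x y b *\<^sub>R b"
  show *: "?D x y \<bullet> z = K x y z" for x y z
  proof -
    have "K x y z = K x y (\<Sum>b\<in>Basis. (z \<bullet> b) *\<^sub>R b)" by (simp add: euclidean_representation)
    also have "\<dots> = (\<Sum>b\<in>Basis. (z \<bullet> b) * K x y b)"
      by (simp add: linear_sum[OF assms(3)] linear_scale[OF assms(3)] o_def)
    finally show ?thesis by (simp add: inner_sum_left inner_commute[of z] mult.commute)
  qed
  show "bilinear ?D"
    unfolding bilinear_def
    by (intro conjI allI linearI; rule vector_eq_rdot[THEN iffD1];
        simp only: * inner_add_left inner_scaleR_left;
        simp add: linear_add[OF assms(1)] linear_add[OF assms(2)]
          linear_scale[OF assms(1)] linear_scale[OF assms(2)])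
qed

lemma ex1_levi_civita:
  fixes br :: "'a::euclidean_space \<Rightarrow> 'a \<Rightarrow> 'a"
  assumes "lie_bracket br"
  shows "\<exists>!D. is_levi_civita br D"
proof -
  have bil: "bilinear br" and br0: "br x x = 0" for x
    using assms by (auto simp: lie_bracket_def)
  note bs = bilinear_ladd[OF bil] bilinear_radd[OF bil] bilinear_lmul[OF bil] bilinear_rmul[OF bil]
  note anti = lie_bracket_anticommute[OF bil br0]
  let ?K = "\<lambda>x y z. (br x y \<bullet> z - br y z \<bullet> x + br z x \<bullet> y) / 2"
  obtain D where D: "bilinear D" "\<And>x y z. D x y \<bullet> z = ?K x y z"
  proof (rule exists_connection[of ?K])
  qed (auto intro!: linearI simp: bs inner_add_left inner_add_right field_simps)
  have D_lc: "is_levi_civita br D"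
    unfolding is_levi_civita_def metric_connection_def
  proof (intro conjI allI)
    show "D x y \<bullet> z + y \<bullet> D x z = 0" for x y z
      unfolding inner_commute[of y] D(2)
      using anti[of x y] anti[of x z] anti[of y z] by (simp add: field_simps)
    show "torsion br D x y = 0" for x y
    proof (rule vector_eq_rdot[THEN iffD1], rule allI)
      fix z
      show "torsion br D x y \<bullet> z = 0 \<bullet> z"
        unfolding torsion_def inner_diff_left D(2)
        using anti[of x y] anti[of x z] anti[of y z] by (simp add: field_simps)
    qed
  qed (fact D(1))
  have "E = D" if E: "is_levi_civita br E" for E
  proof (intro ext)
    fix x y
    have m: "E u v \<bullet> w + E u w \<bullet> v = 0" and t: "E u v \<bullet> w - E v u \<bullet> w = br u v \<bullet> w" for u v w
    proof -
      show "E u v \<bullet> w + E u w \<bullet> v = 0"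
        using E by (simp add: is_levi_civita_def metric_connection_def inner_commute[of _ v])
      show "E u v \<bullet> w - E v u \<bullet> w = br u v \<bullet> w"
        using E by (simp add: is_levi_civita_def torsion_def flip: inner_diff_left)
    qed
    show "E x y = D x y"
    proof (rule vector_eq_rdot[THEN iffD1], rule allI)
      fix z
      show "E x y \<bullet> z = D x y \<bullet> z"
        unfolding D(2)
        using m[of x y z] m[of y z x] m[of z x y] t[of x y z] t[of y z x] t[of z x y] by simp
    qed
  qed
  with D_lc show ?thesis by blast
qed

lemma type_1_0_iff:
  assumes "linear J" "\<And>x. J (J x) = - x"
  shows "X \<in> type_1_0 J \<longleftrightarrow> (\<exists>x. X = (x, - J x))"
proof -
  have "X \<in> type_1_0 J \<longleftrightarrow> J (fst X) = - snd X \<and> J (snd X) = fst X"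
    by (simp add: type_1_0_def cx_linear_ext_def cx_scale_def)
  also have "\<dots> \<longleftrightarrow> X = (fst X, - J (fst X))"
    using assms by (cases X) (auto simp: linear_neg)
  also have "\<dots> \<longleftrightarrow> (\<exists>x. X = (x, - J x))" by auto
  finally show ?thesis .
qed

lemma chern_torsion_iff:
  assumes br: "bilinear br" and J: "linear J" "\<And>x. J (J x) = - x" and D: "bilinear D"
  shows "(\<forall>X\<in>type_1_0 J. \<forall>Y\<in>type_1_0 J.
            torsion (cx_bilinear_ext br) (cx_bilinear_ext D) X (cx_conj Y) = 0)
     \<longleftrightarrow> (\<forall>x y. torsion br D (J x) y = torsion br D x (J y))"
    (is "?L \<longleftrightarrow> ?R")
proof -
  note s = bilinear_lneg[OF br] bilinear_rneg[OF br] bilinear_lneg[OF D] bilinear_rneg[OF D]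
  have eq: "torsion (cx_bilinear_ext br) (cx_bilinear_ext D) (x, - J x) (cx_conj (y, - J y))
     = (torsion br D x y + torsion br D (J x) (J y),
        torsion br D x (J y) - torsion br D (J x) y)" for x y
    by (simp add: torsion_def cx_bilinear_ext_def cx_conj_def s)
  have "?L \<longleftrightarrow> (\<forall>x y. torsion br D x y + torsion br D (J x) (J y) = 0 \<and>
                      torsion br D x (J y) - torsion br D (J x) y = 0)"
  proof -
    have "?L \<longleftrightarrow> (\<forall>x y. torsion (cx_bilinear_ext br) (cx_bilinear_ext D)
        (x, - J x) (cx_conj (y, - J y)) = 0)"
      by (metis type_1_0_iff[OF J])
    then show ?thesis by (simp add: eq zero_prod_def)
  qed
  also have "\<dots> \<longleftrightarrow> ?R"
  proof
    assume R: ?R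
    have "torsion br D (J x) (J y) = - torsion br D x y" for x y
    proof -
      have "torsion br D (J x) (J y) = torsion br D x (J (J y))" using R by blast
      also have "\<dots> = - torsion br D x y" by (simp add: J torsion_def s)
      finally show ?thesis .
    qed
    with R show "\<forall>x y. torsion br D x y + torsion br D (J x) (J y) = 0 \<and>
                      torsion br D x (J y) - torsion br D (J x) y = 0" by simp
  qed (auto simp: algebra_simps)
  finally show ?thesis .
qed

lemma ex1_chern:
  fixes br :: "'a::euclidean_space \<Rightarrow> 'a \<Rightarrow> 'a"
  assumes "hermitian_lie_algebra br J"
  shows "\<exists>!D. is_chern br J D"
proof -
  have bil: "bilinear br" and br0: "br x x = 0" and J: "linear J" and JJ: "J (J x) = - x"
    and int: "br x y - br (J x) (J y) + J (br (J x) y) + J (br x (J y)) = 0"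
    and iso: "J x \<bullet> J y = x \<bullet> y" for x y
    using assms
    by (auto simp: hermitian_lie_algebra_def lie_bracket_def integrable_complex_structure_def)
  note bs = bilinear_ladd[OF bil] bilinear_radd[OF bil] bilinear_lmul[OF bil] bilinear_rmul[OF bil]
    bilinear_lneg[OF bil] bilinear_rneg[OF bil]
  note Js = linear_add[OF J] linear_scale[OF J] linear_neg[OF J] linear_diff[OF J]
  note anti = lie_bracket_anticommute[OF bil br0]
  have skew: "J u \<bullet> v = - (u \<bullet> J v)" for u v
    using iso[of u "J v"] by (simp add: JJ)
  have antii: "br u v \<bullet> w = - (br v u \<bullet> w)" for u v w
    by (subst anti) simp
  have inti: "br u v \<bullet> w - br (J u) (J v) \<bullet> w - br (J u) v \<bullet> J w - br u (J v) \<bullet> J w = 0" for u v w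
    using arg_cong[OF int[of u v], of "\<lambda>t. t \<bullet> w"] by (simp add: inner_add_left inner_diff_left skew)
  let ?q = "\<lambda>x y z. (br x y \<bullet> z + br (J x) (J y) \<bullet> z - br (J x) y \<bullet> J z + br x (J y) \<bullet> J z) / 4"
  let ?K = "\<lambda>x y z. ?q x y z - ?q x z y"
  obtain D where D: "bilinear D" "\<And>x y z. D x y \<bullet> z = ?K x y z"
  proof (rule exists_connection[of ?K])
  qed (auto intro!: linearI simp: bs Js inner_add_left inner_add_right field_simps)
  have "is_chern br J D"
    unfolding is_chern_def hermitian_connection_def metric_connection_def
      chern_torsion_iff[OF bil J JJ D(1)]
  proof (intro conjI allI)
    show "D x y \<bullet> z + y \<bullet> D x z = 0" for x y z
      unfolding inner_commute[of y] D(2) by simp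
    show "D x (J y) = J (D x y)" for x y
    proof (rule vector_eq_rdot[THEN iffD1], rule allI)
      fix z
      show "D x (J y) \<bullet> z = J (D x y) \<bullet> z"
        unfolding skew D(2) by (simp add: JJ bs field_simps)
    qed
    show "torsion br D (J x) y = torsion br D x (J y)" for x y
    proof (rule vector_eq_rdot[THEN iffD1], rule allI)
      fix z
      note i = inti[of x y z] inti[of x y "J z"] inti[of y z x] inti[of y z "J x"]
        inti[of z x y] inti[of z x "J y"]
      note a = antii[of y x] antii[of "J y" x] antii[of y "J x"] antii[of "J y" "J x"]
        antii[of z x] antii[of "J z" x] antii[of z "J x"] antii[of "J z" "J x"]
        antii[of z y] antii[of "J z" y] antii[of z "J y"] antii[of "J z" "J y"]
      show "torsion br D (J x) y \<bullet> z = torsion br D x (J y) \<bullet> z"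
        unfolding torsion_def inner_diff_left D(2) using i
        by (simp (no_asm_use) only: JJ bs a inner_minus_left inner_minus_right minus_minus) argo
    qed
  qed (fact D(1))
  moreover have "E = D" if E: "is_chern br J E" for E
  proof (intro ext)
    fix x y
    have bE: "bilinear E" and m: "E u v \<bullet> w + E u w \<bullet> v = 0" and p: "E u (J v) = J (E u v)" for u v w
      using E by (simp_all add: is_chern_def hermitian_connection_def metric_connection_def
          inner_commute[of _ v])
    have t: "torsion br E (J u) v = torsion br E u (J v)" for u v
      using E chern_torsion_iff[OF bil J JJ bE] by (auto simp: is_chern_def)
    have t': "E (J u) v \<bullet> w + E v u \<bullet> J w - br (J u) v \<bullet> w
        = - (E u v \<bullet> J w) - E (J v) u \<bullet> w - br u (J v) \<bullet> w" for u v w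
      using arg_cong[OF t[of u v], of "\<lambda>a. a \<bullet> w"]
      by (simp add: torsion_def p inner_diff_left skew)
    have q: "E u v \<bullet> w - E (J u) v \<bullet> J w = 2 * ?q u v w" for u v w
      using t'[of u v "J w"] t'[of u "J v" w] inti[of u v w]
      by (simp add: p JJ skew bs bilinear_lneg[OF bE] bilinear_rneg[OF bE] Js field_simps)
    show "E x y = D x y"
    proof (rule vector_eq_rdot[THEN iffD1], rule allI)
      fix z
      have "E (J x) z \<bullet> J y = - (E (J x) (J y) \<bullet> z)" using m[of "J x" z "J y"] by simp
      then have "E (J x) z \<bullet> J y = E (J x) y \<bullet> J z" by (simp add: p skew)
      then show "E x y \<bullet> z = D x y \<bullet> z"
        unfolding D(2) using q[of x y z] q[of x z y] m[of x y z] by argo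
    qed
  qed
  ultimately show ?thesis by blast
qed

lemma ex1_bismut:
  fixes br :: "'a::euclidean_space \<Rightarrow> 'a \<Rightarrow> 'a"
  assumes "hermitian_lie_algebra br J"
  shows "\<exists>!D. is_bismut br J D"
proof -
  have bil: "bilinear br" and br0: "br x x = 0" and J: "linear J" and JJ: "J (J x) = - x"
    and int: "br x y - br (J x) (J y) + J (br (J x) y) + J (br x (J y)) = 0"
    and iso: "J x \<bullet> J y = x \<bullet> y" for x y
    using assms
    by (auto simp: hermitian_lie_algebra_def lie_bracket_def integrable_complex_structure_def)
  note bs = bilinear_ladd[OF bil] bilinear_radd[OF bil] bilinear_lmul[OF bil] bilinear_rmul[OF bil]
    bilinear_lneg[OF bil] bilinear_rneg[OF bil]
  note Js = linear_add[OF J] linear_scale[OF J] linear_neg[OF J] linear_diff[OF J]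
  note anti = lie_bracket_anticommute[OF bil br0]
  have skew: "J u \<bullet> v = - (u \<bullet> J v)" for u v
    using iso[of u "J v"] by (simp add: JJ)
  have antii: "br u v \<bullet> w = - (br v u \<bullet> w)" for u v w
    by (subst anti) simp
  have inti: "br u v \<bullet> w - br (J u) (J v) \<bullet> w - br (J u) v \<bullet> J w - br u (J v) \<bullet> J w = 0" for u v w
    using arg_cong[OF int[of u v], of "\<lambda>t. t \<bullet> w"] by (simp add: inner_add_left inner_diff_left skew)
  let ?K = "\<lambda>x y z. (br x y \<bullet> z - br y z \<bullet> x + br z x \<bullet> y
      - br (J x) (J y) \<bullet> z - br (J y) (J z) \<bullet> x - br (J z) (J x) \<bullet> y) / 2"
  obtain D where D: "bilinear D" "\<And>x y z. D x y \<bullet> z = ?K x y z"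
  proof (rule exists_connection[of ?K])
  qed (auto intro!: linearI simp: bs Js inner_add_left inner_add_right field_simps)
  have "is_bismut br J D"
    unfolding is_bismut_def hermitian_connection_def metric_connection_def
  proof (intro conjI allI)
    fix x y z
    note a = antii[of y x] antii[of "J y" x] antii[of y "J x"] antii[of "J y" "J x"]
        antii[of z x] antii[of "J z" x] antii[of z "J x"] antii[of "J z" "J x"]
        antii[of z y] antii[of "J z" y] antii[of z "J y"] antii[of "J z" "J y"]
    show "D x y \<bullet> z + y \<bullet> D x z = 0"
      unfolding inner_commute[of y] D(2) by (simp add: a field_simps)
    show "torsion br D x y \<bullet> z = - (torsion br D y x \<bullet> z)"
      by (simp add: torsion_def inner_diff_left antii[of y x])
    show "torsion br D x y \<bullet> z = - (torsion br D x z \<bullet> y)"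
      unfolding torsion_def inner_diff_left D(2) by (simp add: a field_simps)
  next
    show "D x (J y) = J (D x y)" for x y
    proof (rule vector_eq_rdot[THEN iffD1], rule allI)
      fix z
      note i = inti[of x y z] inti[of x y "J z"] inti[of y z x] inti[of y z "J x"]
        inti[of z x y] inti[of z x "J y"]
      note a = antii[of y x] antii[of "J y" x] antii[of y "J x"] antii[of "J y" "J x"]
        antii[of z x] antii[of "J z" x] antii[of z "J x"] antii[of "J z" "J x"]
        antii[of z y] antii[of "J z" y] antii[of z "J y"] antii[of "J z" "J y"]
      show "D x (J y) \<bullet> z = J (D x y) \<bullet> z"
        unfolding skew D(2) using i
        by (simp (no_asm_use) only: JJ bs a inner_minus_left inner_minus_right minus_minus) argo
    qed
  qed (fact D(1))
  moreover have "E = F" if E: "is_bismut br J E" and F: "is_bismut br J F" for E F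
  proof (intro ext)
    fix x y
    define G where "G = (\<lambda>u v w. E u v \<bullet> w - F u v \<bullet> w)"
    have m: "G u v w = - G u w v" and p: "G u (J v) w = - G u v (J w)" for u v w
    proof -
      have "E u v \<bullet> w + v \<bullet> E u w = 0" "F u v \<bullet> w + v \<bullet> F u w = 0"
        using E F by (auto simp: is_bismut_def hermitian_connection_def metric_connection_def)
      then show "G u v w = - G u w v"
        unfolding G_def inner_commute[of v] by linarith
      show "G u (J v) w = - G u v (J w)"
        using E F by (auto simp: G_def is_bismut_def hermitian_connection_def skew)
    qed
    have t: "G u v w - G v u w = - (G u w v - G w u v)" for u v w
    proof -
      have "torsion br E u v \<bullet> w = - (torsion br E u w \<bullet> v)"
        "torsion br F u v \<bullet> w = - (torsion br F u w \<bullet> v)"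
        using E F unfolding is_bismut_def by blast+
      then show ?thesis unfolding G_def torsion_def inner_diff_left by linarith
    qed
    have s: "G u v w = - G v u w" for u v w
      using t[of u v w] t[of v w u] t[of w u v] m[of u v w] m[of v w u] m[of w u v] by linarith
    show "E x y = F x y"
    proof (rule vector_eq_rdot[THEN iffD1], rule allI)
      fix z
      have flip: "G (J u) v w = - G u (J v) w" for u v w
        using s[of "J u" v w] m[of v "J u" w] s[of v w "J u"] m[of w v "J u"] p[of w u v]
          m[of w u "J v"] s[of w "J v" u] m[of "J v" w u] s[of "J v" u w] by linarith
      have flip': "G (J u) v w = - G u v (J w)" for u v w
        using m[of "J u" v w] flip[of u w v] m[of u "J w" v] by linarith
      have zero: "G (J u) v w = 0" for u v w
        using flip[of u v w] flip'[of u v w] p[of u v w] by linarith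
      have "G (J (- J x)) y z = 0" by (rule zero)
      then show "E x y \<bullet> z = F x y \<bullet> z" by (simp add: Js JJ G_def)
    qed
  qed
  ultimately show ?thesis by blast
qed

lemma is_levi_civita_levi_civita: "lie_bracket br \<Longrightarrow> is_levi_civita br (levi_civita br)"
  for br :: "'a::euclidean_space \<Rightarrow> 'a \<Rightarrow> 'a"
  unfolding levi_civita_def by (rule theI'[OF ex1_levi_civita])

lemma is_chern_chern: "hermitian_lie_algebra br J \<Longrightarrow> is_chern br J (chern br J)"
  unfolding chern_def by (rule theI'[OF ex1_chern])

lemma is_bismut_bismut: "hermitian_lie_algebra br J \<Longrightarrow> is_bismut br J (bismut br J)"
  unfolding bismut_def by (rule theI'[OF ex1_bismut])

end

theory Submission
  imports Defs
begin

text \<open>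
  On \<open>X = x - \<i> J x\<close> the curvature condition reads \<open>Q \<tau> x = c |x|\<^sup>4\<close> for a quartic form that depends on the connection only
  through a number \<open>\<tau> \<ge> 0\<close>, and \<open>\<tau> = 0\<close> exactly for the Chern connection. Everything follows from the polarizations of this
  identity, traced over the ideal with the help of unimodularity.

  If the abelian ideal is complex, its complement acts on it by two operators. A negative \<open>c\<close> is excluded by
  comparing coefficients at an eigenvector of a symmetric part, and for \<open>c = 0\<close> the trace of the polarized identity kills the parts
  that do not commute with \<open>J\<close>.

  Otherwise let \<open>I = \<aa> \<inter> J \<aa>\<close>, of real codimension four. If \<open>c < 0\<close>, the complement acts on \<open>I\<close> by scalars up to skew maps,
  and the polarizations together with the Jacobi identity leave an inconsistent system for finitely many structure constants.
  If \<open>c = 0\<close>, either the complement acts with a nonzero trace, which forces \<open>\<tau> = 0\<close> and yields a larger abelian ideal that is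
  complex, or the left-symmetric product \<open>[J x, y]\<close> on the real part of the ideal vanishes. In all cases the algebra becomes a
  semidirect product of abelian algebras, whose Levi-Civita and Chern connections are explicit and flat.
\<close>

section \<open>The holomorphic sectional curvature as a quartic form\<close>

text \<open>The sign \<open>c <= 0\<close> is cheap: in the complex case it comes from evaluation at
  a unit vector of the complement, otherwise from evaluation on \<open>I\<close> when
  \<open>I\<close> is not zero. The work is to exclude \<open>c < 0\<close> and to extract rigidity
  from \<open>c = 0\<close>.

  The obstacle is that the polarized identities carry no sign pointwise: products of a symmetric and
  a skew part, or differences \<open>|C\<^sup>T v|^2 - |C v|^2\<close>, can have either sign.
  Summation over an orthonormal basis removes both kinds, because symmetric and skew maps are
  orthogonal for the trace form and \<open>C C\<^sup>T\<close> and \<open>C\<^sup>T C\<close> have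
  the same trace. Traces of the Jacobi identity compare the remaining squares, and unimodularity
  ties the traces of the action on the ideal to the other structure constants.

  The Chern case differs because the terms with factor \<open>\<tau>\<close> are the ones that
  control the symmetric parts of the action. For \<open>\<tau> > 0\<close> the action becomes skew.
  For \<open>\<tau> = 0\<close> symmetric parts survive, and what is left is normality of a
  Dolbeault operator, which still suffices for commuting connection operators.\<close>

lemma linear_trace_adjoint:
  fixes f :: "'a::euclidean_space \<Rightarrow> 'a"
  assumes "linear f" shows "linear_trace (adjoint f) = linear_trace f"
  unfolding linear_trace_def using adjoint_works[OF assms] by (simp add: inner_commute)

lemma linear_trace_compose:
  fixes f g :: "'a::euclidean_space \<Rightarrow> 'a"
  assumes "linear f" "linear g"
  shows "linear_trace (\<lambda>x. f (g x)) = linear_trace (\<lambda>x. g (f x))"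
proof -
  have *: "linear_trace (\<lambda>x. f (g x)) = (\<Sum>b\<in>Basis. \<Sum>d\<in>Basis. (g b \<bullet> d) * (f d \<bullet> b))"
    if "linear f" "linear g" for f g :: "'a \<Rightarrow> 'a"
  proof -
    have "f (g b) \<bullet> b = (\<Sum>d\<in>Basis. (g b \<bullet> d) * (f d \<bullet> b))" for b
    proof -
      have "f (g b) = f (\<Sum>d\<in>Basis. (g b \<bullet> d) *\<^sub>R d)" by (simp add: euclidean_representation)
      also have "\<dots> = (\<Sum>d\<in>Basis. (g b \<bullet> d) *\<^sub>R f d)"
        by (simp add: linear_sum[OF that(1)] linear_scale[OF that(1)])
      finally show ?thesis by (simp add: inner_sum_left)
    qed
    then show ?thesis by (simp add: linear_trace_def)
  qed
  show ?thesis unfolding *[OF assms] *[OF assms(2,1)] by (subst sum.swap) (simp add: mult.commute)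
qed

section \<open>The three connections in terms of the adjoint action and its transpose\<close>

locale hermitian_lie =
  fixes br :: "'a::euclidean_space \<Rightarrow> 'a \<Rightarrow> 'a" and J :: "'a \<Rightarrow> 'a"
  assumes hermitian: "hermitian_lie_algebra br J"
begin

lemma lie: "lie_bracket br" and bil: "bilinear br" and br_self [simp]: "br x x = 0"
  and jacobi: "br x (br y z) + br y (br z x) + br z (br x y) = 0"
  and linJ: "linear J" and JJ [simp]: "J (J x) = - x"
  and integrable: "br x y - br (J x) (J y) + J (br (J x) y) + J (br x (J y)) = 0"
  and iso [simp]: "J x \<bullet> J y = x \<bullet> y"
  using hermitian
  by (auto simp: hermitian_lie_algebra_def lie_bracket_def integrable_complex_structure_def)

lemmas Js [simp] = linear_add[OF linJ] linear_scale[OF linJ] linear_neg[OF linJ]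
  linear_diff[OF linJ] linear_0[OF linJ]
lemmas brs [simp] = bilinear_ladd[OF bil] bilinear_radd[OF bil] bilinear_lmul[OF bil]
  bilinear_rmul[OF bil] bilinear_lneg[OF bil] bilinear_rneg[OF bil] bilinear_lsub[OF bil]
  bilinear_rsub[OF bil] bilinear_lzero[OF bil] bilinear_rzero[OF bil]
lemmas br_neg = bilinear_lneg[OF bil] bilinear_rneg[OF bil]
lemmas br_anti = lie_bracket_anticommute[OF bil br_self]

lemma J_skew: "J x \<bullet> y = - (x \<bullet> J y)" using iso[of x "J y"] by simp
lemma J_orth [simp]: "x \<bullet> J x = 0" "J x \<bullet> x = 0"
  using J_skew[of x x] by (simp_all add: inner_commute)

text \<open>Transposed adjoint action. With it the connections are given by vectors, and the
  curvature becomes a few scalar products without sums over a basis.\<close>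

definition S :: "'a \<Rightarrow> 'a \<Rightarrow> 'a" where "S x = adjoint (br x)"

lemma linear_br: "linear (br x)" using bil by (simp add: bilinear_def)
lemma S_inner: "S x y \<bullet> z = y \<bullet> br x z"
  unfolding S_def using adjoint_works[OF linear_br] by (simp add: inner_commute)
lemma inner_S: "z \<bullet> S x y = y \<bullet> br x z" by (simp add: inner_commute[of z] S_inner)

lemma bilinear_S: "bilinear S"
  unfolding bilinear_def
  by (intro conjI allI linearI; rule vector_eq_rdot[THEN iffD1];
      simp add: S_inner inner_add_left inner_add_right)
lemmas Ss [simp] = bilinear_ladd[OF bilinear_S] bilinear_radd[OF bilinear_S] bilinear_lmul[OF bilinear_S]
  bilinear_rmul[OF bilinear_S] bilinear_lneg[OF bilinear_S] bilinear_rneg[OF bilinear_S]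
  bilinear_lsub[OF bilinear_S] bilinear_rsub[OF bilinear_S] bilinear_lzero[OF bilinear_S]
  bilinear_rzero[OF bilinear_S]

lemma bilinearI2:
  assumes "\<And>x x' y. D (x + x') y = D x y + D x' y" "\<And>x y y'. D x (y + y') = D x y + D x y'"
    "\<And>r x y. D (r *\<^sub>R x) y = r *\<^sub>R D x y" "\<And>r x y. D x (r *\<^sub>R y) = r *\<^sub>R D x y"
  shows "bilinear D"
  unfolding bilinear_def using assms by (auto intro!: linearI)

text \<open>The Koszul formula for left-invariant fields: the candidate is metric and torsion free,
  and uniqueness identifies it.\<close>

lemma levi_civita_eq: "levi_civita br x y = (1/2) *\<^sub>R (br x y - S x y - S y x)"
proof -
  define E where "E = (\<lambda>x y. (1/2) *\<^sub>R (br x y - S x y - S y x))"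
  have bE: "bilinear E" unfolding E_def
    by (rule bilinearI2) (simp_all add: algebra_simps)
  have a: "br u v \<bullet> w = - (br v u \<bullet> w)" for u v w by (subst br_anti) simp
  have "is_levi_civita br E"
    unfolding is_levi_civita_def metric_connection_def torsion_def
  proof (intro conjI allI bE)
    show "E x y \<bullet> z + y \<bullet> E x z = 0" for x y z
      unfolding E_def inner_scaleR_left inner_scaleR_right inner_diff_left inner_diff_right S_inner inner_S
      using a[of y z x] by (simp add: inner_commute[of y] inner_commute[of x] inner_commute[of z] field_simps)
    show "E x y - E y x - br x y = 0" for x y
      unfolding E_def by (subst br_anti[of y x]) (simp add: algebra_simps flip: scaleR_add_left)
  qed
  then have "levi_civita br = E" unfolding levi_civita_def
    by (rule the1_equality[OF ex1_levi_civita[OF lie]])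
  then show ?thesis by (simp add: E_def)
qed

lemma br_inner_anti: "br u v \<bullet> w = - (br v u \<bullet> w)" by (subst br_anti) simp
lemma integrable_inner:
  "br u v \<bullet> w - br (J u) (J v) \<bullet> w - br (J u) v \<bullet> J w - br u (J v) \<bullet> J w = 0"
  using arg_cong[OF integrable[of u v], of "\<lambda>t. t \<bullet> w"]
  by (simp add: inner_add_left inner_diff_left J_skew)

text \<open>Integrability says exactly that \<open>br x + J (br (J x))\<close> commutes with
  \<open>J\<close>; this is the left-invariant Dolbeault operator. The Chern connection is its skew
  part, hence metric by construction.\<close>

lemma chern_eq: "chern br J x y = (1/2) *\<^sub>R (br x y - S x y + J (br (J x) y) + S (J x) (J y))"
proof -
  define E where "E = (\<lambda>x y. (1/2) *\<^sub>R (br x y - S x y + J (br (J x) y) + S (J x) (J y)))"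
  have bE: "bilinear E" unfolding E_def
    by (rule bilinearI2) (simp_all add: algebra_simps)
  have Ei: "E x y \<bullet> z = (br x y \<bullet> z - br x z \<bullet> y - br (J x) y \<bullet> J z + br (J x) z \<bullet> J y) / 2" for x y z
    unfolding E_def inner_scaleR_left inner_add_left inner_diff_left S_inner J_skew[of "br (J x) y"]
    by (simp add: inner_commute)
  have "is_chern br J E"
    unfolding is_chern_def hermitian_connection_def metric_connection_def
      chern_torsion_iff[OF bil linJ JJ bE]
  proof (intro conjI allI bE)
    show "E x y \<bullet> z + y \<bullet> E x z = 0" for x y z
      unfolding inner_commute[of y] Ei by (simp add: field_simps)
    show "E x (J y) = J (E x y)" for x y
    proof (rule vector_eq_rdot[THEN iffD1], rule allI)
      fix z
      show "E x (J y) \<bullet> z = J (E x y) \<bullet> z"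
        unfolding J_skew Ei using integrable_inner[of x y "J z"] integrable_inner[of x z "J y"]
        by (simp add: field_simps)
    qed
    show "torsion br E (J x) y = torsion br E x (J y)" for x y
    proof (rule vector_eq_rdot[THEN iffD1], rule allI)
      fix z
      note i = integrable_inner[of x y z] integrable_inner[of x y "J z"] integrable_inner[of y z x] integrable_inner[of y z "J x"]
        integrable_inner[of z x y] integrable_inner[of z x "J y"]
      note a = br_inner_anti[of y x] br_inner_anti[of "J y" x] br_inner_anti[of y "J x"] br_inner_anti[of "J y" "J x"]
        br_inner_anti[of z x] br_inner_anti[of "J z" x] br_inner_anti[of z "J x"] br_inner_anti[of "J z" "J x"]
        br_inner_anti[of z y] br_inner_anti[of "J z" y] br_inner_anti[of z "J y"] br_inner_anti[of "J z" "J y"]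
      show "torsion br E (J x) y \<bullet> z = torsion br E x (J y) \<bullet> z"
        unfolding torsion_def inner_diff_left Ei using i
        by (simp (no_asm_use) only: JJ br_neg a inner_minus_left inner_minus_right minus_minus) argo
    qed
  qed
  then have "chern br J = E" unfolding chern_def
    by (rule the1_equality[OF ex1_chern[OF hermitian]])
  then show ?thesis by (simp add: E_def)
qed

text \<open>The terms containing \<open>J\<close> form half of a totally skew three-form, so adding
  them to the Levi-Civita connection produces skew torsion and keeps the connection metric.\<close>

lemma bismut_eq: "bismut br J x y = (1/2) *\<^sub>R (br x y - S x y - S y x - br (J x) (J y)
   + J (S (J y) x) - J (S (J x) y))"
proof -
  define E where "E = (\<lambda>x y. (1/2) *\<^sub>R (br x y - S x y - S y x - br (J x) (J y)
   + J (S (J y) x) - J (S (J x) y)))"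
  have bE: "bilinear E" unfolding E_def
    by (rule bilinearI2) (simp_all add: algebra_simps)
  have Ei: "E x y \<bullet> z = (br x y \<bullet> z - br y z \<bullet> x + br z x \<bullet> y
      - br (J x) (J y) \<bullet> z - br (J y) (J z) \<bullet> x - br (J z) (J x) \<bullet> y) / 2" for x y z
    unfolding E_def using br_inner_anti[of z x y] br_inner_anti[of "J z" "J x" y]
    by (simp add: inner_add_left inner_diff_left S_inner J_skew) (simp add: inner_commute)
  have "is_bismut br J E"
    unfolding is_bismut_def hermitian_connection_def metric_connection_def
  proof (intro conjI allI bE)
    fix x y z
    note a = br_inner_anti[of y x] br_inner_anti[of "J y" x] br_inner_anti[of y "J x"] br_inner_anti[of "J y" "J x"]
        br_inner_anti[of z x] br_inner_anti[of "J z" x] br_inner_anti[of z "J x"] br_inner_anti[of "J z" "J x"]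
        br_inner_anti[of z y] br_inner_anti[of "J z" y] br_inner_anti[of z "J y"] br_inner_anti[of "J z" "J y"]
    show "E x y \<bullet> z + y \<bullet> E x z = 0"
      unfolding inner_commute[of y] Ei by (simp add: a field_simps)
    show "torsion br E x y \<bullet> z = - (torsion br E y x \<bullet> z)"
      by (simp add: torsion_def inner_diff_left br_inner_anti[of y x])
    show "torsion br E x y \<bullet> z = - (torsion br E x z \<bullet> y)"
      unfolding torsion_def inner_diff_left Ei by (simp add: a field_simps)
  next
    show "E x (J y) = J (E x y)" for x y
    proof (rule vector_eq_rdot[THEN iffD1], rule allI)
      fix z
      note i = integrable_inner[of x y z] integrable_inner[of x y "J z"] integrable_inner[of y z x] integrable_inner[of y z "J x"]
        integrable_inner[of z x y] integrable_inner[of z x "J y"]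
      note a = br_inner_anti[of y x] br_inner_anti[of "J y" x] br_inner_anti[of y "J x"] br_inner_anti[of "J y" "J x"]
        br_inner_anti[of z x] br_inner_anti[of "J z" x] br_inner_anti[of z "J x"] br_inner_anti[of "J z" "J x"]
        br_inner_anti[of z y] br_inner_anti[of "J z" y] br_inner_anti[of z "J y"] br_inner_anti[of "J z" "J y"]
      show "E x (J y) \<bullet> z = J (E x y) \<bullet> z"
        unfolding J_skew Ei using i
        by (simp (no_asm_use) only: JJ br_neg a inner_minus_left inner_minus_right minus_minus) argo
    qed
  qed
  then have "bismut br J = E" unfolding bismut_def
    by (rule the1_equality[OF ex1_bismut[OF hermitian]])
  then show ?thesis by (simp add: E_def)
qed

text \<open>Up to normalization \<open>Q \<tau> x\<close> is the holomorphic sectional curvature in the direction \<open>x - \<i> J x\<close>.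
  The connection enters only through \<open>\<tau>\<close>, which measures its distance from the Chern connection.\<close>

definition Phi :: "real \<Rightarrow> 'a \<Rightarrow> 'a \<Rightarrow> 'a \<Rightarrow> 'a \<Rightarrow> 'a \<Rightarrow> real" where
  "Phi \<tau> n1 n2 m1 m2 y = - (n1 \<bullet> n2) + (m1 + m2) \<bullet> (m1 + m2) / 4 - (m2 - m1) \<bullet> y / 2
     - 3 / 4 * (y \<bullet> y) - (\<tau> - 1) / 4 * ((y + J (n1 + n2)) \<bullet> (y + J (n1 + n2)))"

definition Q :: "real \<Rightarrow> 'a \<Rightarrow> real" where
  "Q \<tau> x = Phi \<tau> (S x x) (S (J x) (J x)) (S (J x) x) (S x (J x)) (br x (J x))"

text \<open>On \<open>(x, - J x)\<close> the numerator carries a factor 4, and so does the squared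
  norm \<open>(2 * (x \<bullet> x))\<^sup>2\<close>; the two cancel. The real part is enough because
  the result is compared with a real quartic form.\<close>

lemma hol_sec_curvature_eq:
  assumes "metric_connection D"
  shows "Re (hol_sec_curvature br D (x, - J x)) * (x \<bullet> x)\<^sup>2
     = (if x = 0 then 0 else D x (J x) \<bullet> D (J x) x - D (J x) (J x) \<bullet> D x x - D (br x (J x)) (J x) \<bullet> x)"
proof (cases "x = 0")
  case False
  have bD: "bilinear D" and m: "D x y \<bullet> z = - (y \<bullet> D x z)" for x y z
    using assms by (auto simp: metric_connection_def eq_neg_iff_add_eq_0)
  note ds = bilinear_ladd[OF bD] bilinear_radd[OF bD] bilinear_lneg[OF bD] bilinear_rneg[OF bD]
    bilinear_lsub[OF bD] bilinear_rsub[OF bD] bilinear_lzero[OF bD]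
  have m2: "D u (D v w) \<bullet> z = - (D u z \<bullet> D v w)" for u v w z
    using m[of u "D v w" z] by (simp add: inner_commute)
  have m0: "D u w \<bullet> w = 0" for u w using m[of u w w] by (simp add: inner_commute)
  have m1: "D u w \<bullet> z = - (D u z \<bullet> w)" for u w z using m[of u w z] by (simp add: inner_commute)
  let ?X = "(x, - J x)"
  have nrm: "cx_inner ?X (cx_conj ?X) = of_real (2 * (x \<bullet> x))"
    by (simp add: cx_inner_def cx_conj_def complex_eq_iff)
  have yy: "br (J x) x = - br x (J x)" by (rule br_anti)
  have curv: "Re (cx_inner (curvature (cx_bilinear_ext br) (cx_bilinear_ext D) ?X (cx_conj ?X) ?X) (cx_conj ?X))
     = 4 * (D x (J x) \<bullet> D (J x) x - D (J x) (J x) \<bullet> D x x - D (br x (J x)) (J x) \<bullet> x)"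
    unfolding curvature_def cx_bilinear_ext_def cx_conj_def cx_inner_def
    by (simp add: ds yy inner_diff_left inner_add_left m2 m0 m1[of _ x "J x"])
       (simp add: inner_diff_left inner_diff_right inner_add_left inner_add_right inner_commute)
  show ?thesis
    using False curv unfolding hol_sec_curvature_def nrm
    by (simp del: of_real_mult of_real_power
        add: power_mult_distrib Re_divide_of_real flip: of_real_power of_real_mult)
qed simp

lemma metric_canonical: "metric_connection (canonical_connection br J r s)"
proof -
  have "metric_connection (chern br J)" "metric_connection (bismut br J)" "metric_connection (levi_civita br)"
    using is_chern_chern[OF hermitian] is_bismut_bismut[OF hermitian] is_levi_civita_levi_civita[OF lie]
    by (auto simp: is_chern_def is_bismut_def is_levi_civita_def hermitian_connection_def)
  then have b: "bilinear (chern br J)" "bilinear (bismut br J)" "bilinear (levi_civita br)"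
    and m: "chern br J x y \<bullet> z = - (y \<bullet> chern br J x z)" "bismut br J x y \<bullet> z = - (y \<bullet> bismut br J x z)"
      "levi_civita br x y \<bullet> z = - (y \<bullet> levi_civita br x z)" for x y z
    by (auto simp: metric_connection_def eq_neg_iff_add_eq_0)
  show ?thesis unfolding metric_connection_def
  proof (intro conjI allI bilinearI2)
    show "canonical_connection br J r s x y \<bullet> z + y \<bullet> canonical_connection br J r s x z = 0" for x y z
      unfolding canonical_connection_def gauduchon_connection_def
      by (simp add: inner_add_left inner_add_right m field_simps)
  qed (auto simp: canonical_connection_def gauduchon_connection_def algebra_simps
      bilinear_ladd[OF b(1)] bilinear_ladd[OF b(2)] bilinear_ladd[OF b(3)]
      bilinear_radd[OF b(1)] bilinear_radd[OF b(2)] bilinear_radd[OF b(3)]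
      bilinear_lmul[OF b(1)] bilinear_lmul[OF b(2)] bilinear_lmul[OF b(3)]
      bilinear_rmul[OF b(1)] bilinear_rmul[OF b(2)] bilinear_rmul[OF b(3)])
qed

text \<open>With weights \<open>p\<close> of Chern and \<open>t\<close> of Bismut, all deviations
  from Levi-Civita that occur here are multiples of the vector \<open>w = y + J (n1 + n2)\<close> or
  of \<open>J w\<close>. The linear terms in \<open>w\<close> combine to
  \<open>p / 2 * |w|^2\<close>, so the total coefficient of \<open>|w|^2\<close> is
  \<open>p / 2 - p^2 / 4 - t^2 / 4 = - (\<tau> - 1) / 4\<close> with
  \<open>\<tau> = (1 - p)^2 + t^2\<close>.\<close>

lemma canonical_curvature_eq:
  fixes r s x
  defines "p \<equiv> (1 - s) * (1 + r) / 2" and "t \<equiv> (1 - s) * (1 - r) / 2"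
  defines "D \<equiv> canonical_connection br J r s"
  shows "D x (J x) \<bullet> D (J x) x - D (J x) (J x) \<bullet> D x x - D (br x (J x)) (J x) \<bullet> x = Q ((1 - p)\<^sup>2 + t\<^sup>2) x"
proof -
  have s: "s = 1 - p - t" by (simp add: p_def t_def field_simps)
  have D: "D u v = p *\<^sub>R chern br J u v + t *\<^sub>R bismut br J u v + (1 - p - t) *\<^sub>R levi_civita br u v" for u v
    unfolding D_def canonical_connection_def gauduchon_connection_def s[symmetric]
    by (simp add: p_def t_def scaleR_add_right)
  have D': "D u v = levi_civita br u v + p *\<^sub>R (chern br J u v - levi_civita br u v)
     + t *\<^sub>R (bismut br J u v - levi_civita br u v)" for u v
    unfolding D by (simp add: algebra_simps)
  define y where "y = br x (J x)"
  have yy: "br (J x) x = - y" unfolding y_def by (rule br_anti)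
  define n1 where "n1 = S x x" define n2 where "n2 = S (J x) (J x)"
  define m1 where "m1 = S (J x) x" define m2 where "m2 = S x (J x)"
  note defs = y_def[symmetric] n1_def[symmetric] n2_def[symmetric] m1_def[symmetric] m2_def[symmetric]
  have c: "chern br J x x = levi_civita br x x + (1/2) *\<^sub>R (n1 + n2 - J y)"
    "chern br J (J x) (J x) = levi_civita br (J x) (J x) + (1/2) *\<^sub>R (n1 + n2 - J y)"
    "chern br J x (J x) = levi_civita br x (J x)" "chern br J (J x) x = levi_civita br (J x) x"
    "bismut br J x x = levi_civita br x x" "bismut br J (J x) (J x) = levi_civita br (J x) (J x)"
    "bismut br J x (J x) = levi_civita br x (J x) - (1/2) *\<^sub>R (y + J (n1 + n2))"
    "bismut br J (J x) x = levi_civita br (J x) x + (1/2) *\<^sub>R (y + J (n1 + n2))"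
    unfolding chern_eq bismut_eq levi_civita_eq
    by (simp_all add: yy defs algebra_simps flip: scaleR_add_left)
  have l: "levi_civita br x x = - n1" "levi_civita br (J x) (J x) = - n2"
    "levi_civita br x (J x) = (1/2) *\<^sub>R (y - (m1 + m2))" "levi_civita br (J x) x = - (1/2) *\<^sub>R (y + (m1 + m2))"
    unfolding levi_civita_eq by (simp_all add: yy defs algebra_simps flip: scaleR_add_left)
  have i: "S u y \<bullet> x = y \<bullet> br u x" "S y u \<bullet> x = u \<bullet> br y x" for u by (simp_all add: S_inner)
  have a1: "br y (J x) \<bullet> x = - (m1 \<bullet> y)" "J x \<bullet> br y x = - (m2 \<bullet> y)"
    unfolding m1_def m2_def S_inner by (subst br_anti, simp add: inner_commute)+
  have a2: "x \<bullet> br (J y) x = - (n1 \<bullet> J y)" "J x \<bullet> br (J y) (J x) = - (n2 \<bullet> J y)"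
    unfolding n1_def n2_def S_inner by (subst br_anti, simp add: inner_commute)+
  have l3: "levi_civita br y (J x) \<bullet> x = (m2 - m1) \<bullet> y / 2 + y \<bullet> y / 2"
    unfolding levi_civita_eq inner_scaleR_left inner_diff_left S_inner yy a1 by (simp add: inner_commute)
  have c3: "chern br J y (J x) \<bullet> x = levi_civita br y (J x) \<bullet> x - (y + J (n1 + n2)) \<bullet> y / 2"
  proof -
    have "chern br J y (J x) \<bullet> x = (br y (J x) \<bullet> x - J x \<bullet> br y x - J x \<bullet> br (J y) (J x) - x \<bullet> br (J y) x) / 2"
      unfolding chern_eq inner_scaleR_left inner_diff_left inner_add_left S_inner J_skew[of "br _ _"]
      by (simp add: inner_commute)
    then show ?thesis unfolding l3 a1 a2
      by (simp add: inner_add_left inner_diff_left J_skew field_simps)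
  qed
  have b3: "bismut br J y (J x) \<bullet> x = levi_civita br y (J x) \<bullet> x + (y + J (n1 + n2)) \<bullet> y / 2"
  proof -
    have "bismut br J y (J x) \<bullet> x = levi_civita br y (J x) \<bullet> x
       + (x \<bullet> br (J y) x + y \<bullet> br x (J x) + J x \<bullet> br (J y) (J x)) / 2"
      unfolding bismut_eq levi_civita_eq inner_scaleR_left inner_diff_left inner_add_left J_skew[of "S _ _"] S_inner
      by (simp add: inner_add_left inner_diff_left J_skew[of "S _ _"] S_inner inner_commute field_simps)
    then show ?thesis unfolding a2 y_def[symmetric]
      by (simp add: inner_add_left inner_diff_left J_skew field_simps)
  qed
  have "D (br x (J x)) (J x) \<bullet> x = (m2 - m1) \<bullet> y / 2 + y \<bullet> y / 2 - (p - t) / 2 * ((y + J (n1 + n2)) \<bullet> y)"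
    unfolding D y_def[symmetric] inner_add_left inner_scaleR_left c3 b3 l3 by (simp add: inner_add_left field_simps)
  moreover have "D x x = - n1 + (p / 2) *\<^sub>R (n1 + n2 - J y)"
     "D (J x) (J x) = - n2 + (p / 2) *\<^sub>R (n1 + n2 - J y)"
     "D x (J x) = (1/2) *\<^sub>R (y - (m1 + m2)) - (t / 2) *\<^sub>R (y + J (n1 + n2))"
     "D (J x) x = - (1/2) *\<^sub>R (y + (m1 + m2)) + (t / 2) *\<^sub>R (y + J (n1 + n2))"
    unfolding D' c by (simp_all add: l)
  moreover have "J y \<bullet> n = - (J n \<bullet> y)" "n \<bullet> J y = - (J n \<bullet> y)" for n
    by (simp_all add: J_skew[of y n] J_skew[of n y] inner_commute[of y "J n"])
  ultimately show ?thesis unfolding Q_def Phi_def defs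
    by (simp add: inner_add_left inner_add_right inner_diff_left inner_diff_right power2_eq_square)
       (simp add: inner_commute field_simps)
qed

lemma constant_hol_sec_curvatureD:
  assumes "constant_hol_sec_curvature br J (canonical_connection br J r s)"
  obtains c where "\<And>x. Q ((1 - (1 - s) * (1 + r) / 2)\<^sup>2 + ((1 - s) * (1 - r) / 2)\<^sup>2) x = c * (x \<bullet> x)\<^sup>2"
proof -
  obtain c where c: "\<And>X. X \<in> type_1_0 J \<Longrightarrow> X \<noteq> 0 \<Longrightarrow> hol_sec_curvature br (canonical_connection br J r s) X = c"
    using assms by (auto simp: constant_hol_sec_curvature_def)
  show thesis
  proof
    fix x
    show "Q ((1 - (1 - s) * (1 + r) / 2)\<^sup>2 + ((1 - s) * (1 - r) / 2)\<^sup>2) x = Re c * (x \<bullet> x)\<^sup>2"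
    proof (cases "x = 0")
      case False
      have "(x, - J x) \<in> type_1_0 J" using type_1_0_iff[OF linJ JJ] by blast
      with False have "hol_sec_curvature br (canonical_connection br J r s) (x, - J x) = c"
        by (intro c) (auto simp: zero_prod_def)
      then show ?thesis
        using hol_sec_curvature_eq[OF metric_canonical, of r s x] False
        unfolding canonical_curvature_eq by simp
    qed (simp add: Q_def Phi_def)
  qed
qed

section \<open>Polarization: \<open>Psi\<close> is the polar form of the quadratic form
  \<open>Phi\<close>\<close>

definition Psi :: "real \<Rightarrow> 'a \<Rightarrow> 'a \<Rightarrow> 'a \<Rightarrow> 'a \<Rightarrow> 'a \<Rightarrow> 'a \<Rightarrow> 'a \<Rightarrow> 'a \<Rightarrow> 'a \<Rightarrow> 'a \<Rightarrow> real" where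
  "Psi \<tau> n1 n2 m1 m2 y n1' n2' m1' m2' y' = - (n1 \<bullet> n2') - n1' \<bullet> n2 + (m1 + m2) \<bullet> (m1' + m2') / 2
     - ((m2 - m1) \<bullet> y' + (m2' - m1') \<bullet> y) / 2
     - 3 / 2 * (y \<bullet> y') - (\<tau> - 1) / 2 * ((y + J (n1 + n2)) \<bullet> (y' + J (n1' + n2')))"

lemma Phi_add: "Phi \<tau> (n1 + n1') (n2 + n2') (m1 + m1') (m2 + m2') (y + y')
   = Phi \<tau> n1 n2 m1 m2 y + Phi \<tau> n1' n2' m1' m2' y' + Psi \<tau> n1 n2 m1 m2 y n1' n2' m1' m2' y'"
proof -
  have e: "y + y' + J (n1 + n1' + (n2 + n2')) = (y + J (n1 + n2)) + (y' + J (n1' + n2'))"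
    "m2 + m2' - (m1 + m1') = (m2 - m1) + (m2' - m1')"
    "m1 + m1' + (m2 + m2') = (m1 + m2) + (m1' + m2')" by simp_all
  show ?thesis
  unfolding Phi_def Psi_def e
  by (simp only: inner_add_left inner_add_right inner_commute[of y' y] inner_commute[of "m1'+m2'" "m1+m2"]
      inner_commute[of "y' + J (n1' + n2')" "y + J (n1 + n2)"]) (simp only: inner_commute algebra_simps; simp add: field_simps)
qed

lemma Phi_minus: "Phi \<tau> (- n1) (- n2) (- m1) (- m2) (- y) = Phi \<tau> n1 n2 m1 m2 y"
proof -
  have e: "- y + J (- n1 + - n2) = - (y + J (n1 + n2))" "- m2 - - m1 = - (m2 - m1)"
    "- m1 + - m2 = - (m1 + m2)" by simp_all
  show ?thesis unfolding Phi_def e by (simp only: inner_minus_left inner_minus_right minus_minus)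
qed

text \<open>The vectors stand for the values of the four parts of an operator (\<open>a\<close>,
  \<open>k\<close>, \<open>X\<close>, \<open>Y\<close>) and of a second one whose parts are
  \<open>b\<close>, \<open>l\<close>, \<open>J X\<close>, \<open>J Y\<close>. The arguments of
  \<open>Phi\<close> are then the components in a complex ideal of what \<open>Q_even\<close>
  produces. As an identity of vectors it is used again with \<open>X = Y = 0\<close>.\<close>

lemma mixed_identity: "Phi \<tau> (a - k + X - Y) (J b - J l + X - Y) (b - l + J X - J Y) (J a - J k - J X + J Y)
    (J a + J k - J X - J Y - (b + l + J X + J Y))
  = - \<tau> * ((a + J b) \<bullet> (a + J b)) - 2 * (k \<bullet> J l + k \<bullet> a + l \<bullet> b + a \<bullet> J b)
    - 6 * (X \<bullet> X) - 4 * (X \<bullet> Y) - (4 * \<tau> - 2) * (Y \<bullet> Y)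
    + 4 * (X \<bullet> (a + J b + k + J l)) + 4 * \<tau> * (Y \<bullet> (a + J b))"
proof -
  have s: "J u \<bullet> v = - (u \<bullet> J v)" for u v by (rule J_skew)
  have c: "k \<bullet> a = a \<bullet> k" "b \<bullet> a = a \<bullet> b" "l \<bullet> a = a \<bullet> l" "X \<bullet> a = a \<bullet> X" "Y \<bullet> a = a \<bullet> Y"
    "k \<bullet> b = b \<bullet> k" "l \<bullet> b = b \<bullet> l" "X \<bullet> b = b \<bullet> X" "Y \<bullet> b = b \<bullet> Y"
    "l \<bullet> k = k \<bullet> l" "X \<bullet> k = k \<bullet> X" "Y \<bullet> k = k \<bullet> Y" "X \<bullet> l = l \<bullet> X" "Y \<bullet> l = l \<bullet> Y" "Y \<bullet> X = X \<bullet> Y"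
    by (rule inner_commute)+
  have c2: "v \<bullet> J u = - (u \<bullet> J v)" for u v using s[of v u] by (simp add: inner_commute)
  note d = c c2[of k a] c2[of b a] c2[of l a] c2[of X a] c2[of Y a] c2[of k b] c2[of l b] c2[of X b] c2[of Y b]
    c2[of l k] c2[of X k] c2[of Y k] c2[of X l] c2[of Y l] c2[of Y X]
  show ?thesis unfolding Phi_def
    by (simp only: Js JJ inner_add_left inner_add_right inner_diff_left inner_diff_right
        inner_minus_left inner_minus_right s d minus_minus J_orth)
      (simp add: field_simps)
qed

lemma Psi_minus_right: "Psi \<tau> n1 n2 m1 m2 y (- n1') (- n2') (- m1') (- m2') (- y') = - Psi \<tau> n1 n2 m1 m2 y n1' n2' m1' m2' y'"
proof -
  have e: "- y' + J (- n1' + - n2') = - (y' + J (n1' + n2'))" "- m2' - - m1' = - (m2' - m1')"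
    "- m1' + - m2' = - (m1' + m2')" by simp_all
  show ?thesis unfolding Psi_def e inner_minus_left inner_minus_right by (simp add: field_simps)
qed

lemma Psi_add_left: "Psi \<tau> (n1 + k1) (n2 + k2) (m1 + l1) (m2 + l2) (y + z) n1' n2' m1' m2' y' =
   Psi \<tau> n1 n2 m1 m2 y n1' n2' m1' m2' y' + Psi \<tau> k1 k2 l1 l2 z n1' n2' m1' m2' y'"
proof -
  have e: "y + z + J (n1 + k1 + (n2 + k2)) = (y + J (n1 + n2)) + (z + J (k1 + k2))"
    "m2 + l2 - (m1 + l1) = (m2 - m1) + (l2 - l1)"
    "m1 + l1 + (m2 + l2) = (m1 + m2) + (l1 + l2)" by simp_all
  show ?thesis unfolding Psi_def e inner_add_left inner_add_right by (simp add: field_simps)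
qed

lemma Psi_commute: "Psi \<tau> n1 n2 m1 m2 y n1' n2' m1' m2' y' = Psi \<tau> n1' n2' m1' m2' y' n1 n2 m1 m2 y"
  unfolding Psi_def by (simp only: inner_commute algebra_simps)

lemma Psi_scale: "Psi \<tau> (r *\<^sub>R n1) (r *\<^sub>R n2) (r *\<^sub>R m1) (r *\<^sub>R m2) (r *\<^sub>R y)
     (t *\<^sub>R n1') (t *\<^sub>R n2') (t *\<^sub>R m1') (t *\<^sub>R m2') (t *\<^sub>R y') = r * t * Psi \<tau> n1 n2 m1 m2 y n1' n2' m1' m2' y'"
proof -
  have e: "t *\<^sub>R y + J (t *\<^sub>R n) = t *\<^sub>R (y + J n)" "t *\<^sub>R n1 + t *\<^sub>R n2 = t *\<^sub>R (n1 + n2)"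
    "t *\<^sub>R n1 - t *\<^sub>R n2 = t *\<^sub>R (n1 - n2)" for t y n and n1 n2 :: 'a
    by (simp_all add: algebra_simps)
  show ?thesis unfolding Psi_def e inner_scaleR_left inner_scaleR_right by (simp add: field_simps del: Js)
qed

lemma Phi_add3: "Phi \<tau> (n1 + n1' + k1) (n2 + n2' + k2) (m1 + m1' + l1) (m2 + m2' + l2) (y + y' + z)
   = Phi \<tau> n1 n2 m1 m2 y + Phi \<tau> n1' n2' m1' m2' y' + Phi \<tau> k1 k2 l1 l2 z
    + Psi \<tau> n1 n2 m1 m2 y n1' n2' m1' m2' y' + Psi \<tau> n1 n2 m1 m2 y k1 k2 l1 l2 z
    + Psi \<tau> k1 k2 l1 l2 z n1' n2' m1' m2' y'"
  unfolding Phi_add Psi_add_left using Psi_commute[of \<tau> k1 k2 l1 l2 z n1' n2' m1' m2' y'] by simp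

context
  fixes \<tau> c :: real
  assumes Qc: "\<And>x. Q \<tau> x = c * (x \<bullet> x)\<^sup>2"
begin

lemma Q_expand: "Q \<tau> (x + v) = Q \<tau> x + Q \<tau> v
   + Phi \<tau> (S x v + S v x) (S (J x) (J v) + S (J v) (J x)) (S (J x) v + S (J v) x) (S x (J v) + S v (J x)) (br x (J v) + br v (J x))
   + Psi \<tau> (S x x) (S (J x) (J x)) (S (J x) x) (S x (J x)) (br x (J x))
        (S v v) (S (J v) (J v)) (S (J v) v) (S v (J v)) (br v (J v))
   + Psi \<tau> (S x x) (S (J x) (J x)) (S (J x) x) (S x (J x)) (br x (J x))
        (S x v + S v x) (S (J x) (J v) + S (J v) (J x)) (S (J x) v + S (J v) x) (S x (J v) + S v (J x)) (br x (J v) + br v (J x))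
   + Psi \<tau>  (S x v + S v x) (S (J x) (J v) + S (J v) (J x)) (S (J x) v + S (J v) x) (S x (J v) + S v (J x)) (br x (J v) + br v (J x))
        (S v v) (S (J v) (J v)) (S (J v) v) (S v (J v)) (br v (J v))"
proof -
  have "S (x + v) (x + v) = S x x + S v v + (S x v + S v x)"
    "S (J (x + v)) (J (x + v)) = S (J x) (J x) + S (J v) (J v) + (S (J x) (J v) + S (J v) (J x))"
    "S (J (x + v)) (x + v) = S (J x) x + S (J v) v + (S (J x) v + S (J v) x)"
    "S (x + v) (J (x + v)) = S x (J x) + S v (J v) + (S x (J v) + S v (J x))"
    "br (x + v) (J (x + v)) = br x (J x) + br v (J v) + (br x (J v) + br v (J x))"
    by (simp_all add: algebra_simps)
  then show ?thesis unfolding Q_def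
    by (simp only: Phi_add3)
qed

text \<open>For orthogonal vectors \<open>|x + v|^4 = (|x|^2 + |v|^2)^2\<close> contains no cross
  term of odd degree in \<open>v\<close>, and \<open>2 |x|^2 |v|^2\<close> is the only one of even
  degree. Comparison of degrees gives both identities.\<close>

lemma Q_even:
  assumes "x \<bullet> v = 0"
  shows "Phi \<tau> (S x v + S v x) (S (J x) (J v) + S (J v) (J x)) (S (J x) v + S (J v) x) (S x (J v) + S v (J x)) (br x (J v) + br v (J x))
   + Psi \<tau> (S x x) (S (J x) (J x)) (S (J x) x) (S x (J x)) (br x (J x))
        (S v v) (S (J v) (J v)) (S (J v) v) (S v (J v)) (br v (J v)) = 2 * c * (x \<bullet> x) * (v \<bullet> v)"
  and Q_odd: "Psi \<tau>  (S x v + S v x) (S (J x) (J v) + S (J v) (J x)) (S (J x) v + S (J v) x) (S x (J v) + S v (J x)) (br x (J v) + br v (J x))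
        (S v v) (S (J v) (J v)) (S (J v) v) (S v (J v)) (br v (J v)) = 0"
proof -
  define E where "E = (\<lambda>v. Phi \<tau> (S x v + S v x) (S (J x) (J v) + S (J v) (J x)) (S (J x) v + S (J v) x) (S x (J v) + S v (J x)) (br x (J v) + br v (J x))
   + Psi \<tau> (S x x) (S (J x) (J x)) (S (J x) x) (S x (J x)) (br x (J x))
        (S v v) (S (J v) (J v)) (S (J v) v) (S v (J v)) (br v (J v)))"
  define O1 where "O1 = (\<lambda>v. Psi \<tau> (S x x) (S (J x) (J x)) (S (J x) x) (S x (J x)) (br x (J x))
        (S x v + S v x) (S (J x) (J v) + S (J v) (J x)) (S (J x) v + S (J v) x) (S x (J v) + S v (J x)) (br x (J v) + br v (J x)))"
  define O2 where "O2 = (\<lambda>v. Psi \<tau>  (S x v + S v x) (S (J x) (J v) + S (J v) (J x)) (S (J x) v + S (J v) x) (S x (J v) + S v (J x)) (br x (J v) + br v (J x))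
        (S v v) (S (J v) (J v)) (S (J v) v) (S v (J v)) (br v (J v)))"
  have nn: "- p + - q = - (p + q)" for p q :: 'a by simp
  have Q: "Q \<tau> (x + v) = Q \<tau> x + Q \<tau> v + E v + O1 v + O2 v" for v
    unfolding Q_expand E_def O1_def O2_def by simp
  have Em: "E (- v) = E v" for v
    unfolding E_def by (simp only: Js Ss brs nn Phi_minus minus_minus)
  have O1m: "O1 (- v) = - O1 v" for v
    unfolding O1_def by (simp only: Js Ss brs nn Psi_minus_right minus_minus)
  have O1s: "O1 (t *\<^sub>R v) = t * O1 v" for v t
    unfolding O1_def using Psi_scale[of \<tau> 1 _ _ _ _ _ t] by (simp flip: scaleR_add_right)
  have O2s: "O2 (t *\<^sub>R v) = t ^ 3 * O2 v" for v t
    unfolding O2_def using Psi_scale[of \<tau> t _ _ _ _ _ "t * t"]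
    by (simp add: power3_eq_cube mult.assoc flip: scaleR_add_right)
  have O2m: "O2 (- v) = - O2 v" for v using O2s[of "-1" v] by simp
  have eq: "E v + O1 v + O2 v = 2 * c * (x \<bullet> x) * (v \<bullet> v)" if "x \<bullet> v = 0" for v
    using Q[of v] that unfolding Qc
    by (simp add: inner_add_left inner_add_right inner_commute[of v x] power2_eq_square algebra_simps)
  have ev: "E v = 2 * c * (x \<bullet> x) * (v \<bullet> v)" and od: "O1 v + O2 v = 0" if "x \<bullet> v = 0" for v
    using eq[of v] eq[of "- v"] that by (simp_all add: Em O1m O2m)
  show "Phi \<tau> (S x v + S v x) (S (J x) (J v) + S (J v) (J x)) (S (J x) v + S (J v) x) (S x (J v) + S v (J x)) (br x (J v) + br v (J x))
   + Psi \<tau> (S x x) (S (J x) (J x)) (S (J x) x) (S x (J x)) (br x (J x))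
        (S v v) (S (J v) (J v)) (S (J v) v) (S v (J v)) (br v (J v)) = 2 * c * (x \<bullet> x) * (v \<bullet> v)"
    using ev[OF assms] by (simp add: E_def)
  \<comment> \<open>Degrees one and three are separated by scaling: \<open>O1 + O2 = 0\<close> at
    \<open>v\<close> and \<open>2 O1 + 8 O2 = 0\<close> at \<open>2 v\<close>.\<close>
  have "O2 v = 0" using od[OF assms] od[of "2 *\<^sub>R v"] assms by (simp add: O1s O2s)
  then show "Psi \<tau>  (S x v + S v x) (S (J x) (J v) + S (J v) (J x)) (S (J x) v + S (J v) x) (S x (J v) + S v (J x)) (br x (J v) + br v (J x))
        (S v v) (S (J v) (J v)) (S (J v) v) (S v (J v)) (br v (J v)) = 0"
    by (simp add: O2_def)
qed
end

text \<open>The parts of a linear map that are symmetric or skew, and commute or anticommute with \<open>J\<close>.\<close>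

definition sc :: "('a \<Rightarrow> 'a) \<Rightarrow> 'a \<Rightarrow> 'a" where
  "sc f x = (1/4) *\<^sub>R (f x + adjoint f x - J (f (J x)) - J (adjoint f (J x)))"
definition kc :: "('a \<Rightarrow> 'a) \<Rightarrow> 'a \<Rightarrow> 'a" where
  "kc f x = (1/4) *\<^sub>R (f x - adjoint f x - J (f (J x)) + J (adjoint f (J x)))"
definition sa :: "('a \<Rightarrow> 'a) \<Rightarrow> 'a \<Rightarrow> 'a" where
  "sa f x = (1/4) *\<^sub>R (f x + adjoint f x + J (f (J x)) + J (adjoint f (J x)))"
definition ka :: "('a \<Rightarrow> 'a) \<Rightarrow> 'a \<Rightarrow> 'a" where
  "ka f x = (1/4) *\<^sub>R (f x - adjoint f x + J (f (J x)) - J (adjoint f (J x)))"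

context
  fixes f :: "'a \<Rightarrow> 'a"
  assumes f: "linear f"
begin

lemma parts_sum: "f x = sc f x + kc f x + sa f x + ka f x"
  and parts_adjoint: "adjoint f x = sc f x - kc f x + sa f x - ka f x"
  unfolding sc_def kc_def sa_def ka_def by (simp_all add: algebra_simps flip: scaleR_add_left)

lemma adj1: "adjoint f x \<bullet> y = f y \<bullet> x" and adj2: "y \<bullet> adjoint f x = f y \<bullet> x"
  using adjoint_works[OF f, of y x] by (simp_all add: inner_commute)

lemma sc_sym: "sc f x \<bullet> y = x \<bullet> sc f y" and sa_sym: "sa f x \<bullet> y = x \<bullet> sa f y"
  and kc_skew: "kc f x \<bullet> y = - (x \<bullet> kc f y)" and ka_skew: "ka f x \<bullet> y = - (x \<bullet> ka f y)"
  unfolding sc_def kc_def sa_def ka_def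
  by (simp_all add: inner_add_left inner_add_right inner_diff_left inner_diff_right adj1 adj2 J_skew
      J_skew[of "f x", THEN eq_neg_iff_add_eq_0[THEN iffD1]])
     (simp_all add: inner_commute[of x] J_skew adj1 field_simps)

lemmas fs = linear_add[OF f] linear_scale[OF f] linear_neg[OF f] linear_diff[OF f]
lemmas afs = linear_add[OF adjoint_linear[OF f]] linear_scale[OF adjoint_linear[OF f]]
  linear_neg[OF adjoint_linear[OF f]] linear_diff[OF adjoint_linear[OF f]]

lemma sc_J: "sc f (J x) = J (sc f x)" and kc_J: "kc f (J x) = J (kc f x)"
  and sa_J: "sa f (J x) = - J (sa f x)" and ka_J: "ka f (J x) = - J (ka f x)"
  unfolding sc_def kc_def sa_def ka_def by (simp_all add: fs afs algebra_simps)

lemma linear_sc: "linear (sc f)" and linear_kc: "linear (kc f)"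
  and linear_sa: "linear (sa f)" and linear_ka: "linear (ka f)"
  unfolding sc_def[abs_def] kc_def[abs_def] sa_def[abs_def] ka_def[abs_def]
  by (auto intro!: linearI simp: fs afs algebra_simps)
end

end

section \<open>Semidirect products with vanishing quartic form\<close>

context hermitian_lie begin

text \<open>With \<open>p\<close>, \<open>q\<close> the images of a vector under two complex linear
  operators and \<open>p'\<close>, \<open>q'\<close> those under their transposes,
  \<open>p + J q\<close> and \<open>p' - J q'\<close> are the images under the combined operator and
  its transpose. For the Chern connection the form thus measures the failure of normality.\<close>

lemma Phi_normal: "Phi 0 p' (J q') q' (J p') (J p - q) = ((p' - J q') \<bullet> (p' - J q') - (p + J q) \<bullet> (p + J q)) / 2"
proof -
  have c: "J u \<bullet> w = - (u \<bullet> J w)" "w \<bullet> J u = - (u \<bullet> J w)" for u w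
    using J_skew[of u w] inner_commute[of w "J u"] by simp_all
  have i: "q' \<bullet> J p' = - (p' \<bullet> J q')" "q \<bullet> J p = - (p \<bullet> J q)" "q' \<bullet> J p = - (p \<bullet> J q')" "q \<bullet> J p' = - (p' \<bullet> J q)"
    "J p' \<bullet> q' = - (p' \<bullet> J q')" "J p \<bullet> q = - (p \<bullet> J q)" "J p \<bullet> q' = - (p \<bullet> J q')" "J p' \<bullet> q = - (p' \<bullet> J q)"
    "J q' \<bullet> p' = p' \<bullet> J q'" "J q \<bullet> p = p \<bullet> J q" "p' \<bullet> p = p \<bullet> p'" "q' \<bullet> q = q \<bullet> q'"
    by (rule c inner_commute)+
  show ?thesis unfolding Phi_def
    by (simp add: inner_add_left inner_add_right inner_diff_left inner_diff_right i) (simp add: i field_simps)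
qed

end

text \<open>The common end point of all cases with \<open>c = 0\<close>; flatness is decided here
  once, according to whether \<open>\<tau>\<close> is positive or zero.\<close>

locale semidirect = hermitian_lie br J for br :: "'a::euclidean_space \<Rightarrow> 'a \<Rightarrow> 'a" and J +
  fixes I :: "'a set" and P :: "'a \<Rightarrow> 'a" and \<tau> :: real
  assumes linear_P: "linear P" and P_I: "P x \<in> I" and P_id: "v \<in> I \<Longrightarrow> P v = v"
    and P_sym: "P x \<bullet> y = x \<bullet> P y" and J_I: "v \<in> I \<Longrightarrow> J v \<in> I" and sub: "subspace I"
    and ideal: "v \<in> I \<Longrightarrow> br x v \<in> I" and abelian: "v \<in> I \<Longrightarrow> w \<in> I \<Longrightarrow> br v w = 0"
    and br_J: "v \<in> I \<Longrightarrow> br x (J v) = J (br x v)"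
    and commute: "br (x - P x) (y - P y) = 0" and Q0: "Q \<tau> x = 0"
begin

lemmas Ps [simp] = linear_add[OF linear_P] linear_scale[OF linear_P] linear_neg[OF linear_P] linear_diff[OF linear_P] linear_0[OF linear_P]
lemmas I_closed = subspace_add[OF sub] subspace_diff[OF sub] subspace_scale[OF sub] subspace_neg[OF sub] subspace_0[OF sub] J_I
lemma P_P [simp]: "P (P x) = P x" by (simp add: P_id P_I)
lemma P_J: "P (J x) = J (P x)"
proof (rule vector_eq_rdot[THEN iffD1], rule allI)
  fix y
  have "P (J x) \<bullet> y = - (x \<bullet> J (P y))" by (simp add: P_sym J_skew)
  also have "x \<bullet> J (P y) = P x \<bullet> J (P y)" by (simp add: P_sym P_id J_I P_I)
  also have "\<dots> = - (P (J (P x)) \<bullet> y)" by (simp add: P_sym J_skew)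
  finally show "P (J x) \<bullet> y = J (P x) \<bullet> y" by (simp add: P_id J_I P_I)
qed

text \<open>Extended by zero through \<open>P\<close> in both arguments, so that
  \<open>br_eq\<close> holds on the whole algebra and \<open>A\<close> itself is a candidate for the
  Levi-Civita connection.\<close>

definition A where "A x y = br (x - P x) (P y)"
definition At where "At x y = P (S (x - P x) (P y))"

lemma A_I [simp]: "A x y \<in> I" "At x y \<in> I" unfolding A_def At_def by (intro ideal P_I)+
lemma As [simp]: "A (x + y) v = A x v + A y v" "A (t *\<^sub>R x) v = t *\<^sub>R A x v" "A (- x) v = - A x v" "A (x - y) v = A x v - A y v"
   "A x (v + w) = A x v + A x w" "A x (v - w) = A x v - A x w" "A x (- v) = - A x v" "A x (t *\<^sub>R v) = t *\<^sub>R A x v"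
   "At x (v + w) = At x v + At x w" "At x (v - w) = At x v - At x w" "At x (- v) = - At x v" "At x (t *\<^sub>R v) = t *\<^sub>R At x v"
  by (simp_all add: A_def At_def algebra_simps)
lemma A_P [simp]: "A (P x) y = 0" "A x (P y) = A x y" "At (P x) y = 0" "At x (P y) = At x y"
  by (simp_all add: A_def At_def)
lemma A_adj: "A x y \<bullet> z = y \<bullet> At x z" "At x y \<bullet> z = y \<bullet> A x z"
proof -
  show 1: "At x y \<bullet> z = y \<bullet> A x z" for y z
  proof -
    have "At x y \<bullet> z = P y \<bullet> A x z" unfolding At_def A_def by (subst P_sym) (rule S_inner)
    then show ?thesis by (simp add: P_sym P_id)
  qed
  show "A x y \<bullet> z = y \<bullet> At x z" using 1[of z y] by (simp add: inner_commute)
qed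
lemma At_add [simp]: "At (x + y) v = At x v + At y v" "At (- x) v = - At x v"
  by (rule vector_eq_rdot[THEN iffD1], rule allI, simp add: A_adj inner_add_left inner_add_right)+
lemma A_J [simp]: "A x (J y) = J (A x y)" by (simp add: A_def P_J br_J P_I)
lemma At_J [simp]: "At x (J y) = J (At x y)"
  by (rule vector_eq_rdot[THEN iffD1], rule allI) (simp add: A_adj J_skew)
lemma br_eq: "br x y = A x y - A y x"
proof -
  have "br x y = br (x - P x) (y - P y) + br (x - P x) (P y) + br (P x) (y - P y) + br (P x) (P y)"
    by (simp add: algebra_simps)
  then show ?thesis unfolding commute A_def br_anti[of "P x" "y - P y"] by (simp add: abelian P_I)
qed
lemma A_in_I [simp]: "v \<in> I \<Longrightarrow> A v y = 0" using A_P(1)[of v y] by (simp add: P_id)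
lemma A_commute: "A x (A y z) = A y (A x z)"
proof -
  define a b where "a = x - P x" and "b = y - P y"
  have "br (br a b) (P z) = 0" unfolding a_def b_def commute by simp
  moreover have "br a (br b (P z)) + br b (br (P z) a) + br (P z) (br a b) = 0" by (rule jacobi)
  ultimately have "br a (br b (P z)) = br b (br a (P z))"
    unfolding br_anti[of "P z" a] br_anti[of "P z" "br a b"] by simp
  then show ?thesis unfolding A_def a_def b_def by (simp add: P_id ideal P_I)
qed

lemma quotient: "br x y \<in> I" by (subst br_eq) (intro I_closed A_I)

text \<open>On \<open>I\<close> the quartic form reduces to \<open>- \<tau> |S v v|^2\<close>, so
  its vanishing makes every \<open>A w\<close> skew. Then \<open>A\<close> is metric and torsion
  free, hence the Levi-Civita connection. It commutes with \<open>J\<close>, its operators commute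
  with each other, and they vanish for first arguments in \<open>I\<close>, where all brackets
  lie.\<close>

lemma kaehler_flat:
  assumes "\<tau> > 0" shows "kaehler_flat br J"
proof -
  have diag: "v \<bullet> A w v = 0" if v: "v \<in> I" for v w
  proof -
    have brv: "br v w = - A w v" for w using that br_eq[of v w] by simp
    define N where "N = S v v"
    have N: "N \<bullet> w = - (v \<bullet> A w v)" for w unfolding N_def S_inner brv by simp
    have brJv: "br (J v) w = - J (A w v)" for w using J_I[OF v] br_eq[of "J v" w] by simp
    have "S (J v) (J v) = N" "S (J v) v = - S v (J v)"
      by (rule vector_eq_rdot[THEN iffD1], rule allI, simp add: N S_inner brJv brv J_skew)+
    moreover have "br v (J v) = 0" by (rule abelian[OF v J_I[OF v]])
    ultimately have "Q \<tau> v = - (\<tau> * (N \<bullet> N))"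
      unfolding Q_def Phi_def N_def[symmetric] by (simp add: inner_add_left inner_add_right algebra_simps)
    then have "N = 0" using Q0 assms by simp
    then show ?thesis using N[of w] by simp
  qed
  have skew: "A w x \<bullet> y = - (x \<bullet> A w y)" for w x y
  proof -
    have "(P x + P y) \<bullet> A w (P x + P y) = 0" "P x \<bullet> A w (P x) = 0" "P y \<bullet> A w (P y) = 0" by (intro diag I_closed P_I)+
    then have "P y \<bullet> A w x + P x \<bullet> A w y = 0" by (simp add: inner_add_left inner_add_right)
    then have "y \<bullet> A w x + x \<bullet> A w y = 0" by (simp add: P_sym P_id)
    then show ?thesis by (simp add: inner_commute)
  qed
  have LC: "levi_civita br x y = A x y" for x y
  proof (rule vector_eq_rdot[THEN iffD1], rule allI)
    fix z
    show "levi_civita br x y \<bullet> z = A x y \<bullet> z"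
      unfolding levi_civita_eq inner_scaleR_left inner_diff_left S_inner
      using skew[of x y z] skew[of y x z] skew[of z x y] inner_commute[of y "A z x"]
      by (simp only: br_eq) (simp add: inner_diff_left inner_diff_right)
  qed
  have "flat br (levi_civita br)"
    unfolding flat_def curvature_def by (intro allI) (simp only: LC, simp add: A_commute quotient)
  moreover have "kaehler br J"
    unfolding kaehler_def
  proof (intro allI)
    fix x y z
    have i: "J (A u v) \<bullet> w = J (A u w) \<bullet> v" for u v w
      using skew[of u v "J w"] J_skew[of "A u v" w] inner_commute[of v "J (A u w)"] by simp
    show "d_two_form br (kaehler_form J) x y z = 0"
      unfolding d_two_form_def kaehler_form_def
      by (simp only: br_eq) (simp add: inner_diff_left i[of x y z] i[of y x z] i[of z x y])
  qed
  ultimately show ?thesis by (simp add: kaehler_flat_def)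
qed

text \<open>The Dolbeault operator restricted to the ideal, complex antilinear in \<open>x\<close>;
  \<open>Ut x\<close> is its transpose.\<close>

definition U where "U x y = A x y + J (A (J x) y)"
definition Ut where "Ut x y = At x y - J (At (J x) y)"

lemma U_adj: "U x y \<bullet> z = y \<bullet> Ut x z" "Ut x y \<bullet> z = y \<bullet> U x z"
  unfolding U_def Ut_def by (simp_all add: inner_add_left inner_diff_left inner_add_right inner_diff_right A_adj J_skew)
lemma Us: "U (x + y) v = U x v + U y v" "Ut (x + y) v = Ut x v + Ut y v" "U (J x) v = - J (U x v)" "Ut (J x) v = J (Ut x v)"
  "U x (v + w) = U x v + U x w" "Ut x (v + w) = Ut x v + Ut x w" "U x (v - w) = U x v - U x w" "Ut x (v - w) = Ut x v - Ut x w"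
  "U x (J v) = J (U x v)" "Ut x (J v) = J (Ut x v)" "U x (- v) = - U x v" "Ut x (- v) = - Ut x v"
  "U x (t *\<^sub>R v) = t *\<^sub>R U x v" "Ut x (t *\<^sub>R v) = t *\<^sub>R Ut x v"
  unfolding U_def Ut_def by (simp_all add: algebra_simps)

text \<open>The even polarization between the complement and \<open>I\<close>. All brackets lie in
  \<open>I\<close> and the complement commutes, so the \<open>Psi\<close> term vanishes and
  \<open>Phi_normal\<close> remains.\<close>

lemma U_normal: assumes "\<tau> = 0" shows "U x v \<bullet> U x v = Ut x v \<bullet> Ut x v"
proof -
  define a where "a = x - P x"
  define u where "u = P v"
  have u: "u \<in> I" "J u \<in> I" and a: "P a = 0" "P (J a) = 0" by (simp_all add: u_def a_def P_I J_I P_J)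
  have orth: "w \<bullet> a = 0" "a \<bullet> w = 0" "w \<bullet> J a = 0" "J a \<bullet> w = 0" if "w \<in> I" for w
    using P_sym[of w a] P_sym[of w "J a"] that a by (simp_all add: P_id inner_commute)
  have Sxv: "S y w = At y w" if "P y = 0" "w \<in> I" for y w
  proof (rule vector_eq_rdot[THEN iffD1], rule allI)
    fix z
    have "w \<bullet> A z y = 0" using that(1) by (simp add: A_def)
    then show "S y w \<bullet> z = At y w \<bullet> z" unfolding S_inner by (simp only: br_eq) (simp add: A_adj inner_diff_right)
  qed
  have S0: "S w y = 0" if "\<And>v. v \<in> I \<Longrightarrow> y \<bullet> v = 0" for w y
    by (rule vector_eq_rdot[THEN iffD1], rule allI) (simp add: S_inner that quotient)
  have y0: "A y a = 0" "A y (J a) = 0" for y using a by (simp_all add: A_def)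
  have "a \<bullet> u = 0" using orth u by simp
  from Q_even[of \<tau> 0, OF _ this] Q0
  have "Phi \<tau> (At a u) (J (At (J a) u)) (At (J a) u) (J (At a u)) (J (A a u) - A (J a) u) = 0"
    using u by (simp add: Sxv S0 orth a br_eq y0 Psi_def)
  then have "U a u \<bullet> U a u = Ut a u \<bullet> Ut a u" unfolding assms Phi_normal U_def Ut_def by simp
  moreover have "U a u = U x v" "Ut a u = Ut x v" unfolding a_def u_def U_def Ut_def A_def At_def by (simp_all add: P_J)
  ultimately show ?thesis by simp
qed

text \<open>The Chern connection is \<open>(U x - Ut x) / 2\<close>. \<open>U_normal\<close> says
  that each \<open>U x\<close> is normal; polarization in \<open>x\<close> lets \<open>U x\<close>
  commute with every \<open>Ut y\<close>. Hence all connection operators commute, and they vanish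
  for \<open>x\<close> in \<open>I\<close>, which contains all brackets.\<close>

lemma chern_flat:
  assumes "\<tau> = 0" shows "chern_flat br J"
proof -
  have C: "chern br J x y = (1/2) *\<^sub>R (U x y - Ut x y)" for x y
  proof (rule vector_eq_rdot[THEN iffD1], rule allI)
    fix z
    show "chern br J x y \<bullet> z = ((1/2) *\<^sub>R (U x y - Ut x y)) \<bullet> z"
      unfolding chern_eq inner_scaleR_left inner_add_left inner_diff_left S_inner U_def Ut_def
      by (simp only: br_eq) (simp add: inner_add_left inner_diff_left inner_add_right inner_diff_right A_adj J_skew)
  qed
  have self: "U x (Ut x v) = Ut x (U x v)" for x v
  proof -
    define D where "D v = U x (Ut x v) - Ut x (U x v)" for v
    have D0: "D v \<bullet> v = 0" for v
      using U_normal[OF assms, of x v] by (simp add: D_def inner_diff_left U_adj)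
    have sym: "D v \<bullet> w = v \<bullet> D w" for v w unfolding D_def by (simp add: inner_diff_left inner_diff_right U_adj)
    have add: "D (v + w) = D v + D w" for v w unfolding D_def by (simp add: Us)
    have "D v \<bullet> w = 0" for v w
      using D0[of "v + w"] D0[of v] D0[of w] sym[of w v] inner_commute[of w "D v"] by (simp add: add inner_add_left inner_add_right)
    then have "D v = 0" by (metis inner_eq_zero_iff)
    then show ?thesis by (simp add: D_def)
  qed
  have mixed: "U x (Ut y v) = Ut y (U x v)" for x y v
  proof -
    have s: "U x (Ut y v) - Ut y (U x v) = - (U y (Ut x v) - Ut x (U y v))" for x y v
      using self[of "x + y" v] self[of x v] self[of y v] by (simp add: Us algebra_simps)
    define D where "D = U x (Ut y v) - Ut y (U x v)" define E where "E = U y (Ut x v) - Ut x (U y v)"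
    \<comment> \<open>\<open>U\<close> is antilinear and \<open>Ut\<close> linear in its index, so
      replacing \<open>y\<close> by \<open>J y\<close> flips the relative sign of the two
      commutators; together with \<open>D = - E\<close> this kills both.\<close>
    have "J D = J E" using s[of x "J y" v] unfolding D_def E_def by (simp add: Us algebra_simps)
    moreover have "D = - E" using s[of x y v] by (simp add: D_def E_def)
    ultimately have "J D = - J D" by simp
    then have "D = 0" by (metis JJ Js(4) eq_neg_iff_add_eq_0 neg_0_equal_iff_equal scaleR_2 scaleR_eq_0_iff zero_neq_numeral)
    then show ?thesis by (simp add: D_def)
  qed
  have UU: "U x (U y v) = U y (U x v)" for x y v
    unfolding U_def by (simp add: A_commute algebra_simps)
  have UtUt: "Ut x (Ut y v) = Ut y (Ut x v)" for x y v
    by (rule vector_eq_rdot[THEN iffD1], rule allI) (simp add: U_adj UU)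
  have U0: "U u v = 0" "Ut u v = 0" if "u \<in> I" for u v
    using that J_I[OF that] by (simp_all add: U_def Ut_def At_def P_id)
  have "flat br (chern br J)"
    unfolding flat_def curvature_def
    by (intro allI) (simp only: C, simp add: quotient U0 Us UU UtUt mixed algebra_simps)
  then show ?thesis by (simp add: chern_flat_def)
qed

end

lemma linear_trace_add: "linear_trace (\<lambda>x. f x + g x) = linear_trace f + linear_trace g"
  by (simp add: linear_trace_def inner_add_left sum.distrib)
lemma linear_trace_scale: "linear_trace (\<lambda>x. t *\<^sub>R f x) = t * linear_trace f"
  by (simp add: linear_trace_def sum_distrib_left)
lemma linear_trace_minus: "linear_trace (\<lambda>x. - f x) = - linear_trace f"
  by (simp add: linear_trace_def sum_negf)
lemma linear_trace_diff: "linear_trace (\<lambda>x. f x - g x) = linear_trace f - linear_trace g"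
  by (simp add: linear_trace_def inner_diff_left sum_subtractf)
lemma linear_trace_rank1: "linear_trace (\<lambda>x. (x \<bullet> u) *\<^sub>R w) = u \<bullet> w"
  unfolding linear_trace_def by (simp add: euclidean_inner[of u w] inner_commute mult.commute)

context hermitian_lie begin

lemma linear_trace_JJ: assumes "linear f" shows "linear_trace (\<lambda>x. J (f (J x))) = - linear_trace f"
proof -
  have "linear_trace (\<lambda>x. J (f (J x))) = linear_trace (\<lambda>x. f (J (J x)))"
    using linear_trace_compose[OF linJ linear_compose[OF linJ assms]] by (simp add: o_def)
  then show ?thesis by (simp add: linear_neg[OF assms] linear_trace_minus)
qed

lemma linear_trace_sc: assumes "linear f" shows "linear_trace (sc f) = linear_trace f"
  unfolding sc_def[abs_def]
  by (simp add: linear_trace_scale linear_trace_add linear_trace_diff linear_trace_JJ assms adjoint_linear linear_trace_adjoint)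

end

section \<open>Complex ideals\<close>

text \<open>Applied to the given ideal if it is complex, and to an enlarged abelian ideal in one
  branch of the other case.\<close>

locale complex_ideal = hermitian_lie br J for br :: "'a::euclidean_space \<Rightarrow> 'a \<Rightarrow> 'a" and J +
  fixes I :: "'a set" and e :: 'a and \<tau> c :: real
  assumes sub: "subspace I" and ideal: "u \<in> I \<Longrightarrow> br x u \<in> I"
    and abelian: "u \<in> I \<Longrightarrow> v \<in> I \<Longrightarrow> br u v = 0"
    and J_I: "u \<in> I \<Longrightarrow> J u \<in> I" and e_unit [simp]: "e \<bullet> e = 1"
    and e_I: "u \<in> I \<Longrightarrow> u \<bullet> e = 0"
    and decomp: "x - (x \<bullet> e) *\<^sub>R e - (x \<bullet> J e) *\<^sub>R J e \<in> I"
    and unimod: "linear_trace (br x) = 0"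
    and Qc: "Q \<tau> x = c * (x \<bullet> x)\<^sup>2" and tau_nonneg: "\<tau> \<ge> 0"
begin

definition P :: "'a \<Rightarrow> 'a" where "P x = x - (x \<bullet> e) *\<^sub>R e - (x \<bullet> J e) *\<^sub>R J e"
definition A :: "'a \<Rightarrow> 'a" where "A x = br e (P x)"
definition B :: "'a \<Rightarrow> 'a" where "B x = br (J e) (P x)"
definition lam where "lam = br e (J e) \<bullet> e"
definition mu where "mu = br e (J e) \<bullet> J e"
definition h where "h = P (br e (J e))"
abbreviation "a \<equiv> sc A"
abbreviation "k \<equiv> kc A"
abbreviation "X \<equiv> sa A"
abbreviation "Y \<equiv> ka A"
abbreviation "b \<equiv> sc B"
abbreviation "l \<equiv> kc B"

lemma e_I' [simp]: "u \<in> I \<Longrightarrow> u \<bullet> e = 0" "u \<in> I \<Longrightarrow> e \<bullet> u = 0" "u \<in> I \<Longrightarrow> u \<bullet> J e = 0" "u \<in> I \<Longrightarrow> J e \<bullet> u = 0"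
  using e_I[of u] e_I[OF J_I, of u] J_skew[of u e] by (simp_all add: inner_commute)

lemmas I_closed = subspace_add[OF sub] subspace_diff[OF sub] subspace_scale[OF sub] subspace_neg[OF sub] subspace_0[OF sub] J_I
lemma P_I [simp]: "P x \<in> I" unfolding P_def by (rule decomp)
lemma P_id [simp]: "v \<in> I \<Longrightarrow> P v = v" by (simp add: P_def)
lemma P_e [simp]: "P e = 0" "P (J e) = 0" by (simp_all add: P_def)
lemma P_J: "P (J x) = J (P x)" by (simp add: P_def J_skew algebra_simps)
lemma linear_P: "linear P" unfolding P_def[abs_def] by (auto intro!: linearI simp: algebra_simps)
lemmas Ps = linear_add[OF linear_P] linear_scale[OF linear_P] linear_neg[OF linear_P] linear_diff[OF linear_P]
lemma linear_A: "linear A" and linear_B: "linear B"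
  unfolding A_def[abs_def] B_def[abs_def] by (auto intro!: linearI simp: Ps)
lemma split: "x = P x + (x \<bullet> e) *\<^sub>R e + (x \<bullet> J e) *\<^sub>R J e" by (simp add: P_def)
lemma P_sym: "P x \<bullet> y = x \<bullet> P y" by (simp add: P_def algebra_simps inner_commute[of _ y])
lemma in_I: "x \<bullet> e = 0 \<Longrightarrow> x \<bullet> J e = 0 \<Longrightarrow> x \<in> I" using decomp[of x] by simp
lemma h_I [simp]: "h \<in> I" by (simp add: h_def)

lemma br_e_Je: "br e (J e) = h + lam *\<^sub>R e + mu *\<^sub>R J e"
  unfolding h_def lam_def mu_def by (rule split)
lemma br_e: "br e z = A z + (z \<bullet> J e) *\<^sub>R (h + lam *\<^sub>R e + mu *\<^sub>R J e)"
  by (subst split[of z]) (simp add: A_def br_e_Je)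
lemma br_Je: "br (J e) z = B z - (z \<bullet> e) *\<^sub>R (h + lam *\<^sub>R e + mu *\<^sub>R J e)"
  by (subst split[of z]) (simp add: B_def br_anti[of "J e" e] br_e_Je algebra_simps)
lemma br_I: "v \<in> I \<Longrightarrow> br v z = - (z \<bullet> e) *\<^sub>R A v - (z \<bullet> J e) *\<^sub>R B v"
  by (subst split[of z]) (simp add: A_def B_def abelian br_anti[of v e] br_anti[of v "J e"])

lemma AB_I: "A x \<in> I" "B x \<in> I" by (simp_all add: A_def B_def ideal)
lemma adj_I: "adjoint A x \<in> I" "adjoint B x \<in> I"
  by (rule in_I; simp add: adj1[OF linear_A] adj1[OF linear_B] A_def B_def)+
lemma parts_I [simp]: "a x \<in> I" "k x \<in> I" "X x \<in> I" "Y x \<in> I" "b x \<in> I" "l x \<in> I"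
  unfolding sc_def kc_def sa_def ka_def by (intro I_closed AB_I adj_I)+

lemma int_AB: "A x - B (J x) + J (B x) + J (A (J x)) = 0"
  unfolding A_def B_def P_J using integrable[of e "P x"] by simp
lemma int1: "B x + J (B (J x)) = J (A x) - A (J x)"
  using arg_cong[OF int_AB[of x], of J] by (simp add: algebra_simps)
lemma int2: "adjoint B x + J (adjoint B (J x)) = J (adjoint A x) - adjoint A (J x)"
proof (rule vector_eq_rdot[THEN iffD1], rule allI)
  fix y
  have "(B y + J (B (J y))) \<bullet> x = (J (A y) - A (J y)) \<bullet> x" by (simp add: int1)
  then show "(adjoint B x + J (adjoint B (J x))) \<bullet> y = (J (adjoint A x) - adjoint A (J x)) \<bullet> y"
    by (simp add: inner_add_left inner_diff_left J_skew adj1[OF linear_A] adj1[OF linear_B])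
qed
text \<open>Consequence of integrability and of its transpose; with \<open>ka_B\<close> it leaves a
  single pair \<open>X\<close>, \<open>Y\<close> of parts anticommuting with \<open>J\<close> for
  both operators.\<close>

lemma sa_B: "sa B x = J (X x)"
proof -
  have "sa B x = (1/4) *\<^sub>R ((B x + J (B (J x))) + (adjoint B x + J (adjoint B (J x))))" unfolding sa_def by simp
  also have "\<dots> = J (X x)" unfolding int1 int2 sa_def by (simp add: algebra_simps)
  finally show ?thesis .
qed
lemma ka_B: "ka B x = J (Y x)"
proof -
  have "ka B x = (1/4) *\<^sub>R ((B x + J (B (J x))) - (adjoint B x + J (adjoint B (J x))))" unfolding ka_def by (simp add: algebra_simps)
  also have "\<dots> = J (Y x)" unfolding int1 int2 ka_def by (simp add: algebra_simps)
  finally show ?thesis .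
qed

lemma A_eq: "A x = a x + k x + X x + Y x" by (rule parts_sum[OF linear_A])
lemma B_eq: "B x = b x + l x + J (X x) + J (Y x)" using parts_sum[OF linear_B, of x] by (simp add: sa_B ka_B)
lemma adj_A_eq: "adjoint A x = a x - k x + X x - Y x" by (rule parts_adjoint[OF linear_A])
lemma adj_B_eq: "adjoint B x = b x - l x + J (X x) - J (Y x)" using parts_adjoint[OF linear_B, of x] by (simp add: sa_B ka_B)
lemmas pJ [simp] = sc_J[OF linear_A] sc_J[OF linear_B] kc_J[OF linear_A] kc_J[OF linear_B] sa_J[OF linear_A] ka_J[OF linear_A]
lemmas sym_parts = sc_sym[OF linear_A] sc_sym[OF linear_B] sa_sym[OF linear_A]
lemmas skew_parts = kc_skew[OF linear_A] kc_skew[OF linear_B] ka_skew[OF linear_A]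
lemmas lin_parts = linear_sc[OF linear_A] linear_sc[OF linear_B] linear_kc[OF linear_A] linear_kc[OF linear_B]
  linear_sa[OF linear_A] linear_ka[OF linear_A]
lemmas pl [simp] = lin_parts[THEN linear_add] lin_parts[THEN linear_diff] lin_parts[THEN linear_neg]
  lin_parts[THEN linear_scale] lin_parts[THEN linear_0]

lemma skew0 [simp]: "k x \<bullet> x = 0" "l x \<bullet> x = 0" "Y x \<bullet> x = 0" "x \<bullet> k x = 0" "x \<bullet> l x = 0" "x \<bullet> Y x = 0"
  using skew_parts[of x x] by (simp_all add: inner_commute)
lemma J0 [simp]: "a x \<bullet> J x = 0" "b x \<bullet> J x = 0" "Y x \<bullet> J x = 0" "J (a x) \<bullet> x = 0" "J (b x) \<bullet> x = 0" "J (Y x) \<bullet> x = 0"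
proof -
  show 1: "a x \<bullet> J x = 0" "b x \<bullet> J x = 0" "Y x \<bullet> J x = 0"
    using sym_parts[of x "J x"] skew_parts[of x "J x"] J_skew[of "a x" x] J_skew[of "b x" x] J_skew[of "Y x" x]
    by (simp_all add: inner_commute)
  show "J (a x) \<bullet> x = 0" "J (b x) \<bullet> x = 0" "J (Y x) \<bullet> x = 0" using 1 by (simp_all add: J_skew)
qed

lemma AB_inner:
  "A v \<bullet> v = a v \<bullet> v + X v \<bullet> v" "A (J v) \<bullet> J v = a v \<bullet> v - X v \<bullet> v"
  "A (J v) \<bullet> v = - (k v \<bullet> J v) - J (X v) \<bullet> v" "A v \<bullet> J v = k v \<bullet> J v - J (X v) \<bullet> v"
  "B v \<bullet> v = b v \<bullet> v + J (X v) \<bullet> v" "B (J v) \<bullet> J v = b v \<bullet> v - J (X v) \<bullet> v"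
  "B (J v) \<bullet> v = J (l v) \<bullet> v + X v \<bullet> v" "B v \<bullet> J v = X v \<bullet> v - J (l v) \<bullet> v"
  using J_skew[of "X v" v] J_skew[of "k v" v] J_skew[of "l v" v]
  by (simp_all add: A_eq B_eq inner_add_left inner_diff_left)

lemma S_e: "v \<in> I \<Longrightarrow> S e v = a v - k v + X v - Y v + (h \<bullet> v) *\<^sub>R J e"
  and S_Je: "v \<in> I \<Longrightarrow> S (J e) v = b v - l v + J (X v) - J (Y v) - (h \<bullet> v) *\<^sub>R e"
proof -
  show "S e v = a v - k v + X v - Y v + (h \<bullet> v) *\<^sub>R J e" if "v \<in> I"
  proof (rule vector_eq_rdot[THEN iffD1], rule allI)
    fix z show "S e v \<bullet> z = (a v - k v + X v - Y v + (h \<bullet> v) *\<^sub>R J e) \<bullet> z"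
      unfolding adj_A_eq[symmetric] inner_add_left inner_scaleR_left adj1[OF linear_A] S_inner br_e using that
      by (simp add: inner_add_right inner_commute)
  qed
  show "S (J e) v = b v - l v + J (X v) - J (Y v) - (h \<bullet> v) *\<^sub>R e" if "v \<in> I"
  proof (rule vector_eq_rdot[THEN iffD1], rule allI)
    fix z show "S (J e) v \<bullet> z = (b v - l v + J (X v) - J (Y v) - (h \<bullet> v) *\<^sub>R e) \<bullet> z"
      unfolding adj_B_eq[symmetric] inner_diff_left inner_scaleR_left adj1[OF linear_B] S_inner br_Je using that
      by (simp add: inner_add_right inner_diff_right inner_commute)
  qed
qed

lemma S_ee: "S e e = lam *\<^sub>R J e" "S e (J e) = mu *\<^sub>R J e" "S (J e) e = - lam *\<^sub>R e" "S (J e) (J e) = - mu *\<^sub>R e"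
  by (rule vector_eq_rdot[THEN iffD1], rule allI, unfold S_inner br_e br_Je,
      simp add: inner_add_right inner_diff_right AB_I, simp add: inner_commute)+

lemma S_I: assumes "v \<in> I" "w \<in> I" shows "S v w = - (A v \<bullet> w) *\<^sub>R e - (B v \<bullet> w) *\<^sub>R J e"
proof (rule vector_eq_rdot[THEN iffD1], rule allI)
  fix z show "S v w \<bullet> z = (- (A v \<bullet> w) *\<^sub>R e - (B v \<bullet> w) *\<^sub>R J e) \<bullet> z"
    unfolding S_inner br_I[OF assms(1)] by (simp add: inner_diff_left inner_diff_right inner_commute)
qed
lemma S_I_e: assumes "v \<in> I" shows "S v e = 0" "S v (J e) = 0"
  by (rule vector_eq_rdot[THEN iffD1], rule allI, unfold S_inner br_I[OF assms], simp add: inner_diff_right AB_I)+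

text \<open>Evaluation at \<open>e\<close>. Since \<open>\<tau> \<ge> 0\<close> this yields
  \<open>c <= 0\<close>, and once \<open>c < 0\<close> is excluded it makes \<open>lam\<close>,
  \<open>mu\<close> and \<open>h\<close> vanish together.\<close>

lemma c_eq: "c = - (lam\<^sup>2 + mu\<^sup>2) - (\<tau> + 2) / 4 * (h \<bullet> h)"
proof -
  have "Q \<tau> e = - (lam\<^sup>2 + mu\<^sup>2) - (\<tau> + 2) / 4 * (h \<bullet> h)"
    unfolding Q_def Phi_def S_ee br_e_Je
    by (simp add: inner_add_left inner_add_right inner_diff_left inner_diff_right power2_eq_square field_simps)
  then show ?thesis using Qc[of e] by simp
qed

lemma Q_I:
  assumes v: "v \<in> I"
  shows "- \<tau> * ((a v \<bullet> v)\<^sup>2 + (b v \<bullet> v)\<^sup>2) + 2 * ((X v \<bullet> v)\<^sup>2 + (J (X v) \<bullet> v)\<^sup>2) = c * (v \<bullet> v)\<^sup>2"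
proof -
  have "X v \<bullet> J v = - (J (X v) \<bullet> v)" by (simp add: J_skew)
  then have "Q \<tau> v = - \<tau> * ((a v \<bullet> v)\<^sup>2 + (b v \<bullet> v)\<^sup>2) + 2 * ((X v \<bullet> v)\<^sup>2 + (J (X v) \<bullet> v)\<^sup>2)"
    unfolding Q_def Phi_def using v
    by (simp add: S_I J_I abelian A_eq B_eq inner_add_left inner_add_right inner_diff_left inner_diff_right)
      (simp add: J_skew[of "k v"] J_skew[of "l v"] power2_eq_square field_simps)
  then show ?thesis using Qc[of v] by simp
qed

lemma Psi_orth:
  assumes "w1 \<in> I" "w2 \<in> I" "w3 \<in> I" "w4 \<in> I" "w5 \<in> I"
  shows "Psi \<tau> w1 w2 w3 w4 w5 (s1 *\<^sub>R e + t1 *\<^sub>R J e) (s2 *\<^sub>R e + t2 *\<^sub>R J e)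
    (s3 *\<^sub>R e + t3 *\<^sub>R J e) (s4 *\<^sub>R e + t4 *\<^sub>R J e) 0 = 0"
  unfolding Psi_def using assms
  by (simp add: inner_add_left inner_add_right inner_diff_left inner_diff_right J_I)

text \<open>\<open>Q_even\<close> for \<open>e\<close> and \<open>v\<close>. The components of
  \<open>S e v\<close> along \<open>e\<close> and \<open>J e\<close> do not interact with those in
  \<open>I\<close> and give the terms in \<open>h\<close>; the terms in \<open>lam\<close> and
  \<open>mu\<close> come from \<open>Psi\<close>.\<close>

lemma Q_mixed:
  assumes v: "v \<in> I"
  shows "- \<tau> * ((a v + J (b v)) \<bullet> (a v + J (b v))) - 2 * (k v \<bullet> J (l v) + k v \<bullet> a v + l v \<bullet> b v + a v \<bullet> J (b v))
    - 6 * (X v \<bullet> X v) - 4 * (X v \<bullet> Y v) - (4 * \<tau> - 2) * (Y v \<bullet> Y v)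
    + 4 * (X v \<bullet> (a v + J (b v) + k v + J (l v))) + 4 * \<tau> * (Y v \<bullet> (a v + J (b v)))
    + (2 - \<tau>) / 4 * ((h \<bullet> v)\<^sup>2 + (h \<bullet> J v)\<^sup>2)
    + lam * (b v \<bullet> v + k v \<bullet> J v - 2 * (J (X v) \<bullet> v)) - mu * (a v \<bullet> v + J (l v) \<bullet> v + 2 * (X v \<bullet> v)) = 2 * c * (v \<bullet> v)"
proof -
  have Jv: "J v \<in> I" using v by (rule J_I)
  have m: "S e v + S v e = (a v - k v + X v - Y v) + (0 *\<^sub>R e + (h \<bullet> v) *\<^sub>R J e)"
    "S (J e) (J v) + S (J v) (J e) = (J (b v) - J (l v) + X v - Y v) + ((- (h \<bullet> J v)) *\<^sub>R e + 0 *\<^sub>R J e)"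
    "S (J e) v + S (J v) e = (b v - l v + J (X v) - J (Y v)) + ((- (h \<bullet> v)) *\<^sub>R e + 0 *\<^sub>R J e)"
    "S e (J v) + S v (J e) = (J (a v) - J (k v) - J (X v) + J (Y v)) + (0 *\<^sub>R e + (h \<bullet> J v) *\<^sub>R J e)"
    "br e (J v) + br v (J e) = (J (a v) + J (k v) - J (X v) - J (Y v) - (b v + l v + J (X v) + J (Y v))) + 0"
    using v Jv by (simp_all add: S_e S_Je S_I_e br_e br_I A_eq B_eq)
  have "Phi \<tau> (S e v + S v e) (S (J e) (J v) + S (J v) (J e)) (S (J e) v + S (J v) e) (S e (J v) + S v (J e)) (br e (J v) + br v (J e))
     = - \<tau> * ((a v + J (b v)) \<bullet> (a v + J (b v))) - 2 * (k v \<bullet> J (l v) + k v \<bullet> a v + l v \<bullet> b v + a v \<bullet> J (b v))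
    - 6 * (X v \<bullet> X v) - 4 * (X v \<bullet> Y v) - (4 * \<tau> - 2) * (Y v \<bullet> Y v)
    + 4 * (X v \<bullet> (a v + J (b v) + k v + J (l v))) + 4 * \<tau> * (Y v \<bullet> (a v + J (b v)))
    + (2 - \<tau>) / 4 * ((h \<bullet> v)\<^sup>2 + (h \<bullet> J v)\<^sup>2)"
    unfolding m Phi_add mixed_identity
    by (subst Psi_orth, (intro I_closed parts_I)+)
      (simp add: Phi_def inner_add_left inner_add_right inner_diff_left inner_diff_right power2_eq_square field_simps)
  moreover have "Psi \<tau> (S e e) (S (J e) (J e)) (S (J e) e) (S e (J e)) (br e (J e))
        (S v v) (S (J v) (J v)) (S (J v) v) (S v (J v)) (br v (J v))
      = lam * (b v \<bullet> v + k v \<bullet> J v - 2 * (J (X v) \<bullet> v)) - mu * (a v \<bullet> v + J (l v) \<bullet> v + 2 * (X v \<bullet> v))"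
    unfolding S_ee br_e_Je S_I[OF v v] S_I[OF Jv v] S_I[OF v Jv] S_I[OF Jv Jv] abelian[OF v Jv] Psi_def AB_inner
    by (simp add: inner_add_left inner_add_right inner_diff_left inner_diff_right J_I)
      (simp add: J_skew[of "X v" v] field_simps)
  ultimately show ?thesis using Q_even[OF Qc, of e v] v by simp
qed

lemma jacobi_AB: "v \<in> I \<Longrightarrow> A (B v) - B (A v) = lam *\<^sub>R A v + mu *\<^sub>R B v"
proof -
  assume v: "v \<in> I"
  have "br e (br (J e) v) + br (J e) (br v e) + br v (br e (J e)) = 0" by (rule jacobi)
  then show ?thesis using v unfolding br_e_Je
    by (simp add: br_e br_Je br_I AB_I abelian algebra_simps A_eq B_eq)
qed

text \<open>Half the sum and half the difference of \<open>Q_mixed\<close> at \<open>v\<close> and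
  \<open>J v\<close>: the change of argument flips the sign of exactly the terms with one factor
  \<open>X\<close> or \<open>Y\<close>.\<close>

lemma mixed_avg: "v \<in> I \<Longrightarrow> - \<tau> * ((a v + J (b v)) \<bullet> (a v + J (b v))) - 2 * (k v \<bullet> J (l v) + k v \<bullet> a v + l v \<bullet> b v + a v \<bullet> J (b v))
    - 6 * (X v \<bullet> X v) - 4 * (X v \<bullet> Y v) - (4 * \<tau> - 2) * (Y v \<bullet> Y v)
    + (2 - \<tau>) / 4 * ((h \<bullet> v)\<^sup>2 + (h \<bullet> J v)\<^sup>2)
    + lam * (b v \<bullet> v + k v \<bullet> J v) - mu * (a v \<bullet> v + J (l v) \<bullet> v) = 2 * c * (v \<bullet> v)" (is "_ \<Longrightarrow> ?A")
  and mixed_rest: "v \<in> I \<Longrightarrow> 4 * (X v \<bullet> (a v + J (b v) + k v + J (l v))) + 4 * \<tau> * (Y v \<bullet> (a v + J (b v)))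
    = 2 * lam * (J (X v) \<bullet> v) + 2 * mu * (X v \<bullet> v)" (is "_ \<Longrightarrow> ?B")
proof -
  assume v: "v \<in> I"
  have 1: "J (a v) + J (J (b v)) = J (a v + J (b v))" by simp
  have 2: "- J (X v) \<bullet> (J (a v) + J (J (b v)) + J (k v) + J (J (l v))) = - (X v \<bullet> (a v + J (b v) + k v + J (l v)))"
    "- J (Y v) \<bullet> (J (a v) + J (J (b v))) = - (Y v \<bullet> (a v + J (b v)))"
    unfolding Js(1)[symmetric] inner_minus_left iso by simp_all
  have 3: "J (k v) \<bullet> J (J (l v)) = k v \<bullet> J (l v)" "J (a v) \<bullet> J (J (b v)) = a v \<bullet> J (b v)" "J (k v) \<bullet> J (J v) = k v \<bullet> J v"
    "J (J (l v)) \<bullet> J v = J (l v) \<bullet> v" "J (- J (X v)) \<bullet> J v = - (J (X v) \<bullet> v)" "(h \<bullet> J (J v))\<^sup>2 = (h \<bullet> v)\<^sup>2"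
    unfolding Js(3) inner_minus_left iso by simp_all
  note m = Q_mixed[OF v] Q_mixed[OF J_I[OF v], unfolded pJ 2]
  have m2: "- \<tau> * ((a v + J (b v)) \<bullet> (a v + J (b v))) - 2 * (k v \<bullet> J (l v) + k v \<bullet> a v + l v \<bullet> b v + a v \<bullet> J (b v))
    - 6 * (X v \<bullet> X v) - 4 * (X v \<bullet> Y v) - (4 * \<tau> - 2) * (Y v \<bullet> Y v)
    - 4 * (X v \<bullet> (a v + J (b v) + k v + J (l v))) - 4 * \<tau> * (Y v \<bullet> (a v + J (b v)))
    + (2 - \<tau>) / 4 * ((h \<bullet> v)\<^sup>2 + (h \<bullet> J v)\<^sup>2)
    + lam * (b v \<bullet> v + k v \<bullet> J v + 2 * (J (X v) \<bullet> v)) - mu * (a v \<bullet> v + J (l v) \<bullet> v - 2 * (X v \<bullet> v)) = 2 * c * (v \<bullet> v)"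
    using m(2) unfolding 1 3 iso inner_minus_left inner_minus_right minus_minus by (simp add: algebra_simps del: Js JJ iso)
  show ?A using m(1) m2 by (simp add: algebra_simps)
  show ?B using m(1) m2 by (simp add: algebra_simps)
qed

text \<open>The components of \<open>jacobi_AB\<close> that anticommute and commute with
  \<open>J\<close>, isolated by adding and subtracting its conjugate under \<open>J\<close>.\<close>

lemma jacobi_anti: "v \<in> I \<Longrightarrow> J (a (X v)) + J (a (Y v)) + J (k (X v)) + J (k (Y v)) + X (b v) + X (l v) + Y (b v) + Y (l v)
    - b (X v) - b (Y v) - l (X v) - l (Y v) - J (X (a v)) - J (X (k v)) - J (Y (a v)) - J (Y (k v))
    = lam *\<^sub>R (X v + Y v) + mu *\<^sub>R (J (X v) + J (Y v))" (is "_ \<Longrightarrow> ?L = ?R")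
  and jacobi_com: "v \<in> I \<Longrightarrow> a (b v) + a (l v) + k (b v) + k (l v) - b (a v) - b (k v) - l (a v) - l (k v)
     - 2 *\<^sub>R J (X (X v) + X (Y v) + Y (X v) + Y (Y v)) = lam *\<^sub>R (a v + k v) + mu *\<^sub>R (b v + l v)" (is "_ \<Longrightarrow> ?M = ?N")
proof -
  assume v: "v \<in> I"
  define L where "L = (\<lambda>v. A (B v) - B (A v) - (lam *\<^sub>R A v + mu *\<^sub>R B v))"
  have "L v = 0" "L (J v) = 0" using jacobi_AB[of v] jacobi_AB[of "J v"] v J_I by (simp_all add: L_def)
  then have "L v + J (L (J v)) = 0" "L v - J (L (J v)) = 0" by simp_all
  moreover have "L v + J (L (J v)) = 2 *\<^sub>R (?L - ?R)" "L v - J (L (J v)) = 2 *\<^sub>R (?M - ?N)"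
  proof -
    define A1 where "A1 = (\<lambda>x. a x + k x)"
    define A2 where "A2 = (\<lambda>x. X x + Y x)"
    define B1 where "B1 = (\<lambda>x. b x + l x)"
    have J: "A1 (J x) = J (A1 x)" "A2 (J x) = - J (A2 x)" "B1 (J x) = J (B1 x)" for x
      by (simp_all add: A1_def A2_def B1_def)
    have ad: "A1 (x + y) = A1 x + A1 y" "A2 (x + y) = A2 x + A2 y" "B1 (x + y) = B1 x + B1 y"
      "A1 (- x) = - A1 x" "A2 (- x) = - A2 x" "B1 (- x) = - B1 x" for x y
      by (simp_all add: A1_def A2_def B1_def)
    have AB: "A x = A1 x + A2 x" "B x = B1 x + J (A2 x)" for x
      by (simp_all add: A_eq B_eq A1_def A2_def B1_def)
    have L: "L w = A1 (B1 w) + J (A1 (A2 w)) + A2 (B1 w) - J (A2 (A2 w)) - B1 (A1 w) - B1 (A2 w) - J (A2 (A1 w)) - J (A2 (A2 w))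
       - lam *\<^sub>R A1 w - lam *\<^sub>R A2 w - mu *\<^sub>R B1 w - mu *\<^sub>R J (A2 w)" for w
      unfolding L_def AB ad J by (simp add: ad J scaleR_add_right)
    have "L v + J (L (J v)) = 2 *\<^sub>R (J (A1 (A2 v)) + A2 (B1 v) - B1 (A2 v) - J (A2 (A1 v)) - lam *\<^sub>R A2 v - mu *\<^sub>R J (A2 v))"
      unfolding L J ad by (simp add: J ad scaleR_2)
    also have "\<dots> = 2 *\<^sub>R (?L - ?R)"
      by (rule arg_cong[where f = "\<lambda>x. 2 *\<^sub>R x"]) (simp add: A1_def A2_def B1_def scaleR_add_right)
    finally show "L v + J (L (J v)) = 2 *\<^sub>R (?L - ?R)" .
    have "L v - J (L (J v)) = 2 *\<^sub>R (A1 (B1 v) - B1 (A1 v) - 2 *\<^sub>R J (A2 (A2 v)) - lam *\<^sub>R A1 v - mu *\<^sub>R B1 v)"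
      unfolding L J ad by (simp add: J ad scaleR_2)
    also have "\<dots> = 2 *\<^sub>R (?M - ?N)"
      by (rule arg_cong[where f = "\<lambda>x. 2 *\<^sub>R x"]) (simp add: A1_def A2_def B1_def scaleR_add_right)
    finally show "L v - J (L (J v)) = 2 *\<^sub>R (?M - ?N)" .
  qed
  ultimately show "?L = ?R" "?M = ?N" by simp_all
qed

text \<open>Unimodularity enters the complex case here: the bracket of \<open>e\<close> and
  \<open>J e\<close> adds \<open>mu\<close> to the trace of \<open>br e\<close> and
  \<open>- lam\<close> to that of \<open>br (J e)\<close>.\<close>

lemma trace_AB: "linear_trace a = - mu" "linear_trace b = lam"
proof -
  have "br e = (\<lambda>z. A z + (z \<bullet> J e) *\<^sub>R (h + lam *\<^sub>R e + mu *\<^sub>R J e))" using br_e by blast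
  then have "0 = linear_trace A + mu" using unimod[of e]
    by (simp only: linear_trace_add linear_trace_rank1) (simp add: inner_add_right)
  then show "linear_trace a = - mu" by (simp add: linear_trace_sc linear_A)
  have "br (J e) = (\<lambda>z. B z - (z \<bullet> e) *\<^sub>R (h + lam *\<^sub>R e + mu *\<^sub>R J e))" using br_Je by blast
  then have "0 = linear_trace B - lam" using unimod[of "J e"]
    by (simp only: linear_trace_diff linear_trace_rank1) (simp add: inner_add_right)
  then show "linear_trace b = lam" by (simp add: linear_trace_sc linear_B)
qed

lemma parts_P [simp]: "a (P x) = a x" "k (P x) = k x" "X (P x) = X x" "Y (P x) = Y x" "b (P x) = b x" "l (P x) = l x"
proof -
  have "adjoint A (P x) = adjoint A x" "adjoint B (P x) = adjoint B x" for x
    by (rule vector_eq_rdot[THEN iffD1], rule allI, simp add: adj1[OF linear_A] adj1[OF linear_B],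
      simp add: inner_commute[of _ "P x"] P_sym AB_I, rule inner_commute)+
  moreover have "A (P x) = A x" "B (P x) = B x" for x by (simp_all add: A_def B_def)
  moreover have "J (P x) = P (J x)" by (simp add: P_J)
  ultimately show "a (P x) = a x" "k (P x) = k x" "X (P x) = X x" "Y (P x) = Y x" "b (P x) = b x" "l (P x) = l x"
    unfolding sc_def kc_def sa_def ka_def by simp_all
qed

end

section \<open>Eigenvectors and coefficient comparison in the quartic identity for c < 0\<close>

lemma quadratic_nonpos:
  fixes p q :: real
  assumes "\<And>t. 2 * t * p + t\<^sup>2 * q \<le> 0"
  shows "p = 0"
proof (rule ccontr)
  assume p: "p \<noteq> 0"
  \<comment> \<open>Chosen so that \<open>2 * d + q > 0\<close>; at \<open>t = p / d\<close> the
    linear term then dominates.\<close>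
  define d where "d = 1 + \<bar>q\<bar>"
  have d: "d > 0" unfolding d_def by simp
  have "2 * d + q > 0" unfolding d_def by (cases "q \<ge> 0") auto
  have "2 * (p / d) * p + (p / d)\<^sup>2 * q = p\<^sup>2 * (2 * d + q) / d\<^sup>2"
    using d by (simp add: field_simps power2_eq_square)
  also have "\<dots> > 0" using p d \<open>2 * d + q > 0\<close> by simp
  finally show False using assms[of "p / d"] by simp
qed

text \<open>The Rayleigh quotient attains its maximum on the unit sphere of \<open>V\<close>;
  stationarity there, tested in the direction of the residual \<open>u = f v - \<sigma> v\<close>,
  forces \<open>u = 0\<close>.\<close>

lemma symmetric_max_eigenvector:
  fixes f :: "'a::euclidean_space \<Rightarrow> 'a"
  assumes V: "subspace V" and f: "linear f" and fV: "\<And>x. x \<in> V \<Longrightarrow> f x \<in> V"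
    and sym: "\<And>x y. f x \<bullet> y = x \<bullet> f y" and w: "w \<in> V" "w \<noteq> 0"
  obtains v \<sigma> where "v \<in> V" "v \<bullet> v = 1" "f v = \<sigma> *\<^sub>R v" "\<And>x. x \<in> V \<Longrightarrow> f x \<bullet> x \<le> \<sigma> * (x \<bullet> x)"
proof -
  define K where "K = V \<inter> sphere 0 1"
  have "compact K" unfolding K_def using closed_subspace[OF V] by (simp add: closed_Int_compact)
  moreover have "w /\<^sub>R norm w \<in> K" using w subspace_scale[OF V w(1)] by (simp add: K_def)
  moreover have "continuous_on K (\<lambda>x. f x \<bullet> x)"
    by (intro continuous_intros linear_continuous_on linear_conv_bounded_linear[THEN iffD1] f)
  ultimately obtain v where v: "v \<in> K" and max: "\<And>x. x \<in> K \<Longrightarrow> f x \<bullet> x \<le> f v \<bullet> v"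
    using continuous_attains_sup[of K "\<lambda>x. f x \<bullet> x"] by blast
  define \<sigma> where "\<sigma> = f v \<bullet> v"
  have v': "v \<in> V" "v \<bullet> v = 1" using v by (auto simp: K_def dot_square_norm)
  have le: "f x \<bullet> x \<le> \<sigma> * (x \<bullet> x)" if "x \<in> V" for x
  proof (cases "x = 0")
    case False
    have "x /\<^sub>R norm x \<in> K" using False subspace_scale[OF V that] by (simp add: K_def)
    from max[OF this] show ?thesis
      using False by (simp add: \<sigma>_def linear_scale[OF f] dot_square_norm field_simps power2_eq_square)
  qed (simp add: linear_0[OF f])
  define u where "u = f v - \<sigma> *\<^sub>R v"
  have u: "u \<in> V" unfolding u_def using fV V v'(1) by (auto intro: subspace_diff subspace_scale)
  have "u \<bullet> u = 0"
  proof (rule quadratic_nonpos)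
    fix t :: real
    have "v + t *\<^sub>R u \<in> V" using u v'(1) V by (auto intro: subspace_add subspace_scale)
    from le[OF this] have "f (v + t *\<^sub>R u) \<bullet> (v + t *\<^sub>R u) - \<sigma> * ((v + t *\<^sub>R u) \<bullet> (v + t *\<^sub>R u)) \<le> 0" by simp
    moreover have "f (v + t *\<^sub>R u) \<bullet> (v + t *\<^sub>R u) - \<sigma> * ((v + t *\<^sub>R u) \<bullet> (v + t *\<^sub>R u))
       = 2 * t * (u \<bullet> u) + t\<^sup>2 * (f u \<bullet> u - \<sigma> * (u \<bullet> u))"
    proof -
      have "u \<bullet> f v = u \<bullet> u + \<sigma> * (u \<bullet> v)" unfolding u_def by (simp add: inner_diff_right)
      then have "f v \<bullet> u = u \<bullet> u + \<sigma> * (u \<bullet> v)" "f u \<bullet> v = u \<bullet> u + \<sigma> * (u \<bullet> v)"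
        by (simp_all only: inner_commute[of "f v"] sym[of u v])
      then show ?thesis
        by (simp add: linear_add[OF f] linear_scale[OF f] inner_add_left inner_add_right v'(2)
            power2_eq_square inner_commute[of v u] algebra_simps flip: \<sigma>_def)
    qed
    ultimately show "2 * t * (u \<bullet> u) + t\<^sup>2 * (f u \<bullet> u - \<sigma> * (u \<bullet> u)) \<le> 0" by simp
  qed
  then have "f v = \<sigma> *\<^sub>R v" by (simp add: u_def)
  with v' le show thesis by (intro that)
qed

lemma quartic_zero:
  fixes c0 c1 c2 c3 c4 :: real
  assumes "\<And>t. c0 + c1 * t + c2 * t\<^sup>2 + c3 * t ^ 3 + c4 * t ^ 4 = 0"
  shows "c0 = 0" "c1 = 0" "c2 = 0" "c3 = 0" "c4 = 0"
  using assms[of 0] assms[of 1] assms[of "-1"] assms[of 2] assms[of "-2"] by simp_all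

text \<open>Abstracted because it serves two cases: the parts of \<open>A\<close> and
  \<open>B\<close> on a complex ideal, and the symmetric parts of \<open>C1\<close> and a rescaled
  \<open>Ck\<close> with \<open>X = 0\<close> otherwise.\<close>

locale quartic_forms = hermitian_lie br J for br :: "'a::euclidean_space \<Rightarrow> 'a \<Rightarrow> 'a" and J +
  fixes V :: "'a set" and p q X :: "'a \<Rightarrow> 'a" and \<tau> c :: real
  assumes sub: "subspace V" and J_V: "u \<in> V \<Longrightarrow> J u \<in> V" and lin: "linear p" "linear q" "linear X"
    and maps: "u \<in> V \<Longrightarrow> p u \<in> V" "u \<in> V \<Longrightarrow> q u \<in> V"
    and sym: "p x \<bullet> y = x \<bullet> p y" "q x \<bullet> y = x \<bullet> q y" "X x \<bullet> y = x \<bullet> X y"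
    and pJ [simp]: "p (J x) = J (p x)" "q (J x) = J (q x)" "X (J x) = - J (X x)"
    and tau_nonneg: "\<tau> \<ge> 0"
    and quartic: "v \<in> V \<Longrightarrow> - \<tau> * ((p v \<bullet> v)\<^sup>2 + (q v \<bullet> v)\<^sup>2) + 2 * ((X v \<bullet> v)\<^sup>2 + (J (X v) \<bullet> v)\<^sup>2) = c * (v \<bullet> v)\<^sup>2"
begin

lemmas V_closed = subspace_add[OF sub] subspace_diff[OF sub] subspace_scale[OF sub] subspace_neg[OF sub] subspace_0[OF sub] J_V
lemmas pl [simp] = lin[THEN linear_add] lin[THEN linear_diff] lin[THEN linear_neg] lin[THEN linear_scale] lin[THEN linear_0]

lemma J0 [simp]: "p x \<bullet> J x = 0" "q x \<bullet> J x = 0" "J (p x) \<bullet> x = 0" "J (q x) \<bullet> x = 0"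
  using sym(1,2)[of x "J x"] J_skew[of "p x" x] J_skew[of "q x" x] by (simp_all add: inner_commute)

text \<open>Comparing coefficients of \<open>t\<close> in the quartic identity along \<open>v + t w\<close>.\<close>

lemma quartic_coeffs:
  assumes v: "v \<in> V" "v \<bullet> v = 1" "X v = \<sigma> *\<^sub>R v" and w: "w \<in> V" "v \<bullet> w = 0" "J v \<bullet> w = 0"
  shows "\<tau> * ((p v \<bullet> v)\<^sup>2 + (q v \<bullet> v)\<^sup>2) = - c + 2 * \<sigma>\<^sup>2"
    and "\<tau> * ((p v \<bullet> v) * (p v \<bullet> w) + (q v \<bullet> v) * (q v \<bullet> w)) = 0"
    and "\<tau> * (2 * ((p v \<bullet> w)\<^sup>2 + (q v \<bullet> w)\<^sup>2) + (p v \<bullet> v) * (p w \<bullet> w) + (q v \<bullet> v) * (q w \<bullet> w)) = - c * (w \<bullet> w) + 2 * \<sigma> * (X w \<bullet> w)"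
    and "\<tau> * ((p w \<bullet> w) * (p v \<bullet> w) + (q w \<bullet> w) * (q v \<bullet> w)) = 0"
    and "\<tau> * ((p w \<bullet> w)\<^sup>2 + (q w \<bullet> w)\<^sup>2) = - c * (w \<bullet> w)\<^sup>2 + 2 * ((X w \<bullet> w)\<^sup>2 + (J (X w) \<bullet> w)\<^sup>2)"
proof -
  define A0 where "A0 = p v \<bullet> v" define A1 where "A1 = p v \<bullet> w" define A2 where "A2 = p w \<bullet> w"
  define B0 where "B0 = q v \<bullet> v" define B1 where "B1 = q v \<bullet> w" define B2 where "B2 = q w \<bullet> w"
  define K where "K = X w \<bullet> w" define L where "L = J (X w) \<bullet> w" define n where "n = w \<bullet> w"
  have q: "- \<tau> * ((A0 + 2 * t * A1 + t\<^sup>2 * A2)\<^sup>2 + (B0 + 2 * t * B1 + t\<^sup>2 * B2)\<^sup>2)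
     + 2 * ((\<sigma> + t\<^sup>2 * K)\<^sup>2 + (t\<^sup>2 * L)\<^sup>2) - c * (1 + t\<^sup>2 * n)\<^sup>2 = 0" for t
  proof -
    have VI: "v + t *\<^sub>R w \<in> V" using v(1) w(1) by (intro V_closed)
    have s: "p w \<bullet> v = A1" "q w \<bullet> v = B1" unfolding A1_def B1_def using sym by (simp_all add: inner_commute)
    have "X w \<bullet> v = 0" using sym(3)[of w v] v(3) w(2) by (simp add: inner_commute)
    moreover have "J (X w) \<bullet> v = 0"
    proof -
      have "J (X w) \<bullet> v = - (X w \<bullet> J v)" by (rule J_skew)
      also have "\<dots> = w \<bullet> J (X v)" using sym(3)[of w "J v"] by simp
      finally show ?thesis using v(3) w(3) by (simp add: inner_commute)
    qed
    ultimately have "p (v + t *\<^sub>R w) \<bullet> (v + t *\<^sub>R w) = A0 + 2 * t * A1 + t\<^sup>2 * A2"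
      "q (v + t *\<^sub>R w) \<bullet> (v + t *\<^sub>R w) = B0 + 2 * t * B1 + t\<^sup>2 * B2"
      "X (v + t *\<^sub>R w) \<bullet> (v + t *\<^sub>R w) = \<sigma> + t\<^sup>2 * K"
      "J (X (v + t *\<^sub>R w)) \<bullet> (v + t *\<^sub>R w) = t\<^sup>2 * L"
      "(v + t *\<^sub>R w) \<bullet> (v + t *\<^sub>R w) = 1 + t\<^sup>2 * n"
      using v w by (simp_all add: inner_add_left inner_add_right s K_def L_def n_def power2_eq_square algebra_simps
        A0_def[symmetric] A1_def[symmetric] A2_def[symmetric] B0_def[symmetric] B1_def[symmetric] B2_def[symmetric] inner_commute[of w v])
    with quartic[OF VI] show ?thesis by simp
  qed
  have "(- \<tau> * (A0\<^sup>2 + B0\<^sup>2) + 2 * \<sigma>\<^sup>2 - c) + (- 4 * \<tau> * (A0 * A1 + B0 * B1)) * t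
      + (- 2 * \<tau> * (2 * (A1\<^sup>2 + B1\<^sup>2) + A0 * A2 + B0 * B2) + 4 * \<sigma> * K - 2 * c * n) * t\<^sup>2
      + (- 4 * \<tau> * (A2 * A1 + B2 * B1)) * t ^ 3
      + (- \<tau> * (A2\<^sup>2 + B2\<^sup>2) + 2 * (K\<^sup>2 + L\<^sup>2) - c * n\<^sup>2) * t ^ 4 = 0" for t
    using q[of t] by (simp add: power2_eq_square power3_eq_cube power4_eq_xxxx algebra_simps)
  from quartic_zero[OF this] show "\<tau> * ((p v \<bullet> v)\<^sup>2 + (q v \<bullet> v)\<^sup>2) = - c + 2 * \<sigma>\<^sup>2"
    "\<tau> * ((p v \<bullet> v) * (p v \<bullet> w) + (q v \<bullet> v) * (q v \<bullet> w)) = 0"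
    "\<tau> * (2 * ((p v \<bullet> w)\<^sup>2 + (q v \<bullet> w)\<^sup>2) + (p v \<bullet> v) * (p w \<bullet> w) + (q v \<bullet> v) * (q w \<bullet> w)) = - c * (w \<bullet> w) + 2 * \<sigma> * (X w \<bullet> w)"
    "\<tau> * ((p w \<bullet> w) * (p v \<bullet> w) + (q w \<bullet> w) * (q v \<bullet> w)) = 0"
    "\<tau> * ((p w \<bullet> w)\<^sup>2 + (q w \<bullet> w)\<^sup>2) = - c * (w \<bullet> w)\<^sup>2 + 2 * ((X w \<bullet> w)\<^sup>2 + (J (X w) \<bullet> w)\<^sup>2)"
    unfolding A0_def A1_def A2_def B0_def B1_def B2_def K_def L_def n_def by (simp_all add: algebra_simps)
qed

end

text \<open>Read the pairs \<open>(A, B)\<close> as vectors of the plane, the primed one belonging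
  to \<open>J w\<close>. If \<open>(A1, B1)\<close> is not zero, \<open>(A0, B0)\<close> and
  \<open>(A2, B2)\<close> are both orthogonal to it, hence parallel, and Cauchy-Schwarz for them is
  an equality. With \<open>\<rho> = sqrt (K\<^sup>2 + L\<^sup>2)\<close> the coefficients combine
  into \<open>2 * g * (\<rho> + \<sigma> * n)\<^sup>2 = 0\<close>, so \<open>\<sigma> = 0\<close>,
  against the positivity of \<open>g * n - \<tau> * N\<close>.\<close>

lemma planar_contradiction:
  fixes A0 A1 A2 A1' B0 B1 B2 B1' K L \<sigma> n \<tau> g :: real
  assumes g: "g > 0" and n: "n > 0" and \<tau>: "\<tau> \<ge> 0" and \<sigma>: "\<sigma> \<ge> 0"
    and c0: "\<tau> * (A0\<^sup>2 + B0\<^sup>2) = g + 2 * \<sigma>\<^sup>2"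
    and c1: "\<tau> * (A0 * A1 + B0 * B1) = 0" "\<tau> * (A0 * A1' + B0 * B1') = 0"
    and c2: "\<tau> * (2 * (A1\<^sup>2 + B1\<^sup>2) + A0 * A2 + B0 * B2) = g * n + 2 * \<sigma> * K"
      "\<tau> * (2 * (A1'\<^sup>2 + B1'\<^sup>2) + A0 * A2 + B0 * B2) = g * n - 2 * \<sigma> * K"
      "\<tau> * (A1 * A1' + B1 * B1') = - \<sigma> * L"
    and c3: "\<tau> * (A2 * A1 + B2 * B1) = 0"
    and c4: "\<tau> * (A2\<^sup>2 + B2\<^sup>2) = g * n\<^sup>2 + 2 * (K\<^sup>2 + L\<^sup>2)"
    and \<sigma>0: "\<sigma> = 0 \<Longrightarrow> K = 0 \<and> L = 0"
  shows "A1 = 0 \<and> B1 = 0"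
proof (rule ccontr)
  assume nz: "\<not> (A1 = 0 \<and> B1 = 0)"
  have "g + 2 * \<sigma>\<^sup>2 > 0" using g by (simp add: add_pos_nonneg)
  with c0 have t: "\<tau> > 0" using \<tau> by (cases "\<tau> = 0") auto
  define N where "N = A0 * A2 + B0 * B2"
  define D where "D = A1\<^sup>2 + B1\<^sup>2"
  define D' where "D' = A1'\<^sup>2 + B1'\<^sup>2"
  define R where "R = K\<^sup>2 + L\<^sup>2"
  have D: "D > 0" using nz unfolding D_def by (metis sum_power2_gt_zero_iff)
  have o: "A0 * A1 + B0 * B1 = 0" "A0 * A1' + B0 * B1' = 0" "A2 * A1 + B2 * B1 = 0"
    using c1 c3 t by simp_all
  have "(A0 * B2 - A2 * B0) * A1 = 0" "(A0 * B2 - A2 * B0) * B1 = 0" using o by algebra+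
  then have par: "A0 * B2 - A2 * B0 = 0" using nz by auto
  have N2: "N\<^sup>2 = (A0\<^sup>2 + B0\<^sup>2) * (A2\<^sup>2 + B2\<^sup>2)" unfolding N_def using par by algebra
  have nz0: "\<not> (A0 = 0 \<and> B0 = 0)" using c0 \<open>g + 2 * \<sigma>\<^sup>2 > 0\<close> by auto
  have "(A1 * B1' - A1' * B1) * A0 = 0" "(A1 * B1' - A1' * B1) * B0 = 0" using o by algebra+
  then have par': "A1 * B1' - A1' * B1 = 0" using nz0 by auto
  have DD: "(A1 * A1' + B1 * B1')\<^sup>2 = D * D'" unfolding D_def D'_def using par' by algebra
  have s: "\<tau> * (D + D') = g * n - \<tau> * N" "\<tau> * (D - D') = 2 * \<sigma> * K"
    using c2(1,2) unfolding D_def D'_def N_def by (simp_all add: algebra_simps)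
  have "(\<tau> * (D + D'))\<^sup>2 = (\<tau> * (D - D'))\<^sup>2 + 4 * (\<tau> * (A1 * A1' + B1 * B1'))\<^sup>2"
    unfolding power_mult_distrib DD by (simp add: power2_eq_square algebra_simps)
  then have sq: "(g * n - \<tau> * N)\<^sup>2 = (2 * \<sigma>)\<^sup>2 * R"
    unfolding s c2(3) R_def by (simp add: power2_eq_square algebra_simps)
  have pos: "g * n - \<tau> * N > 0" unfolding s(1)[symmetric] using t D unfolding D'_def by (simp add: add_pos_nonneg)
  have R: "R \<ge> 0" unfolding R_def by simp
  define \<rho> where "\<rho> = sqrt R"
  have \<rho>: "\<rho> \<ge> 0" "\<rho>\<^sup>2 = R" unfolding \<rho>_def using R by simp_all
  have "(g * n - \<tau> * N)\<^sup>2 = (2 * \<sigma> * \<rho>)\<^sup>2" unfolding sq power_mult_distrib \<rho>(2) ..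
  then have eq: "g * n - \<tau> * N = 2 * \<sigma> * \<rho>" using pos \<rho>(1) \<sigma> by (simp add: power2_eq_iff_nonneg)
  have "(\<tau> * N)\<^sup>2 = (g + 2 * \<sigma>\<^sup>2) * (g * n\<^sup>2 + 2 * \<rho>\<^sup>2)"
    unfolding c0[symmetric] \<rho>(2) R_def c4[symmetric] by (simp add: power_mult_distrib N2 power2_eq_square[of \<tau>])
  moreover have "\<tau> * N = g * n - 2 * \<sigma> * \<rho>" using eq by simp
  ultimately have "2 * g * (\<rho> + \<sigma> * n)\<^sup>2 = 0" by algebra
  then have "\<rho> + \<sigma> * n = 0" using g by simp
  then have "\<sigma> * n = 0" using \<rho>(1) \<sigma> n by (smt (verit) mult_nonneg_nonneg)
  then have "\<sigma> = 0" using n by simp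
  with eq pos show False by simp
qed

context quartic_forms begin

text \<open>A component of \<open>p v\<close> or \<open>q v\<close> along some \<open>w\<close>
  orthogonal to \<open>v\<close> and \<open>J v\<close> is excluded by
  \<open>planar_contradiction\<close>. The coefficients at \<open>w\<close> and \<open>J w\<close>
  give its squares, those at \<open>w + J w\<close> the mixed product. Components along
  \<open>J v\<close> vanish by symmetry and commutation with \<open>J\<close>.\<close>

lemma eigenvector_scalar:
  assumes c: "c < 0" and v: "v \<in> V" "v \<bullet> v = 1" "X v = \<sigma> *\<^sub>R v" and \<sigma>: "\<sigma> \<ge> 0" "\<sigma> = 0 \<Longrightarrow> \<forall>x. X x = 0"
  shows "p v = (p v \<bullet> v) *\<^sub>R v" "q v = (q v \<bullet> v) *\<^sub>R v" "\<tau> * ((p v \<bullet> v)\<^sup>2 + (q v \<bullet> v)\<^sup>2) = - c + 2 * \<sigma>\<^sup>2"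
proof -
  have main: "p v \<bullet> w = 0 \<and> q v \<bullet> w = 0" if w: "w \<in> V" "v \<bullet> w = 0" "J v \<bullet> w = 0" for w
  proof (cases "w = 0")
    case False
    have w': "J w \<in> V" "v \<bullet> J w = 0" "J v \<bullet> J w = 0" using w J_V J_skew[of v w] by simp_all
    have w'': "w + J w \<in> V" "v \<bullet> (w + J w) = 0" "J v \<bullet> (w + J w) = 0"
      using w w' by (simp_all add: V_closed inner_add_right)
    have JX: "X (J w) \<bullet> J w = - (X w \<bullet> w)" "J (X (J w)) \<bullet> J w = - (J (X w) \<bullet> w)"
       "X (w + J w) \<bullet> (w + J w) = - 2 * (J (X w) \<bullet> w)"
      using J_skew[of "X w" w] by (simp_all add: inner_add_left inner_add_right inner_diff_left)
    have aJ: "p (J w) \<bullet> J w = p w \<bullet> w" "q (J w) \<bullet> J w = q w \<bullet> w"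
      "p (w + J w) \<bullet> (w + J w) = 2 * (p w \<bullet> w)" "q (w + J w) \<bullet> (w + J w) = 2 * (q w \<bullet> w)"
      "(w + J w) \<bullet> (w + J w) = 2 * (w \<bullet> w)" by (simp_all add: inner_add_left inner_add_right)
    note co = quartic_coeffs[OF v w]
    note co' = quartic_coeffs[OF v w']
    note co'' = quartic_coeffs(3)[OF v w'']
    show ?thesis
    proof (rule planar_contradiction[where ?A1.0 = "p v \<bullet> w" and ?A1'.0 = "p v \<bullet> J w" and ?B1.0 = "q v \<bullet> w" and ?B1'.0 = "q v \<bullet> J w"])
      show "- c > 0" "w \<bullet> w > 0" using c False by simp_all
      show "\<tau> \<ge> 0" by (rule tau_nonneg)
      show "\<sigma> \<ge> 0" by fact
      show "\<tau> * ((p v \<bullet> v)\<^sup>2 + (q v \<bullet> v)\<^sup>2) = - c + 2 * \<sigma>\<^sup>2" by (rule co)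
      show "\<tau> * ((p v \<bullet> v) * (p v \<bullet> w) + (q v \<bullet> v) * (q v \<bullet> w)) = 0" by (rule co)
      show "\<tau> * ((p v \<bullet> v) * (p v \<bullet> J w) + (q v \<bullet> v) * (q v \<bullet> J w)) = 0" by (rule co')
      show "\<tau> * (2 * ((p v \<bullet> w)\<^sup>2 + (q v \<bullet> w)\<^sup>2) + (p v \<bullet> v) * (p w \<bullet> w) + (q v \<bullet> v) * (q w \<bullet> w)) = - c * (w \<bullet> w) + 2 * \<sigma> * (X w \<bullet> w)"
        by (rule co)
      show "\<tau> * (2 * ((p v \<bullet> J w)\<^sup>2 + (q v \<bullet> J w)\<^sup>2) + (p v \<bullet> v) * (p w \<bullet> w) + (q v \<bullet> v) * (q w \<bullet> w)) = - c * (w \<bullet> w) - 2 * \<sigma> * (X w \<bullet> w)"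
        using co'(3) unfolding aJ JX iso by simp
      show "\<tau> * ((p v \<bullet> w) * (p v \<bullet> J w) + (q v \<bullet> w) * (q v \<bullet> J w)) = - \<sigma> * (J (X w) \<bullet> w)"
        using co'' co(3) co'(3) unfolding aJ JX iso inner_add_right[of _ w "J w"]
        by (simp add: power2_eq_square algebra_simps J_skew[of "X w" w])
      show "\<tau> * ((p w \<bullet> w) * (p v \<bullet> w) + (q w \<bullet> w) * (q v \<bullet> w)) = 0" by (rule co)
      show "\<tau> * ((p w \<bullet> w)\<^sup>2 + (q w \<bullet> w)\<^sup>2) = - c * (w \<bullet> w)\<^sup>2 + 2 * ((X w \<bullet> w)\<^sup>2 + (J (X w) \<bullet> w)\<^sup>2)" by (rule co)
      show "X w \<bullet> w = 0 \<and> J (X w) \<bullet> w = 0" if "\<sigma> = 0" using \<sigma>(2)[OF that] by simp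
    qed
  qed simp
  have sc: "u = (u \<bullet> v) *\<^sub>R v" if u: "u \<in> V" "u \<bullet> J v = 0" and o: "\<And>w. w \<in> V \<Longrightarrow> v \<bullet> w = 0 \<Longrightarrow> J v \<bullet> w = 0 \<Longrightarrow> u \<bullet> w = 0" for u
  proof -
    define w where "w = u - (u \<bullet> v) *\<^sub>R v"
    have "w \<in> V" "v \<bullet> w = 0" "J v \<bullet> w = 0" unfolding w_def using u v
      by (simp_all add: V_closed inner_diff_right inner_commute)
    from o[OF this] this(2) have "w \<bullet> w = 0" unfolding w_def by (simp add: inner_diff_left inner_commute)
    then show ?thesis by (simp add: w_def)
  qed
  show "p v = (p v \<bullet> v) *\<^sub>R v" "q v = (q v \<bullet> v) *\<^sub>R v" using main maps[OF v(1)] by (intro sc; simp)+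
  show "\<tau> * ((p v \<bullet> v)\<^sup>2 + (q v \<bullet> v)\<^sup>2) = - c + 2 * \<sigma>\<^sup>2"
    using quartic_coeffs(1)[OF v, of 0] by (simp add: V_closed)
qed

end

lemma pointwise_scalar:
  fixes f :: "'a::euclidean_space \<Rightarrow> 'a"
  assumes V: "subspace V" and f: "linear f" and sc: "\<And>v. v \<in> V \<Longrightarrow> v \<bullet> v = 1 \<Longrightarrow> \<exists>r. f v = r *\<^sub>R v"
  shows "\<exists>r. \<forall>v\<in>V. f v = r *\<^sub>R v"
proof (cases "V \<subseteq> {0}")
  case True
  then have "\<forall>v\<in>V. f v = 0 *\<^sub>R v" using linear_0[OF f] by auto
  then show ?thesis by blast
next
  case False
  have ev: "\<exists>r. f v = r *\<^sub>R v" if "v \<in> V" for v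
  proof (cases "v = 0")
    case False
    have "v /\<^sub>R norm v \<in> V" "(v /\<^sub>R norm v) \<bullet> (v /\<^sub>R norm v) = 1"
      using False that by (simp_all add: subspace_scale[OF V] dot_square_norm power2_eq_square)
    then obtain r where "f (v /\<^sub>R norm v) = r *\<^sub>R (v /\<^sub>R norm v)"
      using sc by blast
    then have "norm v *\<^sub>R f (v /\<^sub>R norm v) = r *\<^sub>R v" using False by simp
    then show ?thesis using False by (auto simp: linear_scale[OF f])
  qed (simp add: linear_0[OF f])
  obtain w where w: "w \<in> V" "w \<noteq> 0" using False by auto
  obtain r where r: "f w = r *\<^sub>R w" using ev[OF w(1)] by blast
  have "f v = r *\<^sub>R v" if v: "v \<in> V" for v
  proof -
    obtain s where s: "f v = s *\<^sub>R v" using ev[OF v] by blast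
    obtain t where t: "f (v + w) = t *\<^sub>R (v + w)" using ev[of "v + w"] v w subspace_add[OF V] by blast
    have eq: "(s - t) *\<^sub>R v = (t - r) *\<^sub>R w" using s r t by (simp add: linear_add[OF f] algebra_simps)
    show ?thesis
    proof (cases "s = t")
      case True then show ?thesis using eq w s by auto
    next
      case False
      then have "v = ((t - r) / (s - t)) *\<^sub>R w"
        using arg_cong[OF eq, of "\<lambda>x. (1 / (s - t)) *\<^sub>R x"] by simp
      then show ?thesis using r by (metis linear_scale[OF f] scaleR_left_commute)
    qed
  qed
  then show ?thesis by blast
qed

context quartic_forms begin

lemma scalar_forms:
  assumes c: "c < 0" and X0: "\<And>x. X x = 0" and w: "w \<in> V" "w \<noteq> 0"
  obtains \<alpha> \<beta> where "\<And>v. v \<in> V \<Longrightarrow> p v = \<alpha> *\<^sub>R v" "\<And>v. v \<in> V \<Longrightarrow> q v = \<beta> *\<^sub>R v" "\<tau> * (\<alpha>\<^sup>2 + \<beta>\<^sup>2) = - c"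
proof -
  have scal: "p v = (p v \<bullet> v) *\<^sub>R v" "q v = (q v \<bullet> v) *\<^sub>R v" "\<tau> * ((p v \<bullet> v)\<^sup>2 + (q v \<bullet> v)\<^sup>2) = - c"
    if "v \<in> V" "v \<bullet> v = 1" for v
    using eigenvector_scalar[OF c that, of 0] X0 by simp_all
  obtain \<alpha> where \<alpha>: "\<And>v. v \<in> V \<Longrightarrow> p v = \<alpha> *\<^sub>R v" using pointwise_scalar[OF sub lin(1)] scal(1) by blast
  obtain \<beta> where \<beta>: "\<And>v. v \<in> V \<Longrightarrow> q v = \<beta> *\<^sub>R v" using pointwise_scalar[OF sub lin(2)] scal(2) by blast
  define u where "u = w /\<^sub>R norm w"
  have u: "u \<in> V" "u \<bullet> u = 1"
    unfolding u_def using w by (simp_all add: subspace_scale[OF sub] dot_square_norm power2_eq_square)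
  have "\<tau> * (\<alpha>\<^sup>2 + \<beta>\<^sup>2) = - c"
    using scal(3)[OF u] \<alpha>[OF u(1)] \<beta>[OF u(1)] u(2) by simp
  with \<alpha> \<beta> show thesis by (rule that)
qed

end

context complex_ideal begin

sublocale quartic: quartic_forms br J I a b X \<tau> c
  by unfold_locales (use sub J_I lin_parts sym_parts tau_nonneg Q_I in auto)

end

text \<open>The trace of a product does not depend on the order of its factors, but moving a
  symmetric and a skew factor across the scalar product yields opposite signs.\<close>

lemma sum_inner_sym_skew:
  fixes f g :: "'a::euclidean_space \<Rightarrow> 'a"
  assumes "linear f" "linear g" and sym: "\<And>x y. f x \<bullet> y = x \<bullet> f y" and skew: "\<And>x y. g x \<bullet> y = - (x \<bullet> g y)"
  shows "(\<Sum>b\<in>Basis. f b \<bullet> g b) = 0"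
proof -
  have "(\<Sum>b\<in>Basis. f b \<bullet> g b) = linear_trace (\<lambda>x. f (g x))"
    unfolding linear_trace_def by (intro sum.cong refl) (simp add: sym inner_commute)
  moreover have "(\<Sum>b\<in>Basis. f b \<bullet> g b) = - linear_trace (\<lambda>x. g (f x))"
    unfolding linear_trace_def sum_negf[symmetric] by (intro sum.cong refl) (simp add: skew)
  ultimately show ?thesis using linear_trace_compose[OF assms(1,2)] by simp
qed

lemma linear_zero_of_sum:
  fixes f :: "'a::euclidean_space \<Rightarrow> 'a"
  assumes "linear f" "(\<Sum>b\<in>Basis. f b \<bullet> f b) = 0"
  shows "f x = 0"
proof -
  have "f b = 0" if "b \<in> Basis" for b
    using assms(2) that by (simp add: sum_nonneg_eq_0_iff)
  then show ?thesis using linear_eq_stdbasis[OF assms(1) module_hom_zero] by (metis)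
qed

context complex_ideal begin

text \<open>At a unit eigenvector \<open>v\<close> of \<open>X\<close> with eigenvalue
  \<open>\<sigma> > 0\<close>, \<open>a\<close> and \<open>b\<close> act by numbers
  \<open>A0\<close>, \<open>B0\<close> that cannot both vanish. \<open>mixed_rest\<close> expresses
  them through \<open>k v \<bullet> J v\<close>, \<open>l v \<bullet> J v\<close>,
  \<open>lam\<close> and \<open>mu\<close>, and \<open>jacobi_anti\<close> determines those two
  products so that \<open>A0 = B0 = 0\<close>.\<close>

lemma X_zero:
  assumes c: "c < 0" and w: "w \<in> I"
  shows "X w = 0"
proof (rule ccontr)
  assume Xw: "X w \<noteq> 0"
  then have w0: "w \<noteq> 0" by auto
  obtain v \<sigma> where v: "v \<in> I" "v \<bullet> v = 1" "X v = \<sigma> *\<^sub>R v" and max: "\<And>x. x \<in> I \<Longrightarrow> X x \<bullet> x \<le> \<sigma> * (x \<bullet> x)"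
    using symmetric_max_eigenvector[OF sub lin_parts(5) parts_I(3) sym_parts(3) w w0] by blast
  \<comment> \<open>\<open>X\<close> anticommutes with \<open>J\<close>, so its quadratic form takes
    both signs unless it is zero.\<close>
  have "\<sigma> > 0"
  proof (rule ccontr)
    assume "\<not> \<sigma> > 0"
    then have le: "X x \<bullet> x \<le> 0" if "x \<in> I" for x
      using max[OF that] by (smt (verit) inner_ge_zero mult_nonneg_nonneg mult_minus_left)
    have eq: "X x \<bullet> x = 0" if "x \<in> I" for x
      using le[OF that] le[OF J_I[OF that]] by simp
    have "X w \<in> I" by simp
    have "X w \<bullet> X w = 0" using eq[OF subspace_add[OF sub w parts_I(3)[of w]]] eq[OF w] eq[OF parts_I(3)[of w]] sym_parts(3)[of "X w" w]
      by (simp add: inner_add_left inner_add_right)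
    with Xw show False by simp
  qed
  define A0 where "A0 = a v \<bullet> v" define B0 where "B0 = b v \<bullet> v"
  have ab: "a v = A0 *\<^sub>R v" "b v = B0 *\<^sub>R v" and nz: "\<tau> * (A0\<^sup>2 + B0\<^sup>2) = - c + 2 * \<sigma>\<^sup>2"
    using quartic.eigenvector_scalar[OF c v] \<open>\<sigma> > 0\<close> by (simp_all add: A0_def B0_def)
  \<comment> \<open>At \<open>v\<close> the coefficient of \<open>lam\<close> in
    \<open>mixed_rest\<close> is zero; at \<open>v + J v\<close> that of \<open>mu\<close>
    is.\<close>
  define x where "x = v + J v"
  have xI: "x \<in> I" unfolding x_def using v(1) by (intro I_closed)
  have r1: "A0 + v \<bullet> J (l v) = mu / 2"
  proof -
    have "4 * \<sigma> * (A0 + v \<bullet> J (l v)) = 2 * mu * \<sigma>"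
      using mixed_rest[OF v(1)] unfolding v(3) ab by (simp add: inner_add_right v(2) algebra_simps)
    then have "2 * \<sigma> * (2 * (A0 + v \<bullet> J (l v)) - mu) = 0" by (simp add: algebra_simps)
    then show ?thesis using \<open>\<sigma> > 0\<close> by simp
  qed
  have r2: "B0 + k v \<bullet> J v = - lam / 2"
  proof -
    have Xx: "X x = \<sigma> *\<^sub>R v - \<sigma> *\<^sub>R J v" unfolding x_def by (simp add: v(3))
    have ax: "a x + J (b x) + k x + J (l x) = (A0 - B0) *\<^sub>R v + (A0 + B0) *\<^sub>R J v + (k v + J (k v)) + (J (l v) - l v)"
      unfolding x_def by (simp add: ab algebra_simps)
    have ax': "a x + J (b x) = A0 *\<^sub>R x + B0 *\<^sub>R J x"
      unfolding x_def by (simp add: ab algebra_simps)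
    have "X x \<bullet> (a x + J (b x) + k x + J (l x)) = \<sigma> * (- 2 * B0 - 2 * (k v \<bullet> J v))"
      unfolding Xx ax using J_skew[of v "k v"] J_skew[of v "l v"]
      by (simp add: inner_add_right inner_diff_right inner_diff_left v(2) inner_commute[of v "J _"]
         inner_commute[of "k v" "J v"] inner_commute[of "l v" "J v"] J_skew[of "k v" v] J_skew[of "l v" v] algebra_simps)
    moreover have "Y x \<bullet> (a x + J (b x)) = 0" unfolding ax' by (simp add: inner_add_right)
    moreover have "J (X x) \<bullet> x = 2 * \<sigma>" "X x \<bullet> x = 0"
      unfolding Xx x_def by (simp_all add: inner_add_right inner_diff_left inner_add_left v)
    ultimately have "4 * \<sigma> * (- 2 * B0 - 2 * (k v \<bullet> J v)) = 4 * lam * \<sigma>"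
      using mixed_rest[OF xI] by simp
    then have "4 * \<sigma> * (2 * (B0 + k v \<bullet> J v) + lam) = 0" by (simp add: algebra_simps)
    then show ?thesis using \<open>\<sigma> > 0\<close> by simp
  qed
  note j = jacobi_anti[OF v(1)]
  have fl: "a u \<bullet> z = u \<bullet> a z" "b u \<bullet> z = u \<bullet> b z" "X u \<bullet> z = u \<bullet> X z"
    "k u \<bullet> z = - (u \<bullet> k z)" "l u \<bullet> z = - (u \<bullet> l z)" "Y u \<bullet> z = - (u \<bullet> Y z)" for u z
    using sym_parts skew_parts by blast+
  have j1: "- 2 * \<sigma> * (k v \<bullet> J v) = lam * \<sigma>"
  proof -
    have t: "J (a (X v)) \<bullet> v = 0" "J (a (Y v)) \<bullet> v = 0" "J (k (X v)) \<bullet> v = - \<sigma> * (k v \<bullet> J v)"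
      "J (k (Y v)) \<bullet> v = Y v \<bullet> J (k v)" "X (b v) \<bullet> v = \<sigma> * B0" "X (l v) \<bullet> v = 0" "Y (b v) \<bullet> v = 0"
      "Y (l v) \<bullet> v = - (l v \<bullet> Y v)" "b (X v) \<bullet> v = \<sigma> * B0" "b (Y v) \<bullet> v = 0" "l (X v) \<bullet> v = 0"
      "l (Y v) \<bullet> v = - (Y v \<bullet> l v)" "J (X (a v)) \<bullet> v = 0" "J (X (k v)) \<bullet> v = \<sigma> * (k v \<bullet> J v)"
      "J (Y (a v)) \<bullet> v = 0" "J (Y (k v)) \<bullet> v = J (k v) \<bullet> Y v" "J (X v) \<bullet> v = 0" "X v \<bullet> v = \<sigma>"
    proof -
      show "J (a (Y v)) \<bullet> v = 0" using J_skew[of "a (Y v)" v] fl(1)[of "Y v" "J v"] by (simp add: ab)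
      show "J (k (Y v)) \<bullet> v = Y v \<bullet> J (k v)" using J_skew[of "k (Y v)" v] fl(4)[of "Y v" "J v"] by simp
      show "Y (l v) \<bullet> v = - (l v \<bullet> Y v)" "l (Y v) \<bullet> v = - (Y v \<bullet> l v)" by (rule fl)+
      show "X (l v) \<bullet> v = 0" using fl(3)[of "l v" v] by (simp add: v(3))
      show "b (Y v) \<bullet> v = 0" using fl(2)[of "Y v" v] by (simp add: ab)
      show "J (X (k v)) \<bullet> v = \<sigma> * (k v \<bullet> J v)"
        using J_skew[of "X (k v)" v] fl(3)[of "k v" "J v"] by (simp add: v(3))
      show "J (Y (k v)) \<bullet> v = J (k v) \<bullet> Y v"
        using J_skew[of "Y (k v)" v] fl(6)[of "k v" "J v"] J_skew[of "k v" "Y v"] by simp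
    qed (simp_all add: v ab J_skew[of "k v" v])
    have "J (k v) \<bullet> Y v = Y v \<bullet> J (k v)" "Y v \<bullet> l v = l v \<bullet> Y v" by (rule inner_commute)+
    with arg_cong[OF j, of "\<lambda>x. x \<bullet> v"] show ?thesis
      unfolding inner_add_left inner_diff_left inner_scaleR_left t by simp
  qed
  have j2: "- 2 * \<sigma> * (l v \<bullet> J v) = mu * \<sigma>"
  proof -
    have t: "J (a (X v)) \<bullet> J v = \<sigma> * A0" "J (a (Y v)) \<bullet> J v = 0" "J (k (X v)) \<bullet> J v = 0"
      "J (k (Y v)) \<bullet> J v = - (Y v \<bullet> k v)" "X (b v) \<bullet> J v = 0" "X (l v) \<bullet> J v = - \<sigma> * (l v \<bullet> J v)" "Y (b v) \<bullet> J v = 0"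
      "Y (l v) \<bullet> J v = l v \<bullet> J (Y v)" "b (X v) \<bullet> J v = 0" "b (Y v) \<bullet> J v = 0" "l (X v) \<bullet> J v = \<sigma> * (l v \<bullet> J v)"
      "l (Y v) \<bullet> J v = J (Y v) \<bullet> l v" "J (X (a v)) \<bullet> J v = A0 * \<sigma>" "J (X (k v)) \<bullet> J v = 0"
      "J (Y (a v)) \<bullet> J v = 0" "J (Y (k v)) \<bullet> J v = - (k v \<bullet> Y v)" "J (X v) \<bullet> J v = \<sigma>" "X v \<bullet> J v = 0" "Y v \<bullet> J v = 0" "J (Y v) \<bullet> J v = 0"
    proof -
      show "J (a (Y v)) \<bullet> J v = 0" using fl(1)[of "Y v" v] by (simp add: ab)
      show "J (k (Y v)) \<bullet> J v = - (Y v \<bullet> k v)" using fl(4)[of "Y v" v] by simp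
      show "X (l v) \<bullet> J v = - \<sigma> * (l v \<bullet> J v)" using fl(3)[of "l v" "J v"] by (simp add: v(3))
      show "Y (l v) \<bullet> J v = l v \<bullet> J (Y v)" using fl(6)[of "l v" "J v"] by simp
      show "b (Y v) \<bullet> J v = 0" using fl(2)[of "Y v" "J v"] by (simp add: ab)
      show "l (Y v) \<bullet> J v = J (Y v) \<bullet> l v" using fl(5)[of "Y v" "J v"] J_skew[of "Y v" "l v"] by simp
      show "J (X (k v)) \<bullet> J v = 0" using fl(3)[of "k v" v] by (simp add: v(3))
      show "J (Y (k v)) \<bullet> J v = - (k v \<bullet> Y v)" using fl(6)[of "k v" v] by simp
    qed (simp_all add: v ab)
    have "Y v \<bullet> k v = k v \<bullet> Y v" "J (Y v) \<bullet> l v = l v \<bullet> J (Y v)" by (rule inner_commute)+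
    with arg_cong[OF j, of "\<lambda>x. x \<bullet> J v"] show ?thesis
      unfolding inner_add_left inner_diff_left inner_scaleR_left t by simp
  qed
  have "\<sigma> * (2 * (k v \<bullet> J v) + lam) = 0" "\<sigma> * (2 * (l v \<bullet> J v) + mu) = 0"
    using j1 j2 by (simp_all add: algebra_simps)
  then have "k v \<bullet> J v = - lam / 2" "l v \<bullet> J v = - mu / 2" using \<open>\<sigma> > 0\<close> by simp_all
  moreover have "v \<bullet> J (l v) = - (l v \<bullet> J v)" using J_skew[of v "l v"] by (simp add: inner_commute)
  ultimately have "A0 = 0" "B0 = 0" using r1 r2 by simp_all
  with nz show False using c zero_le_power2[of \<sigma>] by simp
qed

lemma ab_scalar:
  assumes c: "c < 0" and ne: "I \<noteq> {0}"
  obtains \<alpha> \<beta> where "\<And>x. a x = \<alpha> *\<^sub>R P x" "\<And>x. b x = \<beta> *\<^sub>R P x" "\<tau> * (\<alpha>\<^sup>2 + \<beta>\<^sup>2) = - c"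
proof -
  have X0: "X x = 0" for x using X_zero[OF c P_I[of x]] by simp
  obtain w where w: "w \<in> I" "w \<noteq> 0" using ne subspace_0[OF sub] by auto
  obtain \<alpha> \<beta> where ab: "\<And>v. v \<in> I \<Longrightarrow> a v = \<alpha> *\<^sub>R v" "\<And>v. v \<in> I \<Longrightarrow> b v = \<beta> *\<^sub>R v" "\<tau> * (\<alpha>\<^sup>2 + \<beta>\<^sup>2) = - c"
    using quartic.scalar_forms[OF c X0 w] by blast
  have "a x = \<alpha> *\<^sub>R P x" "b x = \<beta> *\<^sub>R P x" for x
    using ab(1,2)[OF P_I[of x]] by simp_all
  then show thesis using ab(3) by (rule that)
qed

text \<open>Bessel's inequality for the orthogonal pair \<open>v\<close>, \<open>J v\<close> of
  equal length.\<close>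

lemma inner_bessel_J: "(h \<bullet> v)\<^sup>2 + (h \<bullet> J v)\<^sup>2 \<le> (h \<bullet> h) * (v \<bullet> v)"
proof (cases "v = 0")
  case False
  define n where "n = v \<bullet> v"
  have n: "n > 0" using False by (simp add: n_def)
  define u where "u = n *\<^sub>R h - (h \<bullet> v) *\<^sub>R v - (h \<bullet> J v) *\<^sub>R J v"
  have "u \<bullet> u = n * (n * (h \<bullet> h) - ((h \<bullet> v)\<^sup>2 + (h \<bullet> J v)\<^sup>2))"
    unfolding u_def by (simp add: inner_diff_left inner_diff_right n_def[symmetric] inner_commute[of v h]
        inner_commute[of "J v" h] power2_eq_square algebra_simps)
  then have "0 \<le> n * (n * (h \<bullet> h) - ((h \<bullet> v)\<^sup>2 + (h \<bullet> J v)\<^sup>2))" by (metis inner_ge_zero)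
  then have "0 \<le> n * (h \<bullet> h) - ((h \<bullet> v)\<^sup>2 + (h \<bullet> J v)\<^sup>2)" using n by (simp add: zero_le_mult_iff)
  then show ?thesis by (simp add: n_def mult.commute)
qed simp

lemma trace_P: "linear_trace P = (\<Sum>b\<in>Basis. P b \<bullet> P b)"
  unfolding linear_trace_def by (intro sum.cong refl) (simp add: P_sym[of _ "P _"] inner_commute)

text \<open>For \<open>c < 0\<close> the symmetric parts are the scalars \<open>\<alpha>\<close>,
  \<open>\<beta>\<close> on \<open>I\<close> and \<open>X = 0\<close>. The map \<open>Y\<close> is
  injective on \<open>I\<close>, so the anticommuting Jacobi identity can be conjugated by it. The
  resulting traces of \<open>J k\<close> and \<open>J l\<close> make the trace of \<open>Y\<close>
  squared nonnegative; as \<open>Y\<close> is skew, it would be zero.\<close>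

lemma c_nonneg: "c \<ge> 0"
proof (rule ccontr)
  assume "\<not> c \<ge> 0"
  then have c: "c < 0" by simp
  have ne: "I \<noteq> {0}"
  proof
    assume I0: "I = {0}"
    have "a x = 0" "b x = 0" for x using parts_I(1)[of x] parts_I(5)[of x] unfolding I0 by auto
    then have "mu = 0" "lam = 0" using trace_AB by (simp_all add: linear_trace_def)
    moreover have "h = 0" using h_I unfolding I0 by auto
    ultimately show False using c_eq c by simp
  qed
  then obtain w where w: "w \<in> I" "w \<noteq> 0" using subspace_0[OF sub] by auto
  obtain \<alpha> \<beta> where a: "\<And>x. a x = \<alpha> *\<^sub>R P x" and b: "\<And>x. b x = \<beta> *\<^sub>R P x" and ab: "\<tau> * (\<alpha>\<^sup>2 + \<beta>\<^sup>2) = - c"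
    using ab_scalar[OF c ne] by blast
  have X: "X x = 0" for x using X_zero[OF c P_I[of x]] by simp
  define N where "N = linear_trace P"
  have N: "N > 0"
  proof -
    have "N \<ge> 0" unfolding N_def trace_P by (simp add: sum_nonneg)
    moreover have "N \<noteq> 0" using linear_zero_of_sum[OF linear_P, of w] w unfolding N_def trace_P by auto
    ultimately show ?thesis by simp
  qed
  have lm: "mu = - N * \<alpha>" "lam = N * \<beta>"
    using trace_AB a b unfolding N_def by (simp_all add: linear_trace_def sum_distrib_left mult.commute)
  have fl: "k u \<bullet> z = - (u \<bullet> k z)" "l u \<bullet> z = - (u \<bullet> l z)" "Y u \<bullet> z = - (u \<bullet> Y z)" for u z
    using skew_parts by blast+
  have jc: "k (l x) - l (k x) - 2 *\<^sub>R J (Y (Y x)) = lam *\<^sub>R (\<alpha> *\<^sub>R P x + k x) + mu *\<^sub>R (\<beta> *\<^sub>R P x + l x)" for x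
    using jacobi_com[OF P_I[of x]] by (simp add: a b X Ps mult.commute)
  have ja: "J (k (Y x)) + Y (l x) - l (Y x) - J (Y (k x)) = lam *\<^sub>R Y x + mu *\<^sub>R J (Y x)" for x
    using jacobi_anti[OF P_I[of x]] by (simp add: a b X linear_0[OF linear_P])
  \<comment> \<open>At a null vector of \<open>Y\<close> the mixed identity equates a sum of
    nonnegative terms to zero although \<open>N * (\<alpha>\<^sup>2 + \<beta>\<^sup>2) * n\<close>
    is positive. Bessel's inequality handles the coefficient \<open>2 - \<tau>\<close>, which may be
    negative.\<close>
  have inj: "v = 0" if v: "v \<in> I" "Y v = 0" for v
  proof (rule ccontr)
    assume v0: "v \<noteq> 0"
    define n where "n = v \<bullet> v"
    have n: "n > 0" using v0 by (simp add: n_def)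
    define H where "H = (h \<bullet> v)\<^sup>2 + (h \<bullet> J v)\<^sup>2"
    have "(k (l v) - l (k v)) \<bullet> J v = lam * (k v \<bullet> J v) + mu * (l v \<bullet> J v)"
      using arg_cong[OF jc[of v], of "\<lambda>x. x \<bullet> J v"] v by (simp add: inner_add_left)
    moreover have "(k (l v) - l (k v)) \<bullet> J v = 2 * (k v \<bullet> J (l v))"
      using fl(1)[of "l v" "J v"] fl(2)[of "k v" "J v"] J_skew[of "l v" "k v"]
      by (simp add: inner_diff_left inner_commute[of "k v" "J (l v)"])
    ultimately have e1: "2 * (k v \<bullet> J (l v)) = lam * (k v \<bullet> J v) + mu * (l v \<bullet> J v)" by simp
    have e2: "J (l v) \<bullet> v = - (l v \<bullet> J v)" by (rule J_skew)
    have e3: "(a v + J (b v)) \<bullet> (a v + J (b v)) = (\<alpha>\<^sup>2 + \<beta>\<^sup>2) * n" "k v \<bullet> a v = 0" "l v \<bullet> b v = 0" "a v \<bullet> J (b v) = 0"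
       "b v \<bullet> v = \<beta> * n" "a v \<bullet> v = \<alpha> * n"
      using v by (simp_all add: a b inner_add_left inner_add_right n_def power2_eq_square algebra_simps)
    have m: "- (\<tau> * (\<alpha>\<^sup>2 + \<beta>\<^sup>2)) * n + (2 - \<tau>) / 4 * H + lam * \<beta> * n - mu * \<alpha> * n = 2 * c * n"
      using mixed_avg[OF v(1)] unfolding e2 e3 X v(2) n_def[symmetric] H_def[symmetric] using e1
      by (simp add: algebra_simps)
    have H: "0 \<le> H" "H \<le> (h \<bullet> h) * n" using inner_bessel_J[of v] by (simp_all add: H_def n_def)
    have "N * (\<alpha>\<^sup>2 + \<beta>\<^sup>2) * n + (lam\<^sup>2 + mu\<^sup>2) * n + ((\<tau> + 2) / 4 * ((h \<bullet> h) * n) + (2 - \<tau>) / 4 * H) = 0"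
    proof -
      have "lam * \<beta> * n - mu * \<alpha> * n = N * (\<alpha>\<^sup>2 + \<beta>\<^sup>2) * n" unfolding lm by (simp add: power2_eq_square algebra_simps)
      moreover have "c * n = - (lam\<^sup>2 + mu\<^sup>2) * n - (\<tau> + 2) / 4 * ((h \<bullet> h) * n)" by (subst c_eq) (simp add: algebra_simps)
      ultimately show ?thesis using m unfolding ab by (simp add: algebra_simps)
    qed
    moreover have "(\<tau> + 2) / 4 * H \<le> (\<tau> + 2) / 4 * ((h \<bullet> h) * n)" using H tau_nonneg by (intro mult_left_mono) auto
    moreover have "(\<tau> + 2) / 4 * H + (2 - \<tau>) / 4 * H = H" by (simp add: field_simps)
    moreover have "N * (\<alpha>\<^sup>2 + \<beta>\<^sup>2) * n > 0"
    proof -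
      have "\<alpha>\<^sup>2 + \<beta>\<^sup>2 \<noteq> 0" using ab c by auto
      then have "\<alpha>\<^sup>2 + \<beta>\<^sup>2 > 0" using sum_power2_ge_zero[of \<alpha> \<beta>] by linarith
      then show ?thesis using N n by simp
    qed
    moreover have "(lam\<^sup>2 + mu\<^sup>2) * n \<ge> 0" using n by simp
    ultimately show False using H(1) by linarith
  qed
  \<comment> \<open>\<open>Y\<close> on \<open>I\<close> and the identity on the complement: an
    invertible map with \<open>P (Z x) = Y x\<close>.\<close>
  define Z where "Z = (\<lambda>x. Y x + (x - P x))"
  have lZ: "linear Z" unfolding Z_def by (auto intro!: linearI simp: Ps algebra_simps)
  have PZ: "P (Z x) = Y x" for x unfolding Z_def by (simp add: Ps)
  have "inj Z"
  proof (rule linear_injective_0[OF lZ, THEN iffD2], intro allI impI)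
    fix x assume "Z x = 0"
    then have "Y x = 0" using PZ[of x] by (simp add: linear_0[OF linear_P])
    with \<open>Z x = 0\<close> have "x = P x" unfolding Z_def by simp
    then have "x \<in> I" using P_I[of x] by simp
    then show "x = 0" using inj \<open>Y x = 0\<close> by blast
  qed
  then obtain W where lW: "linear W" and WZ: "\<And>x. W (Z x) = x" and ZW: "\<And>x. Z (W x) = x"
    using linear_injective_isomorphism[OF lZ] by blast
  have kZ: "k (Z x) = k (Y x)" "l (Z x) = l (Y x)" "Z (k x) = Y (k x)" "Z (l x) = Y (l x)" for x
    unfolding Z_def by simp_all
  have ZJ: "J (Z (k x)) = - Z (J (k x))" "J (Z (l x)) = - Z (J (l x))" for x
    unfolding Z_def by (simp_all add: J_I)
  have conj: "J (k y) + Z (l (W y)) - l y + Z (J (k (W y))) = lam *\<^sub>R P y + mu *\<^sub>R J (P y)" for y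
    using ja[of "W y"] ZJ(1)[of "W y"]
    by (simp add: kZ(1,2)[of "W y", symmetric, unfolded ZW] kZ(3,4)[of "W y", symmetric] PZ[of "W y", symmetric, unfolded ZW])
  have lin: "linear k" "linear l" "linear (\<lambda>x. J (k x))" "linear (\<lambda>x. J (l x))" "linear (\<lambda>x. W (Z x))"
    using lin_parts linear_compose[OF lin_parts(3) linJ] linear_compose[OF lin_parts(4) linJ] linear_compose[OF lZ lW]
    by (simp_all add: o_def)
  have tr_conj: "linear_trace (\<lambda>y. Z (f (W y))) = linear_trace f" if "linear f" for f
    using linear_trace_compose[OF lZ linear_compose[OF lW that]] by (simp add: o_def WZ)
  have tr_JP: "linear_trace (\<lambda>x. J (P x)) = 0"
  proof -
    have "(\<Sum>b\<in>Basis. P b \<bullet> J b) = 0"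
      by (rule sum_inner_sym_skew[OF linear_P linJ P_sym J_skew])
    then show ?thesis unfolding linear_trace_def by (simp add: J_skew sum_negf)
  qed
  have t1: "2 * linear_trace (\<lambda>x. J (k x)) = lam * N"
  proof -
    have "linear_trace (\<lambda>y. J (k y) + Z (l (W y)) - l y + Z (J (k (W y)))) = lam * N"
      unfolding conj linear_trace_add linear_trace_scale tr_JP N_def by simp
    then show ?thesis unfolding linear_trace_add linear_trace_diff tr_conj[OF lin(2)] tr_conj[OF lin(3)] by simp
  qed
  have t2: "2 * linear_trace (\<lambda>x. J (l x)) = mu * N"
  proof -
    have "- k y - Z (J (l (W y))) - J (l y) + Z (k (W y)) = lam *\<^sub>R J (P y) - mu *\<^sub>R P y" for y
    proof -
      have "J (Z (J (k (W y)))) = Z (k (W y))" using ZJ(1)[of "J (W y)"] ZJ(1)[of "W y"]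
        by (simp add: linear_neg[OF lZ] eq_neg_iff_add_eq_0)
      then show ?thesis using arg_cong[OF conj[of y], of J] ZJ(2)[of "W y"] by simp
    qed
    then have "linear_trace (\<lambda>y. - k y - Z (J (l (W y))) - J (l y) + Z (k (W y))) = - mu * N"
      by (simp only: linear_trace_diff linear_trace_scale tr_JP N_def)
    then show ?thesis unfolding linear_trace_add linear_trace_diff linear_trace_minus tr_conj[OF lin(1)] tr_conj[OF lin(4)] by simp
  qed
  \<comment> \<open>The commuting Jacobi identity is multiplied by \<open>J\<close> before the trace
    is taken; the commutator of \<open>J k\<close> and \<open>l\<close> drops out.\<close>
  have t3: "2 * linear_trace (\<lambda>x. Y (Y x)) = lam * linear_trace (\<lambda>x. J (k x)) + mu * linear_trace (\<lambda>x. J (l x))"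
  proof -
    have "J (k (l x)) - l (J (k x)) + 2 *\<^sub>R Y (Y x) = lam *\<^sub>R (\<alpha> *\<^sub>R J (P x) + J (k x)) + mu *\<^sub>R (\<beta> *\<^sub>R J (P x) + J (l x))" for x
      using arg_cong[OF jc[of x], of J] by simp
    then have "linear_trace (\<lambda>x. J (k (l x)) - l (J (k x)) + 2 *\<^sub>R Y (Y x))
       = lam * linear_trace (\<lambda>x. J (k x)) + mu * linear_trace (\<lambda>x. J (l x))"
      by (simp only: linear_trace_add linear_trace_scale tr_JP) simp
    then show ?thesis
      unfolding linear_trace_add linear_trace_diff linear_trace_scale using linear_trace_compose[OF lin(3) lin(2)] by simp
  qed
  have "4 * linear_trace (\<lambda>x. Y (Y x)) = (lam\<^sup>2 + mu\<^sup>2) * N"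
  proof -
    have "4 * linear_trace (\<lambda>x. Y (Y x)) = lam * (2 * linear_trace (\<lambda>x. J (k x))) + mu * (2 * linear_trace (\<lambda>x. J (l x)))"
      using t3 by simp
    then show ?thesis unfolding t1 t2 by (simp add: power2_eq_square algebra_simps)
  qed
  moreover have "(lam\<^sup>2 + mu\<^sup>2) * N \<ge> 0" using N by simp
  ultimately have "linear_trace (\<lambda>x. Y (Y x)) \<ge> 0" by linarith
  moreover have "linear_trace (\<lambda>x. Y (Y x)) = - (\<Sum>b\<in>Basis. Y b \<bullet> Y b)"
    unfolding linear_trace_def by (simp add: fl(3)[of "Y _"] sum_negf)
  ultimately have "(\<Sum>b\<in>Basis. Y b \<bullet> Y b) = 0" by (simp add: antisym sum_nonneg)
  from linear_zero_of_sum[OF lin_parts(6) this] inj[OF w(1)] w(2) show False by simp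
qed

section \<open>Complex ideals with c = 0\<close>

lemma c_zero: "c = 0" and lam_zero: "lam = 0" and mu_zero: "mu = 0" and h_zero: "h = 0"
proof -
  have "lam\<^sup>2 + mu\<^sup>2 \<ge> 0" "(\<tau> + 2) / 4 * (h \<bullet> h) \<ge> 0" using tau_nonneg by simp_all
  then have "lam\<^sup>2 + mu\<^sup>2 = 0" "(\<tau> + 2) / 4 * (h \<bullet> h) = 0" "c = 0" using c_nonneg c_eq by linarith+
  then show "c = 0" "lam = 0" "mu = 0" "h = 0" using tau_nonneg by (auto simp: sum_power2_eq_zero_iff)
qed

lemma flip: "a u \<bullet> z = u \<bullet> a z" "b u \<bullet> z = u \<bullet> b z" "X u \<bullet> z = u \<bullet> X z"
    "k u \<bullet> z = - (u \<bullet> k z)" "l u \<bullet> z = - (u \<bullet> l z)" "Y u \<bullet> z = - (u \<bullet> Y z)"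
  using sym_parts skew_parts by blast+

lemma mixed_zero: "v \<in> I \<Longrightarrow> \<tau> * ((a v + J (b v)) \<bullet> (a v + J (b v))) + 2 * (k v \<bullet> J (l v) + k v \<bullet> a v + l v \<bullet> b v + a v \<bullet> J (b v))
    + 6 * (X v \<bullet> X v) + 4 * (X v \<bullet> Y v) + (4 * \<tau> - 2) * (Y v \<bullet> Y v) = 0"
  using mixed_avg[of v] by (simp add: c_zero lam_zero mu_zero h_zero)

text \<open>Summed over a basis, \<open>mixed_zero\<close> loses all products of a symmetric and a
  skew map. The coefficient \<open>4 * \<tau> - 2\<close> of \<open>|Y|^2\<close> may be negative,
  but the trace of the Jacobi identity gives \<open>|X|^2 = |Y|^2\<close>, after which
  \<open>|X|^2\<close> has the coefficient \<open>4 + 4 * \<tau>\<close> in a sum of nonnegative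
  terms.\<close>

lemma XY_zero: "X x = 0" "Y x = 0"
proof -
  let ?sum = "\<lambda>f. (\<Sum>b\<in>Basis. f b :: real)"
  note lJ = linear_compose[OF _ linJ, unfolded o_def]
  have s1: "?sum (\<lambda>x. a x \<bullet> k x) = 0" "?sum (\<lambda>x. b x \<bullet> l x) = 0" "?sum (\<lambda>x. X x \<bullet> Y x) = 0"
    by (rule sum_inner_sym_skew; (rule lin_parts flip))+
  \<comment> \<open>\<open>J b\<close> is skew since \<open>b\<close> is symmetric and commutes with
    \<open>J\<close>; for the same reason \<open>J l\<close> is symmetric.\<close>
  have s2: "?sum (\<lambda>x. a x \<bullet> J (b x)) = 0"
    by (rule sum_inner_sym_skew[OF lin_parts(1) lJ[OF lin_parts(2)] flip(1)]) (simp add: J_skew flip)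
  have s3: "?sum (\<lambda>x. J (l x) \<bullet> k x) = 0"
    by (rule sum_inner_sym_skew[OF lJ[OF lin_parts(4)] lin_parts(3) _ flip(4)]) (simp add: J_skew flip)
  have XX: "?sum (\<lambda>x. X x \<bullet> X x) = ?sum (\<lambda>x. Y x \<bullet> Y x)"
  proof -
    have e: "J (a (b x)) + J (a (l x)) + J (k (b x)) + J (k (l x)) - b (J (a x)) - b (J (k x)) - l (J (a x)) - l (J (k x))
       + 2 *\<^sub>R (X (X x) + X (Y x) + Y (X x) + Y (Y x)) = 0" for x
      using arg_cong[OF jacobi_com[OF P_I[of x]], of J] by (simp add: lam_zero mu_zero scaleR_add_right)
    have L: "linear (\<lambda>x. J (a x))" "linear (\<lambda>x. J (k x))" using lJ lin_parts by blast+
    have "linear_trace (\<lambda>x. J (a (b x)) + J (a (l x)) + J (k (b x)) + J (k (l x)) - b (J (a x)) - b (J (k x)) - l (J (a x)) - l (J (k x))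
       + 2 *\<^sub>R (X (X x) + X (Y x) + Y (X x) + Y (Y x))) = 0"
      unfolding e by (simp add: linear_trace_def)
    then have "linear_trace (\<lambda>x. X (X x)) + linear_trace (\<lambda>x. X (Y x)) + linear_trace (\<lambda>x. Y (X x)) + linear_trace (\<lambda>x. Y (Y x)) = 0"
      unfolding linear_trace_add linear_trace_diff linear_trace_scale
      using linear_trace_compose[OF L(1) lin_parts(2)] linear_trace_compose[OF L(1) lin_parts(4)]
        linear_trace_compose[OF L(2) lin_parts(2)] linear_trace_compose[OF L(2) lin_parts(4)] by simp
    moreover have "linear_trace (\<lambda>x. X (X x)) = ?sum (\<lambda>x. X x \<bullet> X x)"
      "linear_trace (\<lambda>x. X (Y x)) = ?sum (\<lambda>x. Y x \<bullet> X x)"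
      "linear_trace (\<lambda>x. Y (X x)) = - ?sum (\<lambda>x. X x \<bullet> Y x)"
      "linear_trace (\<lambda>x. Y (Y x)) = - ?sum (\<lambda>x. Y x \<bullet> Y x)"
      unfolding linear_trace_def by (simp_all add: flip(3)[of "X _"] flip(3)[of "Y _"] flip(6)[of "X _"] flip(6)[of "Y _"] sum_negf)
    ultimately show ?thesis using s1(3) by (simp add: inner_commute[of "Y _" "X _"])
  qed
  have eq: "\<tau> * (a x \<bullet> a x) + \<tau> * (b x \<bullet> b x) + (2 * \<tau> + 2) * (a x \<bullet> J (b x)) + 2 * (J (l x) \<bullet> k x) + 2 * (a x \<bullet> k x) + 2 * (b x \<bullet> l x)
      + 6 * (X x \<bullet> X x) + 4 * (X x \<bullet> Y x) + (4 * \<tau> - 2) * (Y x \<bullet> Y x) = 0" for x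
    using mixed_zero[OF P_I[of x]]
    by (simp add: inner_add_left inner_add_right inner_commute[of "J (b x)"] inner_commute[of "k x"] inner_commute[of "l x"] algebra_simps)
  have "?sum (\<lambda>x. \<tau> * (a x \<bullet> a x) + \<tau> * (b x \<bullet> b x) + (2 * \<tau> + 2) * (a x \<bullet> J (b x)) + 2 * (J (l x) \<bullet> k x) + 2 * (a x \<bullet> k x) + 2 * (b x \<bullet> l x)
      + 6 * (X x \<bullet> X x) + 4 * (X x \<bullet> Y x) + (4 * \<tau> - 2) * (Y x \<bullet> Y x)) = 0"
    unfolding eq by simp
  then have tot: "\<tau> * ?sum (\<lambda>x. a x \<bullet> a x) + \<tau> * ?sum (\<lambda>x. b x \<bullet> b x) + (4 + 4 * \<tau>) * ?sum (\<lambda>x. X x \<bullet> X x) = 0"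
    unfolding sum.distrib sum_distrib_left[symmetric] s1 s2 s3 XX[symmetric] by (simp add: algebra_simps)
  have nn: "?sum (\<lambda>x. a x \<bullet> a x) \<ge> 0" "?sum (\<lambda>x. b x \<bullet> b x) \<ge> 0" "?sum (\<lambda>x. X x \<bullet> X x) \<ge> 0" by (simp_all add: sum_nonneg)
  have "\<tau> * ?sum (\<lambda>x. a x \<bullet> a x) \<ge> 0" "\<tau> * ?sum (\<lambda>x. b x \<bullet> b x) \<ge> 0" "(4 + 4 * \<tau>) * ?sum (\<lambda>x. X x \<bullet> X x) \<ge> 0"
    using nn tau_nonneg by simp_all
  with tot have z: "(4 + 4 * \<tau>) * ?sum (\<lambda>x. X x \<bullet> X x) = 0" by linarith
  have X0: "?sum (\<lambda>x. X x \<bullet> X x) = 0" using z tau_nonneg by (auto simp: add_eq_0_iff)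
  show "X x = 0" by (rule linear_zero_of_sum[OF lin_parts(5) X0])
  show "Y x = 0" using linear_zero_of_sum[OF lin_parts(6)] X0 XX by simp
qed

lemma A_eq0: "A x = a x + k x" "B x = b x + l x"
  by (simp_all add: A_eq B_eq XY_zero)

lemma br_eq: "br x y = (x \<bullet> e) *\<^sub>R A y + (x \<bullet> J e) *\<^sub>R B y - (y \<bullet> e) *\<^sub>R A x - (y \<bullet> J e) *\<^sub>R B x"
proof -
  have e: "br e z = A z" "br (J e) z = B z" for z by (simp_all add: br_e br_Je h_zero lam_zero mu_zero)
  have "br (P x) y = - (y \<bullet> e) *\<^sub>R A x - (y \<bullet> J e) *\<^sub>R B x"
    unfolding br_I[OF P_I] by (simp only: A_eq0 parts_P)
  moreover have "br x y = br (P x) y + (x \<bullet> e) *\<^sub>R br e y + (x \<bullet> J e) *\<^sub>R br (J e) y"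
    by (subst split[of x]) (simp only: brs)
  ultimately show ?thesis unfolding e by simp
qed

lemma is_semidirect: "semidirect br J I P \<tau>"
proof
  have "br e (J e) = 0" by (simp add: br_e A_def h_zero lam_zero mu_zero)
  then show "br (x - P x) (y - P y) = 0" for x y
    using br_anti[of "J e" e] by (simp add: P_def)
  show "br x (J v) = J (br x v)" if v: "v \<in> I" for x v
  proof -
    have "br x u = (x \<bullet> e) *\<^sub>R A u + (x \<bullet> J e) *\<^sub>R B u" if "u \<in> I" for u
      by (subst br_eq) (use that in simp)
    then show ?thesis using v J_I[OF v] by (simp add: A_eq0)
  qed
  show "Q \<tau> x = 0" for x using Qc[of x] c_zero by simp
qed (use linear_P P_sym sub ideal abelian J_I in \<open>auto simp: Ps\<close>)

lemmas br_in_I = semidirect.quotient[OF is_semidirect]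
  and kaehler_flat = semidirect.kaehler_flat[OF is_semidirect]
  and chern_flat = semidirect.chern_flat[OF is_semidirect]

end

section \<open>Ideals that are not complex\<close>

context hermitian_lie begin

text \<open>\<open>I\<close> and its orthogonal complement are both invariant under
  \<open>J\<close>, and every product in \<open>Psi\<close> pairs a vector of one with a vector of
  the other.\<close>

lemma Psi_orth_subspace:
  assumes I: "subspace I" "\<And>u. u \<in> I \<Longrightarrow> J u \<in> I" and w: "w1 \<in> I" "w2 \<in> I" "w3 \<in> I" "w4 \<in> I" "w5 \<in> I"
    and p: "\<And>u. u \<in> I \<Longrightarrow> u \<bullet> p1 = 0" "\<And>u. u \<in> I \<Longrightarrow> u \<bullet> p2 = 0" "\<And>u. u \<in> I \<Longrightarrow> u \<bullet> p3 = 0" "\<And>u. u \<in> I \<Longrightarrow> u \<bullet> p4 = 0"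
  shows "Psi \<tau> w1 w2 w3 w4 w5 p1 p2 p3 p4 0 = 0"
proof -
  have Jp: "u \<bullet> J p1 = 0" "u \<bullet> J p2 = 0" if "u \<in> I" for u
    using p(1,2)[OF I(2)[OF that]] J_skew[of u p1] J_skew[of u p2] by simp_all
  have "w1 \<bullet> p2 = 0" "p1 \<bullet> w2 = 0" "(w3 + w4) \<bullet> (p3 + p4) = 0" "(p4 - p3) \<bullet> w5 = 0"
    "(w5 + J (w1 + w2)) \<bullet> (0 + J (p1 + p2)) = 0"
    using p w Jp I(2) by (simp_all add: inner_add_left inner_add_right inner_diff_left inner_commute[of p1] inner_commute[of p3] inner_commute[of p4])
  then show ?thesis unfolding Psi_def by simp
qed

end

text \<open>Here \<open>I\<close> is the largest complex subspace of the given ideal. The complement of \<open>I\<close> has the orthonormal basis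
  \<open>n\<close>, \<open>J n\<close>, \<open>k\<close>, \<open>J k\<close>, where \<open>k\<close> and \<open>J n + \<gamma> J k\<close> span the part of the ideal that is orthogonal to \<open>I\<close>.\<close>

locale totally_real = hermitian_lie br J for br :: "'a::euclidean_space \<Rightarrow> 'a \<Rightarrow> 'a" and J +
  fixes I :: "'a set" and n k :: 'a and \<gamma> \<tau> c :: real
  assumes sub: "subspace I" and ideal: "u \<in> I \<Longrightarrow> br x u \<in> I"
    and abelian: "u \<in> I \<Longrightarrow> v \<in> I \<Longrightarrow> br u v = 0"
    and J_I: "u \<in> I \<Longrightarrow> J u \<in> I" and nn [simp]: "n \<bullet> n = 1" and kk [simp]: "k \<bullet> k = 1"
    and nk: "n \<bullet> k = 0" and nJk: "n \<bullet> J k = 0"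
    and n_I: "u \<in> I \<Longrightarrow> u \<bullet> n = 0" and k_I: "u \<in> I \<Longrightarrow> u \<bullet> k = 0"
    and decomp: "x - (x \<bullet> n) *\<^sub>R n - (x \<bullet> J n) *\<^sub>R J n - (x \<bullet> k) *\<^sub>R k - (x \<bullet> J k) *\<^sub>R J k \<in> I"
    and fk: "br (J n + \<gamma> *\<^sub>R J k) k = 0"
    and fI: "u \<in> I \<Longrightarrow> br (J n + \<gamma> *\<^sub>R J k) u = 0" and kI: "u \<in> I \<Longrightarrow> br k u = 0"
    and in_F: "y \<in> {J n + \<gamma> *\<^sub>R J k, k} \<Longrightarrow> \<exists>\<alpha> \<beta>. br x y - \<alpha> *\<^sub>R (J n + \<gamma> *\<^sub>R J k) - \<beta> *\<^sub>R k \<in> I"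
    and unimod: "linear_trace (br x) = 0"
    and Qc: "Q \<tau> x = c * (x \<bullet> x)\<^sup>2" and tau_nonneg: "\<tau> \<ge> 0"
begin

definition f where "f = J n + \<gamma> *\<^sub>R J k"
definition P :: "'a \<Rightarrow> 'a" where
  "P x = x - (x \<bullet> n) *\<^sub>R n - (x \<bullet> J n) *\<^sub>R J n - (x \<bullet> k) *\<^sub>R k - (x \<bullet> J k) *\<^sub>R J k"
text \<open>Modulo \<open>I\<close>, \<open>[J x, y]\<close> is a left-symmetric product on the span of \<open>f\<close> and \<open>k\<close>, with the structure constants
  \<open>a\<close>, \<open>b\<close>, \<open>d\<close>, \<open>s\<close>; the vectors \<open>u\<close> are the components in \<open>I\<close>.\<close>

definition a1 where "a1 = br (J f) f \<bullet> J n"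
definition a2 where "a2 = br (J f) f \<bullet> k"
definition u11 where "u11 = P (br (J f) f)"
definition b1 where "b1 = br (J f) k \<bullet> J n"
definition b2 where "b2 = br (J f) k \<bullet> k"
definition u1k where "u1k = P (br (J f) k)"
definition d1 where "d1 = br (J k) f \<bullet> J n"
definition d2 where "d2 = br (J k) f \<bullet> k"
definition uk1 where "uk1 = P (br (J k) f)"
definition s1 where "s1 = br (J k) k \<bullet> J n"
definition s2 where "s2 = br (J k) k \<bullet> k"
definition ukk where "ukk = P (br (J k) k)"

lemma orth [simp]: "n \<bullet> k = 0" "k \<bullet> n = 0" "n \<bullet> J k = 0" "J k \<bullet> n = 0" "k \<bullet> J n = 0" "J n \<bullet> k = 0"
  using nk nJk J_skew[of n k] by (simp_all add: inner_commute)

lemma orth_I [simp]: "u \<in> I \<Longrightarrow> u \<bullet> n = 0" "u \<in> I \<Longrightarrow> n \<bullet> u = 0" "u \<in> I \<Longrightarrow> u \<bullet> J n = 0" "u \<in> I \<Longrightarrow> J n \<bullet> u = 0"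
   "u \<in> I \<Longrightarrow> u \<bullet> k = 0" "u \<in> I \<Longrightarrow> k \<bullet> u = 0" "u \<in> I \<Longrightarrow> u \<bullet> J k = 0" "u \<in> I \<Longrightarrow> J k \<bullet> u = 0"
  using n_I[of u] n_I[OF J_I, of u] J_skew[of u n] k_I[of u] k_I[OF J_I, of u] J_skew[of u k]
  by (simp_all add: inner_commute)

lemmas I_closed = subspace_add[OF sub] subspace_diff[OF sub] subspace_scale[OF sub] subspace_neg[OF sub] subspace_0[OF sub] J_I

lemma P_I [simp]: "P x \<in> I" unfolding P_def by (rule decomp)
lemma P_id [simp]: "v \<in> I \<Longrightarrow> P v = v" by (simp add: P_def)
lemma P_basis [simp]: "P n = 0" "P (J n) = 0" "P k = 0" "P (J k) = 0" by (simp_all add: P_def)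
lemma P_J: "P (J x) = J (P x)" by (simp add: P_def J_skew algebra_simps)
lemma linear_P: "linear P" unfolding P_def[abs_def] by (auto intro!: linearI simp: algebra_simps)
lemmas Ps [simp] = linear_add[OF linear_P] linear_scale[OF linear_P] linear_neg[OF linear_P] linear_diff[OF linear_P] linear_0[OF linear_P]
lemma split: "x = P x + (x \<bullet> n) *\<^sub>R n + (x \<bullet> J n) *\<^sub>R J n + (x \<bullet> k) *\<^sub>R k + (x \<bullet> J k) *\<^sub>R J k" by (simp add: P_def)
lemma P_sym: "P x \<bullet> y = x \<bullet> P y" by (simp add: P_def algebra_simps inner_commute[of _ y])
lemma inner_expand: "p \<bullet> q = P p \<bullet> P q + (p \<bullet> n) * (q \<bullet> n) + (p \<bullet> J n) * (q \<bullet> J n) + (p \<bullet> k) * (q \<bullet> k) + (p \<bullet> J k) * (q \<bullet> J k)"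
proof -
  have "P p \<bullet> P q = P p \<bullet> q" by (simp add: P_sym)
  also have "\<dots> = p \<bullet> q - (p \<bullet> n) * (q \<bullet> n) - (p \<bullet> J n) * (q \<bullet> J n) - (p \<bullet> k) * (q \<bullet> k) - (p \<bullet> J k) * (q \<bullet> J k)"
    unfolding P_def by (simp add: inner_diff_left inner_diff_right inner_commute[of _ q])
  finally show ?thesis by simp
qed
lemma eq_by_comps:
  assumes "P x = P y" "x \<bullet> n = y \<bullet> n" "x \<bullet> J n = y \<bullet> J n" "x \<bullet> k = y \<bullet> k" "x \<bullet> J k = y \<bullet> J k"
  shows "x = y"
  by (subst split[of x], subst split[of y]) (simp add: assms)
lemma u_I [simp]: "u11 \<in> I" "u1k \<in> I" "uk1 \<in> I" "ukk \<in> I" by (simp_all add: u11_def u1k_def uk1_def ukk_def)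

lemma n_eq: "n = - J f - \<gamma> *\<^sub>R k" and Jn_eq: "J n = f - \<gamma> *\<^sub>R J k" by (simp_all add: f_def)
lemma Jf: "J f = - n - \<gamma> *\<^sub>R k" by (simp add: f_def)
lemma f_comps [simp]: "f \<bullet> n = 0" "f \<bullet> J n = 1" "f \<bullet> k = 0" "f \<bullet> J k = \<gamma>" "P f = 0"
  by (simp_all add: f_def inner_add_left)
lemma Jf_comps [simp]: "J f \<bullet> n = - 1" "J f \<bullet> J n = 0" "J f \<bullet> k = - \<gamma>" "J f \<bullet> J k = 0" "P (J f) = 0"
  by (simp_all add: Jf inner_diff_left)

lemma br_fk [simp]: "br f k = 0" "br k f = 0" using fk br_anti[of k f] by (simp_all add: f_def)
lemma br_F_I [simp]: "u \<in> I \<Longrightarrow> br f u = 0" "u \<in> I \<Longrightarrow> br u f = 0" "u \<in> I \<Longrightarrow> br k u = 0" "u \<in> I \<Longrightarrow> br u k = 0"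
  using fI[of u] kI[of u] br_anti[of u f] br_anti[of u k] by (simp_all add: f_def)

lemma F_decomp: "y \<in> {f, k} \<Longrightarrow> br x y = (br x y \<bullet> J n) *\<^sub>R f + (br x y \<bullet> k) *\<^sub>R k + P (br x y)"
proof -
  assume "y \<in> {f, k}"
  then obtain \<alpha> \<beta> where "br x y - \<alpha> *\<^sub>R f - \<beta> *\<^sub>R k \<in> I" using in_F[of y x] by (auto simp: f_def)
  then obtain u where u: "u \<in> I" "br x y = \<alpha> *\<^sub>R f + \<beta> *\<^sub>R k + u" by (metis diff_add_cancel add.commute diff_diff_eq)
  show ?thesis unfolding u(2) using u(1) by (simp add: inner_add_left)
qed
lemma M: "br (J f) f = a1 *\<^sub>R f + a2 *\<^sub>R k + u11" "br (J f) k = b1 *\<^sub>R f + b2 *\<^sub>R k + u1k"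
  "br (J k) f = d1 *\<^sub>R f + d2 *\<^sub>R k + uk1" "br (J k) k = s1 *\<^sub>R f + s2 *\<^sub>R k + ukk"
  unfolding a1_def a2_def u11_def b1_def b2_def u1k_def d1_def d2_def uk1_def s1_def s2_def ukk_def
  by (rule F_decomp, simp)+

text \<open>Integrability for the commuting vectors \<open>f\<close> and \<open>k\<close>; modulo
  \<open>I\<close> the right-hand side is \<open>J\<close> applied to the commutator of the
  left-symmetric product.\<close>

lemma JfJk: "br (J f) (J k) = (b1 - d1) *\<^sub>R J f + (b2 - d2) *\<^sub>R J k + J (u1k - uk1)"
proof -
  have "br (J f) (J k) = J (br (J f) k) + J (br f (J k))" using integrable[of f k] by (simp add: algebra_simps)
  then show ?thesis unfolding br_anti[of f "J k"] M by (simp add: algebra_simps)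
qed

lemma br_k_n: "br k n = b1 *\<^sub>R f + b2 *\<^sub>R k + u1k"
  by (subst n_eq) (simp add: M br_anti[of k "J f"])
lemma br_k_Jn: "br k (J n) = \<gamma> *\<^sub>R (s1 *\<^sub>R f + s2 *\<^sub>R k + ukk)"
  by (subst Jn_eq) (simp add: M br_anti[of k "J k"] algebra_simps)
lemma br_k_Jk: "br k (J k) = - (s1 *\<^sub>R f + s2 *\<^sub>R k + ukk)"
  by (simp add: M br_anti[of k "J k"])
lemma br_Jk_n: "br (J k) n = (b1 - d1) *\<^sub>R J f + (b2 - d2) *\<^sub>R J k + J (u1k - uk1) - \<gamma> *\<^sub>R (s1 *\<^sub>R f + s2 *\<^sub>R k + ukk)"
  by (subst n_eq) (simp add: M JfJk br_anti[of "J k" "J f"])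
lemma br_Jk_Jn: "br (J k) (J n) = d1 *\<^sub>R f + d2 *\<^sub>R k + uk1"
  by (subst Jn_eq) (simp add: M)
lemma br_n_Jn: "br n (J n) = - (a1 *\<^sub>R f + a2 *\<^sub>R k + u11) + \<gamma> *\<^sub>R ((b1 - d1) *\<^sub>R J f + (b2 - d2) *\<^sub>R J k + J (u1k - uk1))
    - \<gamma>\<^sup>2 *\<^sub>R (s1 *\<^sub>R f + s2 *\<^sub>R k + ukk)"
proof -
  have "br n (J n) = br (- J f - \<gamma> *\<^sub>R k) (f - \<gamma> *\<^sub>R J k)" using n_eq Jn_eq by simp
  also have "\<dots> = - br (J f) f + \<gamma> *\<^sub>R br (J f) (J k) + (\<gamma> * \<gamma>) *\<^sub>R br k (J k)"
    by (simp add: algebra_simps)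
  finally show ?thesis unfolding M JfJk br_k_Jk by (simp add: power2_eq_square algebra_simps)
qed

definition C1 :: "'a \<Rightarrow> 'a" where "C1 x = br (J f) (P x)"
definition Ck :: "'a \<Rightarrow> 'a" where "Ck x = br (J k) (P x)"
lemma linear_C: "linear C1" "linear Ck" unfolding C1_def[abs_def] Ck_def[abs_def] by (auto intro!: linearI)
lemmas Cs [simp] = linear_C[THEN linear_add] linear_C[THEN linear_diff] linear_C[THEN linear_neg] linear_C[THEN linear_scale] linear_C[THEN linear_0]
lemma C_I [simp]: "C1 x \<in> I" "Ck x \<in> I" by (simp_all add: C1_def Ck_def ideal)
text \<open>\<open>f\<close> and \<open>k\<close> commute with \<open>I\<close>, so integrability
  reduces to complex linearity. Hence no parts anticommuting with \<open>J\<close> occur in this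
  case.\<close>

lemma C_J [simp]: "C1 (J x) = J (C1 x)" "Ck (J x) = J (Ck x)"
proof -
  have "br (J f) (J u) = J (br (J f) u)" "br (J k) (J u) = J (br (J k) u)" if "u \<in> I" for u
    using integrable[of f u] integrable[of k u] that J_I[OF that] by (simp_all add: eq_neg_iff_add_eq_0 algebra_simps)
  then show "C1 (J x) = J (C1 x)" "Ck (J x) = J (Ck x)" by (simp_all add: C1_def Ck_def P_J)
qed
lemma C_P [simp]: "C1 (P x) = C1 x" "Ck (P x) = Ck x" by (simp_all add: C1_def Ck_def)

lemma br_v: "v \<in> I \<Longrightarrow> br x v = - (x \<bullet> n) *\<^sub>R C1 v - (\<gamma> * (x \<bullet> J n)) *\<^sub>R Ck v + (x \<bullet> J k) *\<^sub>R Ck v"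
proof -
  assume v: "v \<in> I"
  have n: "br n v = - C1 v" by (subst n_eq) (use v in \<open>simp add: C1_def\<close>)
  have Jn: "br (J n) v = - \<gamma> *\<^sub>R Ck v" by (subst Jn_eq) (use v in \<open>simp add: Ck_def\<close>)
  have Jk: "br (J k) v = Ck v" using v by (simp add: Ck_def)
  have "br x v = (x \<bullet> n) *\<^sub>R br n v + (x \<bullet> J n) *\<^sub>R br (J n) v + (x \<bullet> k) *\<^sub>R br k v + (x \<bullet> J k) *\<^sub>R br (J k) v"
    by (subst split[of x]) (simp add: abelian v)
  then show ?thesis unfolding n Jn Jk using v by simp
qed
lemma br_Jf_v: "v \<in> I \<Longrightarrow> br (J f) v = C1 v" and br_Jk_v: "v \<in> I \<Longrightarrow> br (J k) v = Ck v"
  by (simp_all add: C1_def Ck_def)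

text \<open>The Jacobi identity of \<open>J f\<close>, \<open>J k\<close>, \<open>f\<close> is
  left-symmetry, \<open>(x y - y x) z = x (y z) - y (x z)\<close>, with the components in
  \<open>I\<close> carried along.\<close>

lemma lsa_f: "(b1 - d1) *\<^sub>R (a1 *\<^sub>R f + a2 *\<^sub>R k + u11) + (b2 - d2) *\<^sub>R (d1 *\<^sub>R f + d2 *\<^sub>R k + uk1)
   = d1 *\<^sub>R (a1 *\<^sub>R f + a2 *\<^sub>R k + u11) + d2 *\<^sub>R (b1 *\<^sub>R f + b2 *\<^sub>R k + u1k) + C1 uk1
    - a1 *\<^sub>R (d1 *\<^sub>R f + d2 *\<^sub>R k + uk1) - a2 *\<^sub>R (s1 *\<^sub>R f + s2 *\<^sub>R k + ukk) - Ck u11"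
proof -
  have "br (br (J f) (J k)) f = br (J f) (br (J k) f) - br (J k) (br (J f) f)"
    using jacobi[of "J f" "J k" f] br_anti[of f "J f"] br_anti[of f "br (J f) (J k)"] by (simp add: algebra_simps)
  moreover have "br (br (J f) (J k)) f = (b1 - d1) *\<^sub>R (a1 *\<^sub>R f + a2 *\<^sub>R k + u11) + (b2 - d2) *\<^sub>R (d1 *\<^sub>R f + d2 *\<^sub>R k + uk1)"
    by (simp add: JfJk M J_I)
  moreover have "br (J f) (br (J k) f) = d1 *\<^sub>R (a1 *\<^sub>R f + a2 *\<^sub>R k + u11) + d2 *\<^sub>R (b1 *\<^sub>R f + b2 *\<^sub>R k + u1k) + C1 uk1"
    by (simp add: M br_Jf_v)
  moreover have "br (J k) (br (J f) f) = a1 *\<^sub>R (d1 *\<^sub>R f + d2 *\<^sub>R k + uk1) + a2 *\<^sub>R (s1 *\<^sub>R f + s2 *\<^sub>R k + ukk) + Ck u11"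
    by (simp add: M br_Jk_v)
  ultimately show ?thesis by simp
qed

lemma lsa_k: "(b1 - d1) *\<^sub>R (b1 *\<^sub>R f + b2 *\<^sub>R k + u1k) + (b2 - d2) *\<^sub>R (s1 *\<^sub>R f + s2 *\<^sub>R k + ukk)
   = s1 *\<^sub>R (a1 *\<^sub>R f + a2 *\<^sub>R k + u11) + s2 *\<^sub>R (b1 *\<^sub>R f + b2 *\<^sub>R k + u1k) + C1 ukk
    - b1 *\<^sub>R (d1 *\<^sub>R f + d2 *\<^sub>R k + uk1) - b2 *\<^sub>R (s1 *\<^sub>R f + s2 *\<^sub>R k + ukk) - Ck u1k"
proof -
  have "br (br (J f) (J k)) k = br (J f) (br (J k) k) - br (J k) (br (J f) k)"
    using jacobi[of "J f" "J k" k] br_anti[of k "J f"] br_anti[of k "br (J f) (J k)"] by (simp add: algebra_simps)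
  moreover have "br (br (J f) (J k)) k = (b1 - d1) *\<^sub>R (b1 *\<^sub>R f + b2 *\<^sub>R k + u1k) + (b2 - d2) *\<^sub>R (s1 *\<^sub>R f + s2 *\<^sub>R k + ukk)"
    by (simp add: JfJk M J_I)
  moreover have "br (J f) (br (J k) k) = s1 *\<^sub>R (a1 *\<^sub>R f + a2 *\<^sub>R k + u11) + s2 *\<^sub>R (b1 *\<^sub>R f + b2 *\<^sub>R k + u1k) + C1 ukk"
    by (simp add: M br_Jf_v)
  moreover have "br (J k) (br (J f) k) = b1 *\<^sub>R (d1 *\<^sub>R f + d2 *\<^sub>R k + uk1) + b2 *\<^sub>R (s1 *\<^sub>R f + s2 *\<^sub>R k + ukk) + Ck u1k"
    by (simp add: M br_Jk_v)
  ultimately show ?thesis by simp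
qed

lemma lsa_coeffs:
  "(b1 - d1) * a1 + (b2 - d2) * d1 = d1 * a1 + d2 * b1 - a1 * d1 - a2 * s1"
  "(b1 - d1) * a2 + (b2 - d2) * d2 = d1 * a2 + d2 * b2 - a1 * d2 - a2 * s2"
  "(b1 - d1) * b1 + (b2 - d2) * s1 = s1 * a1 + s2 * b1 - b1 * d1 - b2 * s1"
  "(b1 - d1) * b2 + (b2 - d2) * s2 = s1 * a2 + s2 * b2 - b1 * d2 - b2 * s2"
  using arg_cong[OF lsa_f, of "\<lambda>x. x \<bullet> J n"] arg_cong[OF lsa_f, of "\<lambda>x. x \<bullet> k"]
    arg_cong[OF lsa_k, of "\<lambda>x. x \<bullet> J n"] arg_cong[OF lsa_k, of "\<lambda>x. x \<bullet> k"]
  by (simp_all add: inner_add_left inner_diff_left)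

lemma lsa_u:
  "(b1 - d1) *\<^sub>R u11 + (b2 - d2) *\<^sub>R uk1 = d1 *\<^sub>R u11 + d2 *\<^sub>R u1k + C1 uk1 - a1 *\<^sub>R uk1 - a2 *\<^sub>R ukk - Ck u11"
  "(b1 - d1) *\<^sub>R u1k + (b2 - d2) *\<^sub>R ukk = s1 *\<^sub>R u11 + s2 *\<^sub>R u1k + C1 ukk - b1 *\<^sub>R uk1 - b2 *\<^sub>R ukk - Ck u1k"
  using arg_cong[OF lsa_f, of P] arg_cong[OF lsa_k, of P] by simp_all

text \<open>By the Jacobi identity the action on \<open>I\<close> represents the commutator algebra
  of the left-symmetric product.\<close>

lemma rep: "C1 (Ck x) - Ck (C1 x) = (b1 - d1) *\<^sub>R C1 x + (b2 - d2) *\<^sub>R Ck x"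
proof -
  have "br (br (J f) (J k)) (P x) = br (J f) (br (J k) (P x)) - br (J k) (br (J f) (P x))"
    using jacobi[of "J f" "J k" "P x"] br_anti[of "P x" "J f"] br_anti[of "P x" "br (J f) (J k)"] by (simp add: algebra_simps)
  then show ?thesis by (simp add: JfJk br_Jf_v br_Jk_v J_I abelian)
qed

definition T1 where "T1 = linear_trace C1"
definition Tk where "Tk = linear_trace Ck"

lemma trace_decomp: assumes g: "linear g"
  shows "linear_trace g = linear_trace (\<lambda>x. g (P x)) + g n \<bullet> n + g (J n) \<bullet> J n + g k \<bullet> k + g (J k) \<bullet> J k"
proof -
  have "g = (\<lambda>x. g (P x) + (x \<bullet> n) *\<^sub>R g n + (x \<bullet> J n) *\<^sub>R g (J n) + (x \<bullet> k) *\<^sub>R g k + (x \<bullet> J k) *\<^sub>R g (J k))"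
    by (rule ext, subst (1) split) (simp add: linear_add[OF g] linear_scale[OF g])
  then have "linear_trace g = linear_trace (\<lambda>x. g (P x) + (x \<bullet> n) *\<^sub>R g n + (x \<bullet> J n) *\<^sub>R g (J n) + (x \<bullet> k) *\<^sub>R g k + (x \<bullet> J k) *\<^sub>R g (J k))"
    by simp
  then show ?thesis unfolding linear_trace_add linear_trace_rank1 by (simp add: inner_commute)
qed

text \<open>The trace of \<open>br (J f)\<close> is \<open>T1\<close> on \<open>I\<close>,
  \<open>a1 + b2\<close> on the span of \<open>f\<close> and \<open>k\<close>, and
  \<open>b2 - d2\<close> on the remaining quotient by \<open>JfJk\<close>. The same count for
  \<open>br (J k)\<close> gives the second equation.\<close>

lemma unimod_f: "T1 + a1 + 2 * b2 - d2 = 0" and unimod_k: "Tk + 2 * d1 + s2 - b1 = 0"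
proof -
  have "br (J f) n = - \<gamma> *\<^sub>R (b1 *\<^sub>R f + b2 *\<^sub>R k + u1k)" by (subst n_eq) (simp add: M)
  moreover have "br (J f) (J n) = (a1 *\<^sub>R f + a2 *\<^sub>R k + u11) - \<gamma> *\<^sub>R ((b1 - d1) *\<^sub>R J f + (b2 - d2) *\<^sub>R J k + J (u1k - uk1))"
    by (subst Jn_eq) (simp add: M JfJk)
  ultimately show "T1 + a1 + 2 * b2 - d2 = 0"
    using unimod[of "J f"] unfolding trace_decomp[OF linear_br] T1_def C1_def[abs_def] M JfJk
    by (simp add: inner_add_left inner_diff_left J_I)
  show "Tk + 2 * d1 + s2 - b1 = 0"
    using unimod[of "J k"] unfolding trace_decomp[OF linear_br] Tk_def Ck_def[abs_def] br_Jk_n br_Jk_Jn M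
    by (simp add: inner_add_left inner_diff_left J_I)
qed

lemma trace_rep: "(b1 - d1) * T1 + (b2 - d2) * Tk = 0"
proof -
  have "linear_trace (\<lambda>x. C1 (Ck x) - Ck (C1 x)) = (b1 - d1) * T1 + (b2 - d2) * Tk"
    unfolding rep linear_trace_add linear_trace_scale T1_def Tk_def ..
  then show ?thesis unfolding linear_trace_diff using linear_trace_compose[OF linear_C] by simp
qed

lemma S_II: assumes v: "v \<in> I" and w: "w \<in> I"
  shows "S v w = (w \<bullet> C1 v) *\<^sub>R n + (\<gamma> * (w \<bullet> Ck v)) *\<^sub>R J n - (w \<bullet> Ck v) *\<^sub>R J k"
proof (rule vector_eq_rdot[THEN iffD1], rule allI)
  fix x
  show "S v w \<bullet> x = ((w \<bullet> C1 v) *\<^sub>R n + (\<gamma> * (w \<bullet> Ck v)) *\<^sub>R J n - (w \<bullet> Ck v) *\<^sub>R J k) \<bullet> x"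
    unfolding S_inner br_anti[of v x] br_v[OF v]
    by (simp add: inner_add_left inner_diff_left inner_diff_right inner_add_right inner_commute[of _ x] algebra_simps)
qed
lemma S_I_orth: assumes v: "v \<in> I" and x: "\<And>u. u \<in> I \<Longrightarrow> u \<bullet> x = 0" shows "S v x = 0"
  by (rule vector_eq_rdot[THEN iffD1], rule allI) (simp add: S_inner inner_commute[of x] x br_anti[of v] ideal[OF v] I_closed)

text \<open>The factor \<open>1 + \<gamma>\<^sup>2\<close> is the squared length of
  \<open>\<gamma> J n - J k\<close>, the direction of the \<open>Ck\<close> term in
  \<open>S_II\<close>. If \<open>I\<close> is not zero, \<open>c <= 0\<close> follows.\<close>

lemma Q_I: assumes v: "v \<in> I" shows "- \<tau> * ((C1 v \<bullet> v)\<^sup>2 + (1 + \<gamma>\<^sup>2) * (Ck v \<bullet> v)\<^sup>2) = c * (v \<bullet> v)\<^sup>2"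
proof -
  have J: "v \<bullet> J (C1 v) = - (J v \<bullet> C1 v)" "v \<bullet> J (Ck v) = - (J v \<bullet> Ck v)"
    "J (C1 v) \<bullet> v = - (J v \<bullet> C1 v)" "J (Ck v) \<bullet> v = - (J v \<bullet> Ck v)"
    using J_skew[of "C1 v" v] J_skew[of "Ck v" v] J_skew[of v "C1 v"] J_skew[of v "Ck v"]
      inner_commute[of "C1 v" "J v"] inner_commute[of "Ck v" "J v"] by simp_all
  have "Q \<tau> v = - \<tau> * ((C1 v \<bullet> v)\<^sup>2 + (1 + \<gamma>\<^sup>2) * (Ck v \<bullet> v)\<^sup>2)"
    unfolding Q_def Phi_def using v
    by (simp add: S_II J_I J abelian inner_commute[of v] inner_add_left inner_add_right inner_diff_left inner_diff_right)
      (simp add: power2_eq_square field_simps)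
  then show ?thesis using Qc[of v] by simp
qed

end

text \<open>The situation that \<open>c < 0\<close> would lead to: up to skew maps the complement acts on \<open>I\<close> by scalars.\<close>

locale totally_real_scalar = totally_real br J I n k \<gamma> \<tau> c
  for br :: "'a::euclidean_space \<Rightarrow> 'a \<Rightarrow> 'a" and J I n k \<gamma> \<tau> c +
  fixes z :: real
  assumes C1_scalar: "\<And>v w. v \<in> I \<Longrightarrow> w \<in> I \<Longrightarrow> C1 v \<bullet> w + v \<bullet> C1 w = - 2 * z * (v \<bullet> w)"
    and Ck_skew: "\<And>v w. v \<in> I \<Longrightarrow> w \<in> I \<Longrightarrow> Ck v \<bullet> w + v \<bullet> Ck w = 0"
    and c_neg: "c < 0" and I_ne: "I \<noteq> {0}"
begin

section \<open>Mixed identities when the symmetric part of the action on I is scalar\<close>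

definition K :: "'a \<Rightarrow> 'a \<Rightarrow> 'a" where "K x v = br x v - (z * (x \<bullet> n)) *\<^sub>R v"

lemma K_I: "v \<in> I \<Longrightarrow> K x v \<in> I" unfolding K_def by (intro I_closed ideal)
lemma br_K: "br x v = (z * (x \<bullet> n)) *\<^sub>R v + K x v" by (simp add: K_def)
lemma K_J: "v \<in> I \<Longrightarrow> K x (J v) = J (K x v)" unfolding K_def by (simp add: br_v J_I)
lemma K_skew: assumes "v \<in> I" "w \<in> I" shows "K x v \<bullet> w = - (v \<bullet> K x w)"
proof -
  have e: "v \<bullet> C1 w = - (C1 v \<bullet> w) - 2 * z * (v \<bullet> w)" "v \<bullet> Ck w = - (Ck v \<bullet> w)"
    using C1_scalar[OF assms] Ck_skew[OF assms] by simp_all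
  show ?thesis unfolding K_def br_v[OF assms(1), of x] br_v[OF assms(2), of x]
    by (simp add: inner_add_left inner_diff_left inner_add_right inner_diff_right e algebra_simps)
qed

definition sb :: "'a \<Rightarrow> 'a \<Rightarrow> 'a" where "sb x v = S x v - P (S x v)"

lemma P_S: "v \<in> I \<Longrightarrow> P (S x v) = (z * (x \<bullet> n)) *\<^sub>R v - K x v"
proof (rule vector_eq_rdot[THEN iffD1], rule allI)
  fix w assume v: "v \<in> I"
  have "P (S x v) \<bullet> w = v \<bullet> br x (P w)" by (simp add: P_sym S_inner)
  also have "\<dots> = ((z * (x \<bullet> n)) *\<^sub>R v - K x v) \<bullet> P w"
    using K_skew[OF v P_I[of w], of x] by (simp add: br_K[of x "P w"] inner_add_right inner_diff_left)
  also have "\<dots> = ((z * (x \<bullet> n)) *\<^sub>R v - K x v) \<bullet> w"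
    using v K_I[OF v, of x] by (simp add: P_sym[symmetric])
  finally show "P (S x v) \<bullet> w = ((z * (x \<bullet> n)) *\<^sub>R v - K x v) \<bullet> w" .
qed
lemma S_v: "v \<in> I \<Longrightarrow> S x v = ((z * (x \<bullet> n)) *\<^sub>R v - K x v) + sb x v" by (simp add: sb_def P_S)
lemma sb_orth: "u \<in> I \<Longrightarrow> u \<bullet> sb x v = 0" "P (sb x v) = 0"
  by (simp_all add: sb_def inner_diff_right P_sym[symmetric])
lemma sb_comp: "P w = 0 \<Longrightarrow> sb x v \<bullet> w = v \<bullet> br x w"
  unfolding sb_def inner_diff_left by (simp add: P_sym S_inner)

text \<open>Contribution of one unit vector \<open>w\<close> of the complement to \<open>Phi\<close>
  of the components outside \<open>I\<close>, written as squares by means of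
  \<open>(p + r)^2 / 4 - p r = (p - r)^2 / 4\<close>.\<close>

definition cell :: "'a \<Rightarrow> 'a \<Rightarrow> 'a \<Rightarrow> real" where
  "cell x v w = ((v \<bullet> br x w - J v \<bullet> br (J x) w)\<^sup>2 + (v \<bullet> br (J x) w + J v \<bullet> br x w)\<^sup>2
     - \<tau> * (v \<bullet> br x w + J v \<bullet> br (J x) w)\<^sup>2) / 4"

lemma Phi_sb: "Phi \<tau> (sb x v) (sb (J x) (J v)) (sb (J x) v) (sb x (J v)) 0
   = cell x v n + cell x v (J n) + cell x v k + cell x v (J k)"
proof -
  have PB: "Phi \<tau> p r' r p' 0 = - (p \<bullet> r') + (r + p') \<bullet> (r + p') / 4 - (\<tau> - 1) / 4 * ((p + r') \<bullet> (p + r'))" for p r r' p'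
  proof -
    have "(0 + J (p + r')) \<bullet> (0 + J (p + r')) = (p + r') \<bullet> (p + r')" by (simp only: add_0 iso)
    then show ?thesis unfolding Phi_def by (simp only:) simp
  qed
  note i = inner_add_left power2_eq_square sb_orth sb_comp
  have e: "sb x v \<bullet> sb (J x) (J v) = (v \<bullet> br x n) * (J v \<bullet> br (J x) n) + (v \<bullet> br x (J n)) * (J v \<bullet> br (J x) (J n))
      + (v \<bullet> br x k) * (J v \<bullet> br (J x) k) + (v \<bullet> br x (J k)) * (J v \<bullet> br (J x) (J k))"
    by (subst inner_expand) (simp add: i)
  have e': "(sb (J x) v + sb x (J v)) \<bullet> (sb (J x) v + sb x (J v)) = (v \<bullet> br (J x) n + J v \<bullet> br x n)\<^sup>2
      + (v \<bullet> br (J x) (J n) + J v \<bullet> br x (J n))\<^sup>2 + (v \<bullet> br (J x) k + J v \<bullet> br x k)\<^sup>2 + (v \<bullet> br (J x) (J k) + J v \<bullet> br x (J k))\<^sup>2"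
    by (subst inner_expand) (simp add: i)
  have e'': "(sb x v + sb (J x) (J v)) \<bullet> (sb x v + sb (J x) (J v)) = (v \<bullet> br x n + J v \<bullet> br (J x) n)\<^sup>2
      + (v \<bullet> br x (J n) + J v \<bullet> br (J x) (J n))\<^sup>2 + (v \<bullet> br x k + J v \<bullet> br (J x) k)\<^sup>2 + (v \<bullet> br x (J k) + J v \<bullet> br (J x) (J k))\<^sup>2"
    by (subst inner_expand) (simp add: i)
  show ?thesis unfolding PB e e' e'' cell_def by (simp add: power2_eq_square field_simps)
qed

text \<open>\<open>Q_even\<close> and \<open>Q_odd\<close> for a complement vector \<open>x\<close>
  and \<open>v\<close> in \<open>I\<close>. The skew part \<open>K\<close> of the action survives
  only in \<open>kv \<bullet> J lv\<close>, which the Jacobi identity cancels against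
  \<open>Psi\<close>. What remains involves \<open>z\<close> and brackets of complement vectors
  only.\<close>

lemma mixed_scalar:
  assumes x: "P x = 0" and v: "v \<in> I"
  shows "cell x v n + cell x v (J n) + cell x v k + cell x v (J k)
    - \<tau> * z\<^sup>2 * ((x \<bullet> n)\<^sup>2 + (x \<bullet> J n)\<^sup>2) * (v \<bullet> v)
    + \<tau> * z * (x \<bullet> br x n + J x \<bullet> br (J x) n) * (v \<bullet> v) + (\<tau> - 1) * z * (br x (J x) \<bullet> J n) * (v \<bullet> v) = 2 * c * (x \<bullet> x) * (v \<bullet> v)"
  and mixed_odd: "\<tau> * z * (v \<bullet> v) * (v \<bullet> br x n + J v \<bullet> br (J x) n) = 0"
proof -
  have Jv: "J v \<in> I" using v by (rule J_I)
  have ux: "u \<bullet> x = 0" "u \<bullet> J x = 0" "x \<bullet> u = 0" if "u \<in> I" for u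
  proof -
    show 1: "u \<bullet> x = 0" using that x by (metis P_id P_sym inner_zero_right)
    have "J u \<bullet> x = 0" using J_I[OF that] x by (metis P_id P_sym inner_zero_right)
    then show "u \<bullet> J x = 0" using J_skew[of u x] by simp
    show "x \<bullet> u = 0" using 1 by (simp add: inner_commute)
  qed
  have Svx: "S v x = 0" "S v (J x) = 0" "S (J v) x = 0" "S (J v) (J x) = 0"
    using S_I_orth[OF v] S_I_orth[OF Jv] ux by simp_all
  define \<zeta> where "\<zeta> = z * (x \<bullet> n)" define \<zeta>' where "\<zeta>' = z * (J x \<bullet> n)"
  define kv where "kv = K x v" define lv where "lv = K (J x) v"
  have kl: "kv \<in> I" "lv \<in> I" unfolding kv_def lv_def using K_I[OF v] by blast+
  have Kx: "K x v = kv" "K x (J v) = J kv" "K (J x) v = lv" "K (J x) (J v) = J lv"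
    using K_J[OF v] by (simp_all add: kv_def lv_def)
  note S1 = S_v[OF v, of x] S_v[OF v, of "J x"] S_v[OF Jv, of x] S_v[OF Jv, of "J x"]
  have m: "S x v + S v x = ((\<zeta> *\<^sub>R v) - kv + 0 - 0) + sb x v"
    "S (J x) (J v) + S (J v) (J x) = (J (\<zeta>' *\<^sub>R v) - J lv + 0 - 0) + sb (J x) (J v)"
    "S (J x) v + S (J v) x = (\<zeta>' *\<^sub>R v - lv + J 0 - J 0) + sb (J x) v"
    "S x (J v) + S v (J x) = (J (\<zeta> *\<^sub>R v) - J kv - J 0 + J 0) + sb x (J v)"
    "br x (J v) + br v (J x) = (J (\<zeta> *\<^sub>R v) + J kv - J 0 - J 0 - (\<zeta>' *\<^sub>R v + lv + J 0 + J 0)) + 0"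
    by (simp_all add: Svx S1 br_anti[of v "J x"] br_K[of x "J v"] br_K[of "J x" v] \<zeta>_def \<zeta>'_def Kx)
  have kv0: "kv \<bullet> v = 0" "lv \<bullet> v = 0" using K_skew[OF v v, of x] K_skew[OF v v, of "J x"] by (simp_all add: kv_def lv_def inner_commute)
  have I: "\<zeta> *\<^sub>R v - kv + 0 - 0 \<in> I" "J (\<zeta>' *\<^sub>R v) - J lv + 0 - 0 \<in> I" "\<zeta>' *\<^sub>R v - lv + J 0 - J 0 \<in> I"
    "J (\<zeta> *\<^sub>R v) - J kv - J 0 + J 0 \<in> I" "J (\<zeta> *\<^sub>R v) + J kv - J 0 - J 0 - (\<zeta>' *\<^sub>R v + lv + J 0 + J 0) \<in> I"
    by (intro I_closed v kl)+
  have xJn: "J x \<bullet> n = - (x \<bullet> J n)" by (rule J_skew)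
  have PhiI: "Phi \<tau> ((\<zeta> *\<^sub>R v) - kv + 0 - 0) (J (\<zeta>' *\<^sub>R v) - J lv + 0 - 0) (\<zeta>' *\<^sub>R v - lv + J 0 - J 0)
     (J (\<zeta> *\<^sub>R v) - J kv - J 0 + J 0) (J (\<zeta> *\<^sub>R v) + J kv - J 0 - J 0 - (\<zeta>' *\<^sub>R v + lv + J 0 + J 0))
     = - \<tau> * z\<^sup>2 * ((x \<bullet> n)\<^sup>2 + (x \<bullet> J n)\<^sup>2) * (v \<bullet> v) - 2 * (kv \<bullet> J lv)"
    unfolding mixed_identity using kv0
    by (simp add: inner_add_left inner_add_right \<zeta>_def \<zeta>'_def xJn power2_eq_square algebra_simps)
  have mix: "Phi \<tau> (S x v + S v x) (S (J x) (J v) + S (J v) (J x)) (S (J x) v + S (J v) x) (S x (J v) + S v (J x)) (br x (J v) + br v (J x))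
    = cell x v n + cell x v (J n) + cell x v k + cell x v (J k)
     - \<tau> * z\<^sup>2 * ((x \<bullet> n)\<^sup>2 + (x \<bullet> J n)\<^sup>2) * (v \<bullet> v) - 2 * (kv \<bullet> J lv)"
    unfolding m Phi_add Phi_sb PhiI
    by (subst Psi_orth_subspace[OF sub J_I I]) (simp_all add: sb_orth)
  have Cv: "v \<bullet> C1 v = - z * (v \<bullet> v)" "J v \<bullet> C1 (J v) = - z * (v \<bullet> v)" "v \<bullet> Ck v = 0" "J v \<bullet> Ck (J v) = 0"
    using C1_scalar[OF v v] Ck_skew[OF v v] by (simp_all add: inner_commute)
  have CJ: "v \<bullet> J (C1 v) = - (J v \<bullet> C1 v)" "v \<bullet> J (Ck v) = - (J v \<bullet> Ck v)" by (simp_all add: J_skew[of v])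
  have Nv: "S v v = (- z * (v \<bullet> v)) *\<^sub>R n" "S (J v) (J v) = (- z * (v \<bullet> v)) *\<^sub>R n" "S (J v) v = - S v (J v)" "br v (J v) = 0"
    unfolding S_II[OF v v] S_II[OF Jv Jv] S_II[OF Jv v] S_II[OF v Jv] Cv abelian[OF v Jv] by (simp_all add: CJ)
  \<comment> \<open>The commutator of \<open>K x\<close> and \<open>K (J x)\<close> is the action of
    \<open>br x (J x)\<close> because the scalar parts commute; it is paired with
    \<open>J v\<close>.\<close>
  have key: "2 * (kv \<bullet> J lv) + S v (J v) \<bullet> br x (J x) = 0"
  proof -
    define y where "y = br x (J x)"
    have "br x (br (J x) v) - br (J x) (br x v) = br y v" unfolding y_def
      using jacobi[of x "J x" v] br_anti[of v x] br_anti[of v "br x (J x)"] by (simp add: algebra_simps)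
    then have "(br x (br (J x) v) - br (J x) (br x v)) \<bullet> J v = br y v \<bullet> J v" by simp
    moreover have "S v (J v) \<bullet> y = - (br y v \<bullet> J v)" by (simp only: S_inner br_anti[of v y] inner_minus_right inner_commute[of "J v"])
    moreover have "br x (br (J x) v) - br (J x) (br x v) = K x lv - K (J x) kv"
      unfolding br_K[of x v] br_K[of "J x" v] Kx by (simp add: br_K[of x] br_K[of "J x"] Kx algebra_simps)
    moreover have "K x lv \<bullet> J v = kv \<bullet> J lv" "K (J x) kv \<bullet> J v = - (kv \<bullet> J lv)"
      using K_skew[OF kl(2) Jv, of x] K_skew[OF kl(1) Jv, of "J x"] J_skew[of lv kv]
      by (simp_all add: Kx inner_commute[of "J lv"])
    ultimately show ?thesis unfolding y_def[symmetric] by (simp add: inner_diff_left)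
  qed
  have N12: "(S x x + S (J x) (J x)) \<bullet> n = x \<bullet> br x n + J x \<bullet> br (J x) n" by (simp add: inner_add_left S_inner)
  have "Psi \<tau> (S x x) (S (J x) (J x)) (S (J x) x) (S x (J x)) (br x (J x))
        (S v v) (S (J v) (J v)) (S (J v) v) (S v (J v)) (br v (J v))
     = \<tau> * z * (x \<bullet> br x n + J x \<bullet> br (J x) n) * (v \<bullet> v) + (\<tau> - 1) * z * (br x (J x) \<bullet> J n) * (v \<bullet> v) - S v (J v) \<bullet> br x (J x)"
    unfolding Psi_def Nv N12[symmetric]
    by (simp add: inner_add_left inner_add_right inner_diff_left inner_diff_right inner_commute[of n])
      (simp add: field_simps)
  then show "cell x v n + cell x v (J n) + cell x v k + cell x v (J k)
    - \<tau> * z\<^sup>2 * ((x \<bullet> n)\<^sup>2 + (x \<bullet> J n)\<^sup>2) * (v \<bullet> v)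
    + \<tau> * z * (x \<bullet> br x n + J x \<bullet> br (J x) n) * (v \<bullet> v) + (\<tau> - 1) * z * (br x (J x) \<bullet> J n) * (v \<bullet> v) = 2 * c * (x \<bullet> x) * (v \<bullet> v)"
    using Q_even[OF Qc, of x v] mix key ux(3)[OF v] by simp
  have yI: "br x (J v) + br v (J x) \<in> I" unfolding br_anti[of v "J x"] by (intro I_closed ideal v Jv)
  have "S v (J v) \<bullet> u = 0" if "u \<in> I" for u unfolding S_II[OF v Jv] using that by (simp add: inner_add_left inner_diff_left)
  then have e: "S v (J v) \<bullet> (br x (J v) + br v (J x)) = 0" "(br x (J v) + br v (J x)) \<bullet> J n = 0" using yI by simp_all
  have N12v: "(S x v + S v x + (S (J x) (J v) + S (J v) (J x))) \<bullet> n = v \<bullet> br x n + J v \<bullet> br (J x) n"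
    unfolding Svx by (simp add: inner_add_left S_inner)
  define y where "y = br x (J v) + br v (J x)"
  have "Psi \<tau> (S x v + S v x) (S (J x) (J v) + S (J v) (J x)) (S (J x) v + S (J v) x) (S x (J v) + S v (J x)) (br x (J v) + br v (J x))
        (S v v) (S (J v) (J v)) (S (J v) v) (S v (J v)) (br v (J v)) = \<tau> * z * (v \<bullet> v) * (v \<bullet> br x n + J v \<bullet> br (J x) n)"
    unfolding Psi_def Nv N12v[symmetric] y_def[symmetric]
    using e unfolding y_def[symmetric]
    by (simp add: inner_add_left inner_add_right inner_diff_left inner_diff_right inner_commute[of n])
      (simp add: field_simps)
  then show "\<tau> * z * (v \<bullet> v) * (v \<bullet> br x n + J v \<bullet> br (J x) n) = 0"
    using Q_odd[OF Qc, of x v] ux(3)[OF v] by simp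
qed

lemma c_scalar: "v \<in> I \<Longrightarrow> v \<noteq> 0 \<Longrightarrow> c = - \<tau> * z\<^sup>2"
proof -
  assume v: "v \<in> I" "v \<noteq> 0"
  have C: "C1 v \<bullet> v = - z * (v \<bullet> v)" "Ck v \<bullet> v = 0"
    using C1_scalar[OF v(1) v(1)] Ck_skew[OF v(1) v(1)] inner_commute[of v "C1 v"] inner_commute[of v "Ck v"] by linarith+
  have "- \<tau> * ((- z * (v \<bullet> v))\<^sup>2 + (1 + \<gamma>\<^sup>2) * 0\<^sup>2) = c * (v \<bullet> v)\<^sup>2"
    using Q_I[OF v(1)] unfolding C .
  then have "c * (v \<bullet> v)\<^sup>2 + \<tau> * (z\<^sup>2 * (v \<bullet> v)\<^sup>2) = 0" by (simp add: power_mult_distrib)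
  then have "(v \<bullet> v)\<^sup>2 * (c + \<tau> * z\<^sup>2) = 0" by (simp add: algebra_simps)
  then show ?thesis using v by simp
qed

end

context totally_real begin

lemma orth_f [simp]: "u \<in> I \<Longrightarrow> u \<bullet> f = 0" "u \<in> I \<Longrightarrow> f \<bullet> u = 0" "u \<in> I \<Longrightarrow> u \<bullet> J f = 0" "u \<in> I \<Longrightarrow> J f \<bullet> u = 0"
  by (simp_all add: f_def inner_add_left inner_add_right inner_diff_left inner_diff_right)
lemma n_f [simp]: "n \<bullet> f = 0" "J n \<bullet> f = 1" "k \<bullet> f = 0" "J k \<bullet> f = \<gamma>"
  "n \<bullet> J f = - 1" "J n \<bullet> J f = 0" "k \<bullet> J f = - \<gamma>" "J k \<bullet> J f = 0"
  by (simp_all add: inner_commute[of _ f] inner_commute[of _ "J f"])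

lemma trace_P_eq: "linear_trace P = (\<Sum>b\<in>Basis. P b \<bullet> P b)" unfolding linear_trace_def by (simp add: P_sym)
lemma trace_P_pos: assumes "I \<noteq> {0}" shows "linear_trace P > 0"
proof -
  obtain v where v: "v \<in> I" "v \<noteq> 0" using assms subspace_0[OF sub] by blast
  have "linear_trace P \<noteq> 0"
  proof
    assume "linear_trace P = 0"
    then have "\<forall>b\<in>Basis. P b \<bullet> P b = 0" unfolding trace_P_eq by (subst (asm) sum_nonneg_eq_0_iff) auto
    then have "\<forall>b\<in>Basis. P b = 0" by simp
    then have "P = (\<lambda>x. 0)" by (intro linear_eq_stdbasis[OF linear_P]) (auto intro: linearI)
    then show False using v by (metis P_id)
  qed
  moreover have "linear_trace P \<ge> 0" unfolding trace_P_eq by (intro sum_nonneg) simp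
  ultimately show ?thesis by simp
qed

end

context totally_real_scalar begin

text \<open>The complex dimension of \<open>I\<close>.\<close>

definition m where "m = linear_trace P / 2"

lemma ex_v: obtains v where "v \<in> I" "v \<noteq> 0" using I_ne subspace_0[OF sub] by blast
lemma c_eq: "c = - \<tau> * z\<^sup>2" by (rule ex_v) (rule c_scalar)
lemma tau_pos: "\<tau> > 0" and z_ne: "z \<noteq> 0" using c_neg tau_nonneg unfolding c_eq by (auto simp: less_eq_real_def)

lemma trace_P: "linear_trace P = 2 * m" by (simp add: m_def)

lemma T_vals: "T1 = - z * (2 * m)" "Tk = 0"
proof -
  have e: "linear_trace (\<lambda>x. g (P x)) = (\<Sum>b\<in>Basis. g (P b) \<bullet> P b)" if "linear g" "\<And>x. g (P x) \<in> I" for g :: "'a \<Rightarrow> 'a"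
    unfolding linear_trace_def using that(2) by (simp add: P_sym[symmetric])
  have C: "C1 (P x) \<bullet> P x = - z * (P x \<bullet> P x)" "Ck (P x) \<bullet> P x = 0" for x
    using C1_scalar[of "P x" "P x"] Ck_skew[of "P x" "P x"] inner_commute[of "P x" "C1 (P x)"] inner_commute[of "P x" "Ck (P x)"] by simp_all
  have "T1 = (\<Sum>b\<in>Basis. C1 (P b) \<bullet> P b)" "Tk = (\<Sum>b\<in>Basis. Ck (P b) \<bullet> P b)"
    using e[OF linear_C(1)] e[OF linear_C(2)] by (simp_all add: T1_def Tk_def)
  then show "T1 = - z * (2 * m)" "Tk = 0" unfolding C trace_P[symmetric] trace_P_eq by (simp_all add: sum_distrib_left)
qed

lemma m_pos: "m > 0" using trace_P_pos[OF I_ne] by (simp add: m_def)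

text \<open>Here \<open>Tk = 0\<close> and \<open>T1\<close> is not zero, so
  \<open>trace_rep\<close> forces \<open>b1 = d1\<close>; the two unimodularity equations give the
  rest.\<close>

lemma d1_eq: "d1 = b1" and s2_eq: "s2 = - b1" and a_eq: "a1 + 2 * b2 - d2 = 2 * m * z"
proof -
  show "d1 = b1" using trace_rep m_pos z_ne by (simp add: T_vals)
  then show "s2 = - b1" using unimod_k by (simp add: T_vals)
  show "a1 + 2 * b2 - d2 = 2 * m * z" using unimod_f unfolding T_vals by algebra
qed

lemma odd: "P x = 0 \<Longrightarrow> v \<in> I \<Longrightarrow> v \<bullet> br x n + J v \<bullet> br (J x) n = 0"
  using mixed_odd[of x v] tau_pos z_ne by (cases "v = 0") simp_all

lemma Jv: "J v \<bullet> w = - (v \<bullet> J w)" "J v \<bullet> J w = v \<bullet> w" by (rule J_skew) simp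

lemma vector_zero: "x \<in> I \<Longrightarrow> (\<And>v. v \<in> I \<Longrightarrow> v \<bullet> x = 0) \<Longrightarrow> x = 0" by (metis inner_eq_zero_iff)

text \<open>Through this vector and \<open>ukk\<close> the odd identity expresses \<open>uk1\<close>
  and \<open>u11\<close>; it turns out to be zero.\<close>

definition \<pi> where "\<pi> = u1k + \<gamma> *\<^sub>R J ukk"
lemma pi_I: "\<pi> \<in> I" unfolding \<pi>_def by (intro I_closed u_I)

text \<open>The odd identity at \<open>x = k\<close> and at \<open>x = J n\<close>.\<close>

lemma uk1_eq: "uk1 = 2 *\<^sub>R \<pi> - \<gamma> *\<^sub>R J ukk" and u11_eq: "u11 = - \<gamma> *\<^sub>R J \<pi> - \<gamma>\<^sup>2 *\<^sub>R ukk"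
proof -
  have "2 *\<^sub>R u1k - uk1 + \<gamma> *\<^sub>R J ukk = 0"
  proof (rule vector_zero)
    show "v \<bullet> (2 *\<^sub>R u1k - uk1 + \<gamma> *\<^sub>R J ukk) = 0" if v: "v \<in> I" for v
      using odd[of k v] v J_I[OF v]
      by (simp add: br_k_n br_Jk_n inner_add_right inner_diff_right Jv d1_eq) (simp add: algebra_simps)?
  qed (intro I_closed u_I)
  moreover have "uk1 = 2 *\<^sub>R u1k + \<gamma> *\<^sub>R J ukk - (2 *\<^sub>R u1k - uk1 + \<gamma> *\<^sub>R J ukk)" by simp
  ultimately have "uk1 = 2 *\<^sub>R u1k + \<gamma> *\<^sub>R J ukk" by simp
  then show k: "uk1 = 2 *\<^sub>R \<pi> - \<gamma> *\<^sub>R J ukk" unfolding scaleR_2 by (simp add: \<pi>_def)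
  have "u11 - \<gamma> *\<^sub>R J (u1k - uk1) + \<gamma>\<^sup>2 *\<^sub>R ukk = 0"
  proof (rule vector_zero)
    show "v \<bullet> (u11 - \<gamma> *\<^sub>R J (u1k - uk1) + \<gamma>\<^sup>2 *\<^sub>R ukk) = 0" if v: "v \<in> I" for v
    proof -
      have "v \<bullet> br n (J n) = 0" using odd[of "J n" v, OF _ v] by (simp add: br_anti[of "J n" n])
      then show ?thesis unfolding br_n_Jn using v by (simp add: inner_add_right inner_diff_right d1_eq)
    qed
  qed (intro I_closed u_I)
  moreover have "u1k - uk1 = - \<pi>" unfolding k scaleR_2 by (simp add: \<pi>_def)
  ultimately show "u11 = - \<gamma> *\<^sub>R J \<pi> - \<gamma>\<^sup>2 *\<^sub>R ukk" by (simp add: algebra_simps eq_neg_iff_add_eq_0)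
qed

lemma u1k_eq: "u1k = \<pi> - \<gamma> *\<^sub>R J ukk" by (simp add: \<pi>_def)
lemma u_diff: "u1k - uk1 = - \<pi>" by (simp add: u1k_eq uk1_eq scaleR_2)

lemma cell_k:
  assumes v: "v \<in> I"
  shows "cell k v n + cell k v (J n) + cell k v k + cell k v (J k)
   = 2 * (v \<bullet> \<pi> + \<gamma> * (J v \<bullet> ukk))\<^sup>2 + 2 * (J v \<bullet> \<pi> - \<gamma> * (v \<bullet> ukk))\<^sup>2 - \<tau> * (J v \<bullet> \<pi>)\<^sup>2
    + (1/2 - \<tau>/4) * ((v \<bullet> ukk)\<^sup>2 + (J v \<bullet> ukk)\<^sup>2)"
  unfolding cell_def br_k_n br_k_Jn br_k_Jk br_Jk_n br_Jk_Jn M u_diff unfolding u1k_eq uk1_eq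
  using v J_I[OF v] Jv(1)[of v \<pi>] Jv(1)[of v ukk]
  by (simp add: inner_add_right inner_diff_right) (simp add: power2_eq_square field_simps)

lemma mixed_k: assumes v: "v \<in> I"
  shows "2 * (v \<bullet> \<pi> + \<gamma> * (J v \<bullet> ukk))\<^sup>2 + 2 * (J v \<bullet> \<pi> - \<gamma> * (v \<bullet> ukk))\<^sup>2 - \<tau> * (J v \<bullet> \<pi>)\<^sup>2
    + (1/2 - \<tau>/4) * ((v \<bullet> ukk)\<^sup>2 + (J v \<bullet> ukk)\<^sup>2)
    + \<tau> * z * (2 * b2 - d2 - \<gamma>\<^sup>2 * s1) * (v \<bullet> v) - (\<tau> - 1) * z * s1 * (v \<bullet> v) = - 2 * \<tau> * z\<^sup>2 * (v \<bullet> v)"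
proof -
  have "k \<bullet> br k n + J k \<bullet> br (J k) n = 2 * b2 - d2 - \<gamma>\<^sup>2 * s1" "br k (J k) \<bullet> J n = - s1"
    unfolding br_k_n br_Jk_n br_k_Jk by (simp_all add: inner_add_right inner_diff_right inner_add_left inner_diff_left power2_eq_square I_closed)
  then show ?thesis using mixed_scalar[of k v] v unfolding cell_k[OF v] c_eq by simp
qed

text \<open>When \<open>v\<close> is replaced by \<open>J v\<close>, only the term
  \<open>\<tau> * (J v \<bullet> \<pi>)\<^sup>2\<close> of \<open>mixed_k\<close> changes.
  Comparison at \<open>v = \<pi>\<close> gives \<open>\<tau> |\<pi>|^4 = 0\<close>.\<close>

lemma pi_zero [simp]: "\<pi> = 0"
proof -
  have "\<pi> \<bullet> J \<pi> = 0" using J_skew[of \<pi> \<pi>] by (simp add: inner_commute)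
  then have "\<tau> * (\<pi> \<bullet> \<pi>)\<^sup>2 = 0"
    using mixed_k[OF pi_I] mixed_k[OF J_I[OF pi_I]] by (simp add: Jv power2_eq_square algebra_simps)
  then show ?thesis using tau_pos by simp
qed

lemmas u_eqs = u1k_eq[unfolded pi_zero] uk1_eq[unfolded pi_zero] u11_eq[unfolded pi_zero]

lemma br_values:
  "br k n = b1 *\<^sub>R f + b2 *\<^sub>R k - \<gamma> *\<^sub>R J ukk"
  "br k (J n) = \<gamma> *\<^sub>R (s1 *\<^sub>R f - b1 *\<^sub>R k + ukk)"
  "br k (J k) = - (s1 *\<^sub>R f - b1 *\<^sub>R k + ukk)"
  "br (J k) n = (b2 - d2) *\<^sub>R J k - \<gamma> *\<^sub>R (s1 *\<^sub>R f - b1 *\<^sub>R k + ukk)"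
  "br (J k) (J n) = b1 *\<^sub>R f + d2 *\<^sub>R k - \<gamma> *\<^sub>R J ukk"
  "br n (J n) = \<gamma> *\<^sub>R ((b2 - d2) *\<^sub>R J k) - (a1 *\<^sub>R f + a2 *\<^sub>R k) - \<gamma>\<^sup>2 *\<^sub>R (s1 *\<^sub>R f - b1 *\<^sub>R k)"
  unfolding br_k_n br_k_Jn br_k_Jk br_Jk_n br_Jk_Jn br_n_Jn u_diff unfolding u_eqs d1_eq s2_eq
  by (simp_all add: algebra_simps)

lemma br_values':
  "br n k = - (b1 *\<^sub>R f + b2 *\<^sub>R k - \<gamma> *\<^sub>R J ukk)"
  "br (J n) k = - (\<gamma> *\<^sub>R (s1 *\<^sub>R f - b1 *\<^sub>R k + ukk))"
  "br (J k) k = s1 *\<^sub>R f - b1 *\<^sub>R k + ukk"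
  "br n (J k) = - ((b2 - d2) *\<^sub>R J k - \<gamma> *\<^sub>R (s1 *\<^sub>R f - b1 *\<^sub>R k + ukk))"
  "br (J n) (J k) = - (b1 *\<^sub>R f + d2 *\<^sub>R k - \<gamma> *\<^sub>R J ukk)"
  "br (J n) n = - (\<gamma> *\<^sub>R ((b2 - d2) *\<^sub>R J k) - (a1 *\<^sub>R f + a2 *\<^sub>R k) - \<gamma>\<^sup>2 *\<^sub>R (s1 *\<^sub>R f - b1 *\<^sub>R k))"
  unfolding br_anti[of n k] br_anti[of "J n" k] br_anti[of "J k" k] br_anti[of n "J k"] br_anti[of "J n" "J k"] br_anti[of "J n" n] br_values
  by (simp_all add: algebra_simps)

text \<open>Coordinates in \<open>br n (J n) = g1 k + g2 J k - g0 J n\<close>.\<close>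

definition g0 where "g0 = a1 + \<gamma>\<^sup>2 * s1"
definition g1 where "g1 = \<gamma>\<^sup>2 * b1 - a2"
definition g2 where "g2 = \<gamma> * (b2 - d2 - g0)"

lemma mixed_n: assumes v: "v \<in> I"
  shows "z * g0 * (v \<bullet> v) = \<tau> * \<gamma>\<^sup>2 * ((v \<bullet> ukk)\<^sup>2 + (J v \<bullet> ukk)\<^sup>2) - \<tau> * z\<^sup>2 * (v \<bullet> v)"
proof -
  have cells: "cell n v n + cell n v (J n) + cell n v k + cell n v (J k) = - \<tau> * \<gamma>\<^sup>2 * ((v \<bullet> ukk)\<^sup>2 + (J v \<bullet> ukk)\<^sup>2)"
    unfolding cell_def br_values br_values' using v J_I[OF v] Jv(1)[of v ukk]
    by (simp add: inner_add_right inner_diff_right) (simp add: power2_eq_square field_simps)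
  have "n \<bullet> br n n + J n \<bullet> br (J n) n = g0" "br n (J n) \<bullet> J n = - g0"
    unfolding br_values br_values' by (simp_all add: inner_add_right inner_diff_right inner_add_left inner_diff_left g0_def)
  then show ?thesis using mixed_scalar[of n v] v unfolding cells c_eq by (simp add: algebra_simps)
qed

text \<open>Polarization of \<open>mixed_scalar\<close> in its complement vector: the value at
  \<open>n + k\<close> minus the values at \<open>n\<close> and at \<open>k\<close>.
  \<open>mixed_n_Jk\<close> does the same with \<open>J k\<close>.\<close>

lemma mixed_n_k: assumes v: "v \<in> I"
  shows "2 * \<gamma> * s1 * (1 - \<tau>) * z * (v \<bullet> v) + \<tau> * z * (g2 + \<gamma> * s1) * (v \<bullet> v) = \<tau> * \<gamma> * ((v \<bullet> ukk)\<^sup>2 + (J v \<bullet> ukk)\<^sup>2)"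
proof -
  let ?C = "\<lambda>x. cell x v n + cell x v (J n) + cell x v k + cell x v (J k)"
  have cells: "?C (n + k) = ?C n + ?C k + \<tau> * \<gamma> * ((v \<bullet> ukk)\<^sup>2 + (J v \<bullet> ukk)\<^sup>2)"
    unfolding cell_def linear_add brs br_values br_values' using v J_I[OF v] Jv(1)[of v ukk]
    by (simp add: inner_add_right inner_diff_right br_values br_values') (simp add: power2_eq_square field_simps)
  have "(n + k) \<bullet> br (n + k) n + J (n + k) \<bullet> br (J (n + k)) n
      = n \<bullet> br n n + J n \<bullet> br (J n) n + (k \<bullet> br k n + J k \<bullet> br (J k) n) - (\<gamma> * s1 + g2)"
    "br (n + k) (J (n + k)) \<bullet> J n = br n (J n) \<bullet> J n + br k (J k) \<bullet> J n + 2 * \<gamma> * s1"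
    "P (n + k) = 0" "(n + k) \<bullet> n = 1" "(n + k) \<bullet> J n = 0" "(n + k) \<bullet> (n + k) = 2"
    by (simp_all add: inner_add_right inner_diff_right inner_add_left inner_diff_left br_values br_values' g2_def g0_def J_I power2_eq_square algebra_simps)
  note e = this
  have o: "k \<bullet> J n = 0" "k \<bullet> n = 0" "n \<bullet> J n = 0" "k \<bullet> k = 1" "n \<bullet> n = 1" "(0::real)\<^sup>2 = 0" by simp_all
  note 1 = mixed_scalar[of "n + k" v, OF e(3) v, unfolded cells e c_eq zero_power2 power_one]
    and 2 = mixed_scalar[of n v, OF P_basis(1) v, unfolded c_eq o power_one] and 3 = mixed_scalar[of k v, OF P_basis(3) v, unfolded c_eq o power_one]
  show ?thesis using 1 2 3 by algebra
qed

lemma mixed_n_Jk: "\<tau> * g1 = b1 * (2 - \<tau>)"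
proof -
  obtain v where v: "v \<in> I" "v \<noteq> 0" by (rule ex_v)
  let ?C = "\<lambda>x. cell x v n + cell x v (J n) + cell x v k + cell x v (J k)"
  have cells: "?C (n + J k) = ?C n + ?C (J k)"
    unfolding cell_def using v J_I[OF v(1)] Jv(1)[of v ukk]
    by (simp add: inner_add_right inner_diff_right br_values br_values') (simp add: power2_eq_square field_simps)
  have "(n + J k) \<bullet> br (n + J k) n + J (n + J k) \<bullet> br (J (n + J k)) n
      = n \<bullet> br n n + J n \<bullet> br (J n) n + (J k \<bullet> br (J k) n + J (J k) \<bullet> br (J (J k)) n) + (g1 - b1)"
    "br (n + J k) (J (n + J k)) \<bullet> J n = br n (J n) \<bullet> J n + br (J k) (J (J k)) \<bullet> J n + 2 * b1"
    "P (n + J k) = 0" "(n + J k) \<bullet> n = 1" "(n + J k) \<bullet> J n = 0" "(n + J k) \<bullet> (n + J k) = 2"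
    by (simp_all add: inner_add_right inner_diff_right inner_add_left inner_diff_left br_values br_values' g1_def J_I power2_eq_square algebra_simps)
  note e = this
  have o: "J k \<bullet> J n = 0" "J k \<bullet> J k = 1" "n \<bullet> J n = 0" "J k \<bullet> n = 0" "n \<bullet> n = 1" "(0::real)\<^sup>2 = 0" by simp_all
  note 1 = mixed_scalar[of "n + J k" v, OF e(3) v(1), unfolded cells e c_eq zero_power2 power_one]
    and 2 = mixed_scalar[of n v, OF P_basis(1) v(1), unfolded c_eq o power_one] and 3 = mixed_scalar[of "J k" v, OF P_basis(4) v(1), unfolded c_eq o power_one]
  have "z * (v \<bullet> v) * (\<tau> * g1 - b1 * (2 - \<tau>)) = 0" using 1 2 3 by algebra
  then show ?thesis using v z_ne by simp
qed

lemma Q_n: "- g0\<^sup>2 - \<tau> / 4 * ((g1 + b1)\<^sup>2 + (g2 - \<gamma> * s1)\<^sup>2) - (g1\<^sup>2 + g2\<^sup>2) / 2 + b1 * g1 - \<gamma> * s1 * g2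
   + (b1\<^sup>2 + \<gamma>\<^sup>2 * s1\<^sup>2) / 2 = - \<tau> * z\<^sup>2"
proof -
  have PS: "P (S x y) = 0" if "P x = 0" "P y = 0" for x y
  proof (rule vector_zero)
    fix v assume v: "v \<in> I"
    have "y \<bullet> br x v = 0" using ideal[OF v, of x] that by (metis P_id P_sym inner_zero_left)
    then show "v \<bullet> P (S x y) = 0" using v by (simp add: P_sym[symmetric] inner_S inner_commute[of v])
  qed simp
  have S: "S n n = 0" "S (J n) n = 0" "S (J n) (J n) = g0 *\<^sub>R n - (\<gamma> * s1) *\<^sub>R k - b1 *\<^sub>R J k"
    "S n (J n) = - g0 *\<^sub>R J n - b1 *\<^sub>R k + (\<gamma> * s1) *\<^sub>R J k"
    by (rule eq_by_comps; simp add: PS S_inner br_values br_values' inner_add_left inner_add_right inner_diff_left inner_diff_right J_I; simp add: g0_def)+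
  have y: "br n (J n) = g1 *\<^sub>R k + g2 *\<^sub>R J k - g0 *\<^sub>R J n"
    by (rule eq_by_comps) (simp_all add: br_values inner_add_left inner_diff_left g0_def g1_def g2_def power2_eq_square algebra_simps)
  have "Q \<tau> n = - g0\<^sup>2 - \<tau> / 4 * ((g1 + b1)\<^sup>2 + (g2 - \<gamma> * s1)\<^sup>2) - (g1\<^sup>2 + g2\<^sup>2) / 2 + b1 * g1 - \<gamma> * s1 * g2
   + (b1\<^sup>2 + \<gamma>\<^sup>2 * s1\<^sup>2) / 2"
    unfolding Q_def Phi_def S y
    by (simp add: inner_add_left inner_add_right inner_diff_left inner_diff_right) (simp add: power2_eq_square field_simps)
  then show ?thesis using Qc[of n] unfolding c_eq by simp
qed

lemma lsa_s: "s1 * (a1 - m * z) = b1\<^sup>2"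
  using lsa_coeffs(3) a_eq unfolding d1_eq s2_eq by algebra

end

section \<open>Inconsistency of the equations for the structure constants when c < 0\<close>

lemma large_orthogonal_contradiction:
  fixes \<tau> z m s b g g1 g2 a :: real
  assumes pos: "\<tau> > 0" "z \<noteq> 0" "m > 0" and g0: "a + g\<^sup>2 * s = - \<tau> * z"
    and s: "s * (1 - \<tau>) = - \<tau> * z * (2 * m + 2 + \<tau>)" and g1: "\<tau> * g1 = b * (2 - \<tau>)" and g2: "\<tau> * g2 = - g * s * (2 - \<tau>)"
    and Q: "- (\<tau> * z)\<^sup>2 - \<tau> / 4 * ((g1 + b)\<^sup>2 + (g2 - g * s)\<^sup>2) - (g1\<^sup>2 + g2\<^sup>2) / 2 + b * g1 - g * s * g2
      + (b\<^sup>2 + g\<^sup>2 * s\<^sup>2) / 2 = - \<tau> * z\<^sup>2"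
    and b: "s * (a - m * z) = b\<^sup>2"
  shows False
proof -
  \<comment> \<open>\<open>N\<close> is nonnegative, while the linear relations give
    \<open>N * (1 - \<tau>) > 0\<close>, hence \<open>\<tau> < 1\<close>. The quartic identity at
    \<open>n\<close> then becomes \<open>(\<tau> + m) * (2 * m + 2 + \<tau>) * (2 - \<tau>) =
    \<tau>\<^sup>2 * (1 - \<tau>)\<close>, whose left side exceeds \<open>2 \<tau>\<close> and whose
    right side is at most \<open>\<tau>\<close>.\<close>
  define N where "N = b\<^sup>2 + g\<^sup>2 * s\<^sup>2"
  have N: "N = - (\<tau> + m) * z * s" unfolding N_def using g0 b by algebra
  have "- (\<tau> * z)\<^sup>2 * \<tau>\<^sup>2 - \<tau> / 4 * ((\<tau> * g1 + \<tau> * b)\<^sup>2 + (\<tau> * g2 - \<tau> * g * s)\<^sup>2) - ((\<tau> * g1)\<^sup>2 + (\<tau> * g2)\<^sup>2) / 2 + \<tau> * b * (\<tau> * g1) - \<tau> * g * s * (\<tau> * g2)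
      + \<tau>\<^sup>2 * (b\<^sup>2 + g\<^sup>2 * s\<^sup>2) / 2 = - \<tau> * z\<^sup>2 * \<tau>\<^sup>2"
    using arg_cong[OF Q, of "\<lambda>x. x * \<tau>\<^sup>2"] by (simp add: power2_eq_square field_simps)
  then have NN: "N * (1 - \<tau>) * (2 - \<tau>) = \<tau> ^ 3 * z\<^sup>2 * (1 - \<tau>)"
    unfolding g1 g2 N_def by (simp add: field_simps power2_eq_square power3_eq_cube)
  have N1: "N * (1 - \<tau>) = (\<tau> + m) * \<tau> * z\<^sup>2 * (2 * m + 2 + \<tau>)" unfolding N using s by algebra
  have pos': "(\<tau> + m) * \<tau> * z\<^sup>2 * (2 * m + 2 + \<tau>) > 0" using pos by (intro mult_pos_pos) auto
  have "N \<ge> 0" unfolding N_def by simp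
  with N1 pos' have t1: "1 - \<tau> > 0" by (smt (verit) mult_nonneg_nonpos)
  have "((\<tau> + m) * \<tau> * z\<^sup>2 * (2 * m + 2 + \<tau>)) * (2 - \<tau>) = \<tau> ^ 3 * z\<^sup>2 * (1 - \<tau>)" using NN N1 by simp
  then have "\<tau> * z\<^sup>2 * ((\<tau> + m) * (2 * m + 2 + \<tau>) * (2 - \<tau>)) = \<tau> * z\<^sup>2 * (\<tau>\<^sup>2 * (1 - \<tau>))"
    by (simp add: power3_eq_cube power2_eq_square mult_ac)
  then have e: "(\<tau> + m) * (2 * m + 2 + \<tau>) * (2 - \<tau>) = \<tau>\<^sup>2 * (1 - \<tau>)" using pos by simp
  have "\<tau> * 2 * 1 < (\<tau> + m) * (2 * m + 2 + \<tau>) * (2 - \<tau>)" using pos t1 by (intro mult_strict_mono) auto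
  moreover have "\<tau>\<^sup>2 * (1 - \<tau>) \<le> \<tau> * 1 * 1" unfolding power2_eq_square using pos t1 by (intro mult_mono) auto
  ultimately show False using e pos by linarith
qed

text \<open>For \<open>g\<close> nonzero and \<open>p = g\<^sup>2 * s\<close>, the linear relations
  express \<open>b2\<close>, \<open>d2\<close>, \<open>\<kappa>\<close> and
  \<open>g * \<theta>\<close> through \<open>a1\<close>, \<open>p\<close> and \<open>z\<close>.
  Left-symmetry gives \<open>b\<^sup>2 = - (g * s)\<^sup>2\<close> if \<open>b\<close> is not zero;
  if \<open>b = 0\<close> it leaves finitely many ratios of \<open>a1\<close> and \<open>p\<close>
  to \<open>z\<close>, each of them incompatible with the remaining relations.\<close>

lemma plane_contradiction:
  fixes \<tau> z p s b g a1 a2 b2 d2 \<sigma> \<theta> \<kappa> g2 :: real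
  assumes pos: "\<tau> > 0" "z \<noteq> 0" "\<sigma> > 0" and a: "a1 + 2 * b2 - d2 = 2 * z"
    and n: "z * (a1 + g\<^sup>2 * s) = \<tau> * g\<^sup>2 * \<sigma> - \<tau> * z\<^sup>2"
    and nk: "2 * g * s * (1 - \<tau>) * z + \<tau> * z * (g * (\<kappa> - (a1 + g\<^sup>2 * s)) + g * s) = \<tau> * g * \<sigma>"
    and \<kappa>: "\<kappa> = b2 - d2" and \<theta>: "\<kappa> * \<theta> = 0"
    and l1: "2 * b2 - d2 + g\<^sup>2 * s + z + g * \<theta> = 0" and l2: "g * (\<kappa> - d2 + z + a1 + g * \<theta>) = 0"
    and a2: "a2 = - 3 * b * g\<^sup>2" and s: "s * (a1 - z) = b\<^sup>2"
    and lsa1: "\<kappa> * b = b * d2 - a2 * s" and lsa2: "\<kappa> * d2 = b * a2 + d2 * b2 - a1 * d2 + a2 * b"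
  shows False
proof (cases "g = 0")
  case True
  then have "a1 = 3 * z" using a l1 by simp
  then have "z\<^sup>2 * (3 + \<tau>) = 0" using n True by (simp add: power2_eq_square algebra_simps)
  then show False using pos by simp
next
  case g: False
  define p where "p = g\<^sup>2 * s"
  have l2': "\<kappa> - d2 + z + a1 + g * \<theta> = 0" using l2 g by simp
  have b2: "b2 = (2 * z - p) / 3" and d2: "d2 = (3 * a1 - 2 * p - 2 * z) / 3"
    using l1 l2' a unfolding \<kappa> p_def[symmetric] by (simp_all add: field_simps)
  have k: "\<kappa> = (4 * z + p) / 3 - a1" unfolding \<kappa> b2 d2 by (simp add: field_simps)
  have t: "g * \<theta> = a1 - p - 3 * z" using l1 unfolding p_def[symmetric] b2 d2 by (simp add: field_simps)
  have kt: "\<kappa> = 0 \<or> a1 - p - 3 * z = 0" using \<theta> t by (metis mult_eq_0_iff mult_zero_right)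
  show False
  proof (cases "b = 0")
    case False
    have "b * (\<kappa> - d2 - 3 * p) = 0" using lsa1 unfolding a2 p_def by (simp add: algebra_simps)
    then have "\<kappa> - d2 - 3 * p = 0" using False by simp
    then have "p = z - a1" unfolding k d2 by (simp add: field_simps)
    then have "b\<^sup>2 = - (g * s)\<^sup>2" using s unfolding p_def by algebra
    then show False using False by (smt (verit) zero_le_power2 power2_eq_iff zero_eq_power2)
  next
    case b: True
    have "d2 * (d2 - a1) = 0" using lsa2 b a2 unfolding \<kappa> by (auto simp: algebra_simps)
    then have "d2 = 0 \<or> d2 - a1 = 0" by simp
    then have d: "3 * a1 - 2 * p - 2 * z = 0 \<or> p = - z" unfolding d2 by (auto simp: field_simps)
    have "s = 0 \<or> a1 = z" using s b by simp
    then show False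
    proof
      assume "s = 0"
      then have "p = 0" by (simp add: p_def)
      with d kt k pos show False by (auto simp: field_simps)
    next
      assume a1: "a1 = z"
      with d have "p = z / 2 \<or> p = - z" by auto
      then show False
      proof
        assume "p = z / 2" then show False using kt pos unfolding k a1 by simp
      next
        assume p: "p = - z"
        have n': "\<tau> * (g\<^sup>2 * \<sigma>) = \<tau> * z\<^sup>2" using n unfolding p_def[symmetric] p a1 by simp
        have k0: "\<kappa> = 0" unfolding k p a1 by simp
        have "g * (s * (2 - \<tau>) * z) = g * (\<tau> * \<sigma>)" using nk unfolding p_def[symmetric] p a1 k0 by (simp add: algebra_simps)
        then have "s * (2 - \<tau>) * z = \<tau> * \<sigma>" using g by simp
        then have "p * (2 - \<tau>) * z = \<tau> * z\<^sup>2" using n' unfolding p_def by algebra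
        then have "z\<^sup>2 = 0" unfolding p by algebra
        then show False using pos by simp
      qed
    qed
  qed
qed

context totally_real_scalar begin

text \<open>For such a \<open>v\<close> all components in \<open>I\<close> drop out of the mixed
  identities, and \<open>|v|^2\<close> can be cancelled: equations between structure constants alone
  remain.\<close>

lemma large_orthogonal: assumes v: "v \<in> I" "v \<noteq> 0" and u: "v \<bullet> ukk = 0" "J v \<bullet> ukk = 0" shows False
proof -
  have V: "v \<bullet> v \<noteq> 0" "z * (v \<bullet> v) \<noteq> 0" using v z_ne by simp_all
  have "z * (v \<bullet> v) * (g0 + \<tau> * z) = 0" using mixed_n[OF v(1)] u by (simp add: power2_eq_square algebra_simps)
  then have g0: "g0 = - \<tau> * z" using V by simp
  have "z * (v \<bullet> v) * (\<tau> * (2 * b2 - d2 - \<gamma>\<^sup>2 * s1) - (\<tau> - 1) * s1 + 2 * \<tau> * z) = 0"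
    using mixed_k[OF v(1)] u by (simp add: power2_eq_square algebra_simps)
  then have k: "\<tau> * (2 * b2 - d2 - \<gamma>\<^sup>2 * s1) - (\<tau> - 1) * s1 + 2 * \<tau> * z = 0" using V by simp
  have "z * (v \<bullet> v) * (2 * \<gamma> * s1 * (1 - \<tau>) + \<tau> * (g2 + \<gamma> * s1)) = 0"
    using mixed_n_k[OF v(1)] u by (simp add: power2_eq_square algebra_simps)
  then have nk: "2 * \<gamma> * s1 * (1 - \<tau>) + \<tau> * (g2 + \<gamma> * s1) = 0" using V by simp
  show False
  proof (rule large_orthogonal_contradiction[OF tau_pos z_ne m_pos _ _ mixed_n_Jk _ _ lsa_s])
    show "a1 + \<gamma>\<^sup>2 * s1 = - \<tau> * z" using g0 by (simp add: g0_def)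
    then show "s1 * (1 - \<tau>) = - \<tau> * z * (2 * m + 2 + \<tau>)" using k a_eq by algebra
    show "\<tau> * g2 = - \<gamma> * s1 * (2 - \<tau>)" using nk by algebra
    show "- (\<tau> * z)\<^sup>2 - \<tau> / 4 * ((g1 + b1)\<^sup>2 + (g2 - \<gamma> * s1)\<^sup>2) - (g1\<^sup>2 + g2\<^sup>2) / 2 + b1 * g1 - \<gamma> * s1 * g2
      + (b1\<^sup>2 + \<gamma>\<^sup>2 * s1\<^sup>2) / 2 = - \<tau> * z\<^sup>2" using Q_n unfolding g0 by simp
  qed
qed

text \<open>By \<open>large_orthogonal\<close>, \<open>I\<close> is the complex line through
  \<open>ukk\<close>, so \<open>m = 1\<close> and the actions \<open>C1\<close>, \<open>Ck\<close>
  are given by the numbers \<open>z\<close>, \<open>\<theta>1\<close>, \<open>\<theta>\<close>.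
  Pairing \<open>lsa_u\<close> and \<open>rep\<close> with \<open>u\<close> and \<open>J u\<close>
  supplies the equations of \<open>plane_contradiction\<close>.\<close>

lemma impossible: False
proof -
  define u where "u = ukk"
  define \<sigma> where "\<sigma> = u \<bullet> u"
  have uI: "u \<in> I" "J u \<in> I" unfolding u_def by (simp_all add: J_I)
  obtain v where v: "v \<in> I" "v \<noteq> 0" by (rule ex_v)
  have "u \<noteq> 0" using large_orthogonal[OF v] by (auto simp: u_def)
  then have \<sigma>: "\<sigma> > 0" by (simp add: \<sigma>_def)
  have uJu: "u \<bullet> J u = 0" "J u \<bullet> u = 0" "J u \<bullet> J u = \<sigma>" using J_skew[of u u] by (simp_all add: inner_commute \<sigma>_def)
  have plane: "w = ((w \<bullet> u) / \<sigma>) *\<^sub>R u + ((w \<bullet> J u) / \<sigma>) *\<^sub>R J u" if w: "w \<in> I" for w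
  proof -
    define r where "r = w - ((w \<bullet> u) / \<sigma>) *\<^sub>R u - ((w \<bullet> J u) / \<sigma>) *\<^sub>R J u"
    have r: "r \<bullet> u = 0" "r \<bullet> J u = 0" unfolding r_def using \<sigma> uJu by (simp_all add: inner_diff_left \<sigma>_def)
    have "J r \<bullet> u = 0" using r(2) J_skew[of r u] by simp
    moreover have "r \<in> I" unfolding r_def by (intro I_closed w uI)
    ultimately have "r = 0" using large_orthogonal[of r] r(1) by (auto simp: u_def)
    then show ?thesis by (simp add: r_def algebra_simps)
  qed
  have "P = (\<lambda>x. (x \<bullet> ((1 / \<sigma>) *\<^sub>R u)) *\<^sub>R u + (x \<bullet> ((1 / \<sigma>) *\<^sub>R J u)) *\<^sub>R J u)"
    by (rule ext, subst plane[OF P_I]) (use uI in \<open>simp add: P_sym\<close>)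
  then have "linear_trace P = linear_trace (\<lambda>x. (x \<bullet> ((1 / \<sigma>) *\<^sub>R u)) *\<^sub>R u + (x \<bullet> ((1 / \<sigma>) *\<^sub>R J u)) *\<^sub>R J u)" by simp
  also have "\<dots> = 2" unfolding linear_trace_add linear_trace_rank1 using \<sigma> uJu by (simp add: \<sigma>_def)
  finally have m: "m = 1" by (simp add: m_def)
  define \<theta>1 where "\<theta>1 = C1 u \<bullet> J u / \<sigma>" define \<theta> where "\<theta> = Ck u \<bullet> J u / \<sigma>"
  have "C1 u \<bullet> u = - z * \<sigma>" "Ck u \<bullet> u = 0"
    using C1_scalar[OF uI(1) uI(1)] Ck_skew[OF uI(1) uI(1)] inner_commute[of u "C1 u"] inner_commute[of u "Ck u"] by (simp_all add: \<sigma>_def)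
  then have C1u: "C1 u = - z *\<^sub>R u + \<theta>1 *\<^sub>R J u" and Cku: "Ck u = \<theta> *\<^sub>R J u"
    using plane[of "C1 u"] plane[of "Ck u"] \<sigma> by (simp_all add: \<theta>1_def \<theta>_def)
  have u_vals: "u1k = (- \<gamma>) *\<^sub>R J u" "uk1 = (- \<gamma>) *\<^sub>R J u" "u11 = (- \<gamma>\<^sup>2) *\<^sub>R u" "ukk = u"
    unfolding u_def by (simp_all add: u_eqs)
  have uu: "u \<bullet> u = \<sigma>" by (simp add: \<sigma>_def)
  have \<sigma>2: "\<sigma> \<noteq> 0" using \<sigma> by simp
  note i = inner_add_left inner_diff_left inner_scaleR_left inner_minus_left uu uJu Js JJ u_vals d1_eq s2_eq Cs C_J C1u Cku
  have "\<sigma> * (a2 + b1 * \<gamma>\<^sup>2 - \<gamma> * \<theta>1) = 0"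
    using arg_cong[OF lsa_u(1), of "\<lambda>x. x \<bullet> u"] unfolding i by algebra
  moreover have "\<sigma> * (\<gamma> * (b2 - d2 - d2 + z + a1 + \<gamma> * \<theta>)) = 0"
    using arg_cong[OF lsa_u(1), of "\<lambda>x. x \<bullet> J u"] unfolding i by algebra
  moreover have "\<sigma> * (2 * b2 - d2 + \<gamma>\<^sup>2 * s1 + z + \<gamma> * \<theta>) = 0"
    using arg_cong[OF lsa_u(2), of "\<lambda>x. x \<bullet> u"] unfolding i by algebra
  moreover have "\<sigma> * (- 2 * b1 * \<gamma> - \<theta>1) = 0"
    using arg_cong[OF lsa_u(2), of "\<lambda>x. x \<bullet> J u"] unfolding i by algebra
  moreover have "\<sigma> * ((b2 - d2) * \<theta>) = 0"
    using arg_cong[OF rep[of u], of "\<lambda>x. x \<bullet> J u"] unfolding i by algebra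
  ultimately have vec: "a2 + b1 * \<gamma>\<^sup>2 - \<gamma> * \<theta>1 = 0" "\<gamma> * (b2 - d2 - d2 + z + a1 + \<gamma> * \<theta>) = 0"
    "2 * b2 - d2 + \<gamma>\<^sup>2 * s1 + z + \<gamma> * \<theta> = 0" "- 2 * b1 * \<gamma> - \<theta>1 = 0" "(b2 - d2) * \<theta> = 0" using \<sigma>2 by (simp_all only: mult_eq_0_iff) auto
  have n: "z * (a1 + \<gamma>\<^sup>2 * s1) * \<sigma> = (\<tau> * \<gamma>\<^sup>2 * \<sigma> - \<tau> * z\<^sup>2) * \<sigma>"
    using mixed_n[OF uI(1)] unfolding u_vals uu uJu g0_def by (simp add: power2_eq_square algebra_simps)
  have nk: "(2 * \<gamma> * s1 * (1 - \<tau>) * z + \<tau> * z * (\<gamma> * (b2 - d2 - (a1 + \<gamma>\<^sup>2 * s1)) + \<gamma> * s1)) * \<sigma> = \<tau> * \<gamma> * \<sigma> * \<sigma>"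
    using mixed_n_k[OF uI(1)] unfolding u_vals uu uJu g2_def g0_def by (simp add: power2_eq_square algebra_simps)
  show False
  proof (rule plane_contradiction[OF tau_pos z_ne \<sigma>, of a1 b2 d2 \<gamma> s1 "b2 - d2" \<theta> a2 b1])
    show "a1 + 2 * b2 - d2 = 2 * z" using a_eq m by simp
    show "z * (a1 + \<gamma>\<^sup>2 * s1) = \<tau> * \<gamma>\<^sup>2 * \<sigma> - \<tau> * z\<^sup>2" using n \<sigma>2 by simp
    show "2 * \<gamma> * s1 * (1 - \<tau>) * z + \<tau> * z * (\<gamma> * (b2 - d2 - (a1 + \<gamma>\<^sup>2 * s1)) + \<gamma> * s1) = \<tau> * \<gamma> * \<sigma>" using nk \<sigma>2 by simp
    show "(b2 - d2) * \<theta> = 0" by (rule vec)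
    show "2 * b2 - d2 + \<gamma>\<^sup>2 * s1 + z + \<gamma> * \<theta> = 0" by (rule vec)
    show "\<gamma> * (b2 - d2 - d2 + z + a1 + \<gamma> * \<theta>) = 0" by (rule vec)
    show "a2 = - 3 * b1 * \<gamma>\<^sup>2" using vec(1,4) by algebra
    show "s1 * (a1 - z) = b1\<^sup>2" using lsa_s m by simp
    show "(b2 - d2) * b1 = b1 * d2 - a2 * s1" using lsa_coeffs(1) unfolding d1_eq by algebra
    show "(b2 - d2) * d2 = b1 * a2 + d2 * b2 - a1 * d2 + a2 * b1" using lsa_coeffs(2) unfolding d1_eq s2_eq by algebra
  qed simp
qed

end

section \<open>Vanishing of c and the traces of the action on I\<close>

context totally_real begin

lemma trace_I: assumes "linear g" "\<And>x. g (P x) \<in> I"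
  shows "linear_trace (\<lambda>x. g (P x)) = (\<Sum>b\<in>Basis. g (P b) \<bullet> P b)"
  unfolding linear_trace_def using assms(2) by (simp add: P_sym[symmetric])

text \<open>\<open>Q_I\<close> gives \<open>c <= 0\<close>. If \<open>c < 0\<close>, the symmetric
  parts of \<open>C1\<close> and \<open>Ck\<close> are scalars by \<open>scalar_forms\<close>, and
  \<open>Tk = 0\<close> makes the second scalar zero; this is the situation excluded by
  \<open>impossible\<close>.\<close>

lemma c_zero:
  assumes ne: "I \<noteq> {0}" and Tk: "Tk = 0"
  shows "c = 0"
proof (rule antisym)
  obtain v where v: "v \<in> I" "v \<noteq> 0" using ne subspace_0[OF sub] by blast
  have "c * (v \<bullet> v)\<^sup>2 \<le> 0" unfolding Q_I[OF v(1), symmetric] using tau_nonneg by (simp add: mult_nonneg_nonneg)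
  then show "c \<le> 0" using v by (simp add: mult_le_0_iff)
  show "c \<ge> 0"
  proof (rule ccontr)
    assume "\<not> c \<ge> 0"
    then have c: "c < 0" by simp
    \<comment> \<open>Rescaling \<open>Ck\<close> by \<open>\<rho>\<close> absorbs the factor
      \<open>1 + \<gamma>\<^sup>2\<close> of \<open>Q_I\<close>, since \<open>quartic_forms\<close>
      weights \<open>p\<close> and \<open>q\<close> equally.\<close>
    define \<rho> where "\<rho> = sqrt (1 + \<gamma>\<^sup>2)"
    have "1 + \<gamma>\<^sup>2 > 0" by (simp add: add_pos_nonneg)
    then have \<rho>: "\<rho>\<^sup>2 = 1 + \<gamma>\<^sup>2" "\<rho> \<noteq> 0" by (simp_all add: \<rho>_def)
    define p q where "p = sc C1" and "q x = \<rho> *\<^sub>R sc Ck x" for x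
    have lin: "linear p" "linear (sc Ck)" "linear q" unfolding p_def q_def[abs_def]
      using linear_sc linear_C by (auto intro: linear_compose_scale_right)
    have f2: "sc g x \<bullet> y = (g x \<bullet> y + x \<bullet> g y) / 2" if g: "linear g" "\<And>x. g (J x) = J (g x)" for g x y
      unfolding sc_def using adj1[OF g(1), of x y] adj1[OF g(1), of "J x" "J y"] J_skew[of "adjoint g (J x)" y]
      by (simp add: inner_add_left inner_diff_left g(2) J_skew inner_commute[of x])
    have form: "p x \<bullet> y = (C1 x \<bullet> y + x \<bullet> C1 y) / 2" "sc Ck x \<bullet> y = (Ck x \<bullet> y + x \<bullet> Ck y) / 2" for x y
      unfolding p_def by (simp_all add: f2 linear_C)
    have inI: "g x \<in> I" if g: "\<And>y. g x \<bullet> y = (h x \<bullet> y + x \<bullet> h y) / 2" "h x \<in> I" "\<And>y. h (P y) = h y" "x \<in> I" for g h x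
    proof -
      have "P (g x) \<bullet> y = g x \<bullet> y" for y
      proof -
        have "h x \<bullet> P y = h x \<bullet> y" using P_sym[of "h x" y] P_id[OF g(2)] by simp
        then show ?thesis unfolding P_sym[of "g x"] g(1) g(3) by simp
      qed
      then have "P (g x) = g x" by (metis vector_eq_rdot)
      then show ?thesis using P_I by metis
    qed
    have maps: "x \<in> I \<Longrightarrow> p x \<in> I" "x \<in> I \<Longrightarrow> sc Ck x \<in> I" for x
      using inI[of p x C1] inI[of "sc Ck" x Ck] by (simp_all add: form)
    have lin0: "linear (\<lambda>x::'a. 0::'a)" by (auto intro: linearI)
    have psym: "p x \<bullet> y = x \<bullet> p y" "q x \<bullet> y = x \<bullet> q y" "p (J x) = J (p x)" "q (J x) = J (q x)" for x y
      by (simp_all add: p_def q_def sc_sym linear_C sc_J)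
    have qf: "quartic_forms br J I p q (\<lambda>x. 0) \<tau> c"
    proof (intro quartic_forms.intro quartic_forms_axioms.intro)
      show "- \<tau> * ((p v \<bullet> v)\<^sup>2 + (q v \<bullet> v)\<^sup>2) + 2 * ((0 \<bullet> v)\<^sup>2 + (J 0 \<bullet> v)\<^sup>2) = c * (v \<bullet> v)\<^sup>2" if "v \<in> I" for v
      proof -
        have "p v \<bullet> v = C1 v \<bullet> v" "q v \<bullet> v = \<rho> * (Ck v \<bullet> v)"
          using form[of v v] inner_commute[of v "C1 v"] inner_commute[of v "Ck v"] by (simp_all add: q_def)
        then show ?thesis using Q_I[OF that] \<rho>(1) by (simp add: power_mult_distrib)
      qed
      show "linear p" "linear q" "linear (\<lambda>x::'a. 0::'a)" by (fact lin lin0)+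
      show "q u \<in> I" if "u \<in> I" for u unfolding q_def by (intro I_closed maps that)
    qed (fact sub tau_nonneg hermitian_lie_axioms psym | erule J_I maps | simp)+
    obtain \<alpha> \<beta> where p: "\<And>v. v \<in> I \<Longrightarrow> p v = \<alpha> *\<^sub>R v" and q: "\<And>v. v \<in> I \<Longrightarrow> q v = \<beta> *\<^sub>R v"
      and "\<tau> * (\<alpha>\<^sup>2 + \<beta>\<^sup>2) = - c"
      using quartic_forms.scalar_forms[OF qf c refl v] by metis
    have q': "sc Ck v = (\<beta> / \<rho>) *\<^sub>R v" if "v \<in> I" for v
    proof -
      have "sc Ck v = (1 / \<rho>) *\<^sub>R q v" using \<rho>(2) by (simp add: q_def)
      then show ?thesis using q[OF that] by simp
    qed
    have "Tk = (\<Sum>b\<in>Basis. Ck (P b) \<bullet> P b)" using trace_I[OF linear_C(2)] by (simp add: Tk_def)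
    also have "\<dots> = (\<Sum>b\<in>Basis. sc Ck (P b) \<bullet> P b)"
    proof (rule sum.cong[OF refl])
      show "Ck (P b) \<bullet> P b = sc Ck (P b) \<bullet> P b" for b
        using form(2)[of "P b" "P b"] inner_commute[of "P b" "Ck (P b)"] by simp
    qed
    also have "\<dots> = \<beta> / \<rho> * linear_trace P" unfolding trace_P_eq by (simp add: q' sum_distrib_left)
    finally have "\<beta> = 0" using Tk trace_P_pos[OF ne] \<rho>(2) by simp
    interpret totally_real_scalar br J I n k \<gamma> \<tau> c "- \<alpha>"
    proof
      fix v w assume vw: "v \<in> I" "w \<in> I"
      show "C1 v \<bullet> w + v \<bullet> C1 w = - 2 * - \<alpha> * (v \<bullet> w)" using form(1)[of v w] p[OF vw(1)] by simp
      show "Ck v \<bullet> w + v \<bullet> Ck w = 0" using form(2)[of v w] unfolding q'[OF vw(1)] \<open>\<beta> = 0\<close> by simp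
    qed (fact c ne)+
    show False by (rule impossible)
  qed
qed

text \<open>\<open>Q_even\<close> for \<open>x\<close> in the span of \<open>f\<close> and
  \<open>k\<close>. As \<open>x\<close> commutes with \<open>I\<close>, only the action of
  \<open>J x\<close> enters, through the difference of the norms of its transpose and itself. The
  other components contribute squares, and \<open>\<tau> = 0\<close> removes the negative
  ones.\<close>

lemma F_mixed:
  assumes \<tau>: "\<tau> = 0" and c: "c = 0" and x: "x = \<alpha> *\<^sub>R f + \<beta> *\<^sub>R k" and v: "v \<in> I"
  shows "(P (S (J x) v) \<bullet> P (S (J x) v) - br (J x) v \<bullet> br (J x) v) / 2
     + (\<Sum>w\<in>{n, J n, k, J k}. ((v \<bullet> br x w - J v \<bullet> br (J x) w)\<^sup>2 + (v \<bullet> br (J x) w + J v \<bullet> br x w)\<^sup>2) / 4)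
     = (br (J x) x \<bullet> J n) * (C1 v \<bullet> v) + (br (J x) x \<bullet> k) * (Ck v \<bullet> v)"
proof -
  have Jv: "J v \<in> I" using v by (rule J_I)
  have brxI: "br x u = 0" "br u x = 0" if "u \<in> I" for u using that by (simp_all add: x)
  define C where "C = br (J x) v"
  define Ct where "Ct = P (S (J x) v)"
  have CI: "C \<in> I" "Ct \<in> I" unfolding C_def Ct_def using ideal[OF v] by simp_all
  have PS: "P (S x u) = 0" if "u \<in> I" for u
  proof (rule vector_eq_rdot[THEN iffD1], rule allI)
    show "P (S x u) \<bullet> w = 0 \<bullet> w" for w by (simp add: P_sym S_inner brxI)
  qed
  have brJu: "br (J x) (J u) = J (br (J x) u)" if "u \<in> I" for u
    using integrable[of x u] brxI(1)[OF that] brxI(1)[OF J_I[OF that]] by (simp add: eq_neg_iff_add_eq_0 algebra_simps)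
  have PSJ: "P (S (J x) (J v)) = J Ct"
  proof (rule vector_eq_rdot[THEN iffD1], rule allI)
    fix w
    show "P (S (J x) (J v)) \<bullet> w = J Ct \<bullet> w"
      unfolding Ct_def using brJu[of "P w"] by (simp add: P_sym S_inner J_skew P_J)
  qed
  define o1 o2 o3 o4 where "o1 = S x v" and "o2 = S (J x) (J v) - J Ct" and "o3 = S (J x) v - Ct" and "o4 = S x (J v)"
  have Po: "P o1 = 0" "P o2 = 0" "P o3 = 0" "P o4 = 0"
    unfolding o1_def o2_def o3_def o4_def by (simp_all add: PS v Jv PSJ J_I CI) (simp add: Ct_def)
  have oI: "u \<bullet> w = 0" if "u \<in> I" "P w = 0" for u w using that by (metis P_id P_sym inner_zero_right)
  have Sv0: "S v x = 0" "S v (J x) = 0" "S (J v) x = 0" "S (J v) (J x) = 0"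
    using S_I_orth[OF v] S_I_orth[OF Jv] oI by (simp_all add: x J_I)
  have m: "S x v + S v x = 0 + o1" "S (J x) (J v) + S (J v) (J x) = J Ct + o2"
    "S (J x) v + S (J v) x = Ct + o3" "S x (J v) + S v (J x) = J 0 + o4" "br x (J v) + br v (J x) = (J 0 - C) + 0"
    by (simp_all add: o1_def o2_def o3_def o4_def Sv0 brxI Jv C_def br_anti[of v])
  have o: "o1 \<bullet> w = v \<bullet> br x w" "o2 \<bullet> w = J v \<bullet> br (J x) w" "o3 \<bullet> w = v \<bullet> br (J x) w" "o4 \<bullet> w = J v \<bullet> br x w" if "w \<in> {n, J n, k, J k}" for w
  proof -
    have "Ct \<bullet> w = 0" "J Ct \<bullet> w = 0" using that CI J_I[OF CI(2)] by auto
    then show "o1 \<bullet> w = v \<bullet> br x w" "o2 \<bullet> w = J v \<bullet> br (J x) w" "o3 \<bullet> w = v \<bullet> br (J x) w" "o4 \<bullet> w = J v \<bullet> br x w"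
      unfolding o1_def o2_def o3_def o4_def inner_diff_left by (simp_all add: S_inner)
  qed
  define \<Sigma> where "\<Sigma> = (\<Sum>w\<in>{n, J n, k, J k}. ((v \<bullet> br x w - J v \<bullet> br (J x) w)\<^sup>2 + (v \<bullet> br (J x) w + J v \<bullet> br x w)\<^sup>2) / 4)"
  have dist: "n \<noteq> J n" "n \<noteq> k" "n \<noteq> J k" "J n \<noteq> k" "J n \<noteq> J k" "k \<noteq> J k"
  proof -
    have "u \<noteq> w" if "u \<bullet> u = 1" "u \<bullet> w = 0" for u w :: 'a using that by auto
    then show "n \<noteq> J n" "n \<noteq> k" "n \<noteq> J k" "J n \<noteq> k" "J n \<noteq> J k" "k \<noteq> J k" by simp_all
  qed
  have sumw: "(\<Sum>w\<in>{n, J n, k, J k}. F w) = F n + F (J n) + F k + F (J k)" for F :: "'a \<Rightarrow> real"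
    using dist by simp
  have e1: "(o1 - o2) \<bullet> (o1 - o2) + (o3 + o4) \<bullet> (o3 + o4) = 4 * \<Sigma>"
    unfolding inner_expand[of "o1 - o2" "o1 - o2"] inner_expand[of "o3 + o4" "o3 + o4"]
    by (simp add: Po \<Sigma>_def sumw inner_diff_left inner_add_left o power2_eq_square field_simps)
  have e2: "Phi 0 o1 o2 o3 o4 0 = \<Sigma>"
  proof -
    have iso': "(0 + J (o1 + o2)) \<bullet> (0 + J (o1 + o2)) = (o1 + o2) \<bullet> (o1 + o2)" by (simp only: add_0 iso)
    have "(o1 - o2) \<bullet> (o1 - o2) = (o1 + o2) \<bullet> (o1 + o2) - 4 * (o1 \<bullet> o2)"
      by (simp add: inner_add_left inner_add_right inner_diff_left inner_diff_right inner_commute[of o2 o1])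
    then show ?thesis using e1 unfolding Phi_def iso' by simp
  qed
  have Phi: "Phi \<tau> (S x v + S v x) (S (J x) (J v) + S (J v) (J x)) (S (J x) v + S (J v) x) (S x (J v) + S v (J x)) (br x (J v) + br v (J x))
     = (Ct \<bullet> Ct - C \<bullet> C) / 2 + \<Sigma>"
  proof -
    have z: "Psi 0 0 (J Ct) Ct (J 0) (J 0 - C) o1 o2 o3 o4 0 = 0"
      by (rule Psi_orth_subspace[OF sub J_I]) (use CI oI Po in \<open>simp_all add: I_closed\<close>)
    have "Phi 0 0 (J Ct) Ct (J 0) (J 0 - C) = (Ct \<bullet> Ct - C \<bullet> C) / 2"
      unfolding Phi_normal by simp
    then show ?thesis unfolding m Phi_add \<tau> z e2 by simp
  qed
  have Sv: "S (J v) (J v) = S v v" "S (J v) v = - S v (J v)" "br v (J v) = 0"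
  proof -
    have J: "J v \<bullet> J (C1 v) = v \<bullet> C1 v" "J v \<bullet> J (Ck v) = v \<bullet> Ck v" "v \<bullet> J (C1 v) = - (J v \<bullet> C1 v)" "v \<bullet> J (Ck v) = - (J v \<bullet> Ck v)"
      by (simp_all add: J_skew[of v])
    show "S (J v) (J v) = S v v" "S (J v) v = - S v (J v)"
      unfolding S_II[OF v v] S_II[OF v Jv] S_II[OF Jv v] S_II[OF Jv Jv] C_J J by (simp_all add: algebra_simps)
    show "br v (J v) = 0" by (rule abelian[OF v Jv])
  qed
  have y: "br (J x) x = (br (J x) x \<bullet> J n) *\<^sub>R f + (br (J x) x \<bullet> k) *\<^sub>R k + P (br (J x) x)"
  proof -
    have "br (J x) x = \<alpha> *\<^sub>R br (J x) f + \<beta> *\<^sub>R br (J x) k" by (subst (2) x) simp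
    also have "\<dots> = \<alpha> *\<^sub>R ((br (J x) f \<bullet> J n) *\<^sub>R f + (br (J x) f \<bullet> k) *\<^sub>R k + P (br (J x) f))
      + \<beta> *\<^sub>R ((br (J x) k \<bullet> J n) *\<^sub>R f + (br (J x) k \<bullet> k) *\<^sub>R k + P (br (J x) k))"
      using F_decomp[of f "J x"] F_decomp[of k "J x"] by simp
    finally have e: "br (J x) x = (\<alpha> * (br (J x) f \<bullet> J n) + \<beta> * (br (J x) k \<bullet> J n)) *\<^sub>R f
       + (\<alpha> * (br (J x) f \<bullet> k) + \<beta> * (br (J x) k \<bullet> k)) *\<^sub>R k + (\<alpha> *\<^sub>R P (br (J x) f) + \<beta> *\<^sub>R P (br (J x) k))" (is "_ = ?g *\<^sub>R f + ?h *\<^sub>R k + ?u")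
      by (simp add: algebra_simps)
    have "?u \<in> I" by (intro I_closed P_I)
    then have "br (J x) x \<bullet> J n = ?g" "br (J x) x \<bullet> k = ?h" "P (br (J x) x) = ?u"
      unfolding e by (simp_all add: inner_add_left)
    then show ?thesis using e by simp
  qed
  define g h u where "g = br (J x) x \<bullet> J n" and "h = br (J x) x \<bullet> k" and "u = P (br (J x) x)"
  have y': "br x (J x) = - (g *\<^sub>R f + h *\<^sub>R k + u)" "u \<in> I" using y by (simp_all add: br_anti[of x "J x"] g_def h_def u_def)
  have "br v (br x (J x)) = 0" using y'(2) v by (simp add: y'(1) abelian)
  then have SJ: "S v (J v) \<bullet> br x (J x) = 0" by (simp add: S_inner)
  have SvI: "S v v \<bullet> w = 0" "J (S v v) \<bullet> w = 0" if "w \<in> I" for w unfolding S_II[OF v v] using that J_I[OF that]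
    by (simp_all add: inner_add_left inner_diff_left J_skew)
  have JN: "J (S v v) \<bullet> br x (J x) = - (g * (C1 v \<bullet> v) + h * (Ck v \<bullet> v))"
    unfolding y'(1) inner_minus_right inner_add_right SvI[OF y'(2)] unfolding S_II[OF v v]
    using inner_commute[of v "C1 v"] inner_commute[of v "Ck v"] by (simp add: inner_add_left inner_diff_left algebra_simps)
  have Psi: "Psi \<tau> (S x x) (S (J x) (J x)) (S (J x) x) (S x (J x)) (br x (J x))
        (S v v) (S (J v) (J v)) (S (J v) v) (S v (J v)) (br v (J v)) = J (S v v) \<bullet> br x (J x)"
  proof -
    have "(br x (J x) + J (S x x + S (J x) (J x))) \<bullet> J (S v v) = br x (J x) \<bullet> J (S v v) + (S x x + S (J x) (J x)) \<bullet> S v v"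
      by (simp add: inner_add_left)
    then show ?thesis unfolding Psi_def Sv \<tau> using SJ inner_commute[of "br x (J x)" "J (S v v)"] inner_commute[of "S (J x) (J x)" "S v v"]
      by (simp add: inner_add_left inner_add_right field_simps)
  qed
  have "x \<bullet> v = 0" using v by (simp add: x inner_add_left)
  from Q_even[OF Qc this] show ?thesis unfolding Phi Psi JN c g_def h_def \<Sigma>_def[symmetric] C_def Ct_def by simp
qed

text \<open>An operator and its transpose have equal Hilbert-Schmidt norm, so the difference in
  \<open>F_mixed\<close> sums to zero. A sum of squares is left, which gives the right-hand side a
  sign.\<close>

lemma F_trace:
  assumes \<tau>: "\<tau> = 0" and c: "c = 0" and x: "x = \<alpha> *\<^sub>R f + \<beta> *\<^sub>R k"
  shows "(\<Sum>b\<in>Basis. \<Sum>w\<in>{n, J n, k, J k}. ((P b \<bullet> br x w - J (P b) \<bullet> br (J x) w)\<^sup>2 + (P b \<bullet> br (J x) w + J (P b) \<bullet> br x w)\<^sup>2) / 4)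
     = (br (J x) x \<bullet> J n) * T1 + (br (J x) x \<bullet> k) * Tk"
proof -
  define C where "C u = br (J x) (P u)" for u
  define Ct where "Ct u = P (S (J x) (P u))" for u
  have lin: "linear C" "linear Ct" unfolding C_def[abs_def] Ct_def[abs_def] by (auto intro!: linearI)
  have C_I: "C u \<in> I" "Ct u \<in> I" for u by (simp_all add: C_def Ct_def ideal)
  have adj: "Ct u \<bullet> w = u \<bullet> C w" for u w
  proof -
    have "Ct u \<bullet> w = P u \<bullet> C w" unfolding Ct_def C_def by (subst P_sym) (rule S_inner)
    also have "\<dots> = u \<bullet> C w" using C_I by (simp add: P_sym)
    finally show ?thesis .
  qed
  have "(\<Sum>b\<in>Basis. Ct b \<bullet> Ct b) = linear_trace (\<lambda>u. C (Ct u))" unfolding linear_trace_def by (simp add: adj inner_commute)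
  also have "\<dots> = linear_trace (\<lambda>u. Ct (C u))" by (rule linear_trace_compose[OF lin])
  also have "\<dots> = (\<Sum>b\<in>Basis. C b \<bullet> C b)" unfolding linear_trace_def by (simp add: adj)
  finally have "(\<Sum>b\<in>Basis. (Ct b \<bullet> Ct b - C b \<bullet> C b) / 2) = 0" by (simp add: sum_subtractf flip: sum_divide_distrib)
  moreover have "T1 = (\<Sum>b\<in>Basis. C1 (P b) \<bullet> P b)" "Tk = (\<Sum>b\<in>Basis. Ck (P b) \<bullet> P b)"
    using trace_I[OF linear_C(1)] trace_I[OF linear_C(2)] by (simp_all add: T1_def Tk_def)
  moreover have "(\<Sum>b\<in>Basis. (Ct b \<bullet> Ct b - C b \<bullet> C b) / 2 + (\<Sum>w\<in>{n, J n, k, J k}. ((P b \<bullet> br x w - J (P b) \<bullet> br (J x) w)\<^sup>2 + (P b \<bullet> br (J x) w + J (P b) \<bullet> br x w)\<^sup>2) / 4))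
     = (\<Sum>b\<in>Basis. (br (J x) x \<bullet> J n) * (C1 (P b) \<bullet> P b) + (br (J x) x \<bullet> k) * (Ck (P b) \<bullet> P b))"
    unfolding C_def Ct_def by (intro sum.cong refl F_mixed[OF \<tau> c x] P_I)
  ultimately show ?thesis by (simp only: sum.distrib sum_distrib_left)
qed

text \<open>Under these equations \<open>k\<close> and \<open>J k\<close> can be adjoined to
  \<open>I\<close>: they commute with \<open>I\<close> and with each other, and brackets with them
  have no component along \<open>n\<close> or \<open>J n\<close>.\<close>

lemma larger_complex_ideal:
  assumes z: "b1 = 0" "d1 = 0" "s1 = 0" "s2 = 0" "ukk = 0" "\<And>x. Ck x = 0"
  shows "complex_ideal br J {x. x \<bullet> n = 0 \<and> x \<bullet> J n = 0} n \<tau> c"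
proof
  have brk: "br y k \<bullet> n = 0" "br y k \<bullet> J n = 0" for y
  proof -
    have e: "br y k = (y \<bullet> n) *\<^sub>R br n k + (y \<bullet> J n) *\<^sub>R br (J n) k + (y \<bullet> J k) *\<^sub>R br (J k) k"
      by (subst (1) split[of y]) (simp add: brs)
    have "br n k = - (b2 *\<^sub>R k + u1k)" "br (J n) k = 0" "br (J k) k = 0"
      unfolding br_anti[of n k] br_anti[of "J n" k] br_anti[of "J k" k] br_k_n br_k_Jn br_k_Jk z by simp_all
    then show "br y k \<bullet> n = 0" "br y k \<bullet> J n = 0" unfolding e by (simp_all add: inner_add_left inner_diff_left)
  qed
  have brJk: "br y (J k) \<bullet> n = 0" "br y (J k) \<bullet> J n = 0" for y
  proof -
    have "br (P y) (J k) = - Ck (P y)" unfolding br_anti[of "P y" "J k"] by (simp add: br_Jk_v)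
    then have e: "br y (J k) = (y \<bullet> n) *\<^sub>R br n (J k) + (y \<bullet> J n) *\<^sub>R br (J n) (J k) + (y \<bullet> k) *\<^sub>R br k (J k)"
      by (subst (1) split[of y]) (simp add: brs z)
    have "br n (J k) = - ((b2 - d2) *\<^sub>R J k + J (u1k - uk1))" "br (J n) (J k) = - (d2 *\<^sub>R k + uk1)" "br k (J k) = 0"
      unfolding br_anti[of n "J k"] br_anti[of "J n" "J k"] br_Jk_n br_Jk_Jn br_k_Jk z by simp_all
    then show "br y (J k) \<bullet> n = 0" "br y (J k) \<bullet> J n = 0" unfolding e by (simp_all add: inner_add_left inner_diff_left J_I)
  qed
  have eq: "x = P x + (x \<bullet> k) *\<^sub>R k + (x \<bullet> J k) *\<^sub>R J k" if "x \<bullet> n = 0 \<and> x \<bullet> J n = 0" for x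
    using split[of x] that by simp
  show "br x u \<in> {x. x \<bullet> n = 0 \<and> x \<bullet> J n = 0}" if "u \<in> {x. x \<bullet> n = 0 \<and> x \<bullet> J n = 0}" for u x
  proof -
    have "br x u = br x (P u) + (u \<bullet> k) *\<^sub>R br x k + (u \<bullet> J k) *\<^sub>R br x (J k)"
      using that by (subst (1) eq[of u]) (simp_all add: brs)
    then show ?thesis using brk[of x] brJk[of x] ideal[OF P_I, of x u] by (simp add: inner_add_left)
  qed
  show "br u v = 0" if u: "u \<in> {x. x \<bullet> n = 0 \<and> x \<bullet> J n = 0}" and v: "v \<in> {x. x \<bullet> n = 0 \<and> x \<bullet> J n = 0}" for u v
  proof -
    have "br (J k) (P x) = 0" "br (P x) (J k) = 0" for x
      using br_Jk_v[of "P x"] br_anti[of "P x" "J k"] by (simp_all add: z)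
    moreover have "br k (J k) = 0" "br (J k) k = 0" using br_k_Jk br_anti[of "J k" k] by (simp_all add: z)
    moreover have "br (P u + (u \<bullet> k) *\<^sub>R k + (u \<bullet> J k) *\<^sub>R J k) (P v + (v \<bullet> k) *\<^sub>R k + (v \<bullet> J k) *\<^sub>R J k) = 0"
      using calculation abelian[OF P_I P_I, of u v] by (simp add: brs)
    moreover have "br u v = br (P u + (u \<bullet> k) *\<^sub>R k + (u \<bullet> J k) *\<^sub>R J k) (P v + (v \<bullet> k) *\<^sub>R k + (v \<bullet> J k) *\<^sub>R J k)"
      using arg_cong2[OF eq[of u] eq[of v], of br] u v by blast
    ultimately show ?thesis by metis
  qed
  show "subspace {x. x \<bullet> n = 0 \<and> x \<bullet> J n = 0}" by (auto simp: subspace_def inner_add_left)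
qed (auto simp: J_skew inner_diff_left unimod Qc tau_nonneg)

text \<open>A positive \<open>\<tau>\<close> would give \<open>C1 v \<bullet> v = 0\<close> on
  \<open>I\<close> by \<open>Q_I\<close>, hence \<open>T1 = 0\<close>. For
  \<open>\<tau> = 0\<close>, the sign in \<open>F_trace\<close> and left-symmetry remove enough
  structure constants for \<open>larger_complex_ideal\<close>.\<close>

lemma trace_nonzero:
  assumes T1: "T1 \<noteq> 0" and Tk: "Tk = 0"
  shows "\<tau> = 0" and "complex_ideal br J {x. x \<bullet> n = 0 \<and> x \<bullet> J n = 0} n \<tau> c"
proof -
  have ne: "I \<noteq> {0}"
  proof
    assume "I = {0}"
    then have "C1 = (\<lambda>x. 0)" using C_I(1) by auto
    then show False using T1 by (simp add: T1_def linear_trace_def)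
  qed
  have c: "c = 0" by (rule c_zero[OF ne Tk])
  show \<tau>: "\<tau> = 0"
  proof (rule ccontr)
    assume "\<tau> \<noteq> 0"
    then have "C1 v \<bullet> v = 0" if "v \<in> I" for v
      using Q_I[OF that] tau_nonneg c by (smt (verit) mult_eq_0_iff power2_eq_square zero_le_power2 zero_le_mult_iff mult_minus_left mult_zero_left add_nonneg_eq_0_iff)
    then have "C1 (P b) \<bullet> P b = 0" for b using P_I by blast
    then have "linear_trace (\<lambda>x. C1 (P x)) = 0" using trace_I[OF linear_C(1)] by (simp only: C_I sum.neutral_const)
    then show False using T1 by (simp add: T1_def)
  qed
  let ?\<Sigma> = "\<lambda>x. \<Sum>b\<in>Basis. \<Sum>w\<in>{n, J n, k, J k}. ((P b \<bullet> br x w - J (P b) \<bullet> br (J x) w)\<^sup>2 + (P b \<bullet> br (J x) w + J (P b) \<bullet> br x w)\<^sup>2) / 4"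
  have \<Sigma>: "?\<Sigma> x \<ge> 0" for x by (intro sum_nonneg) simp
  have d: "d1 = b1" using trace_rep T1 Tk by simp
  have s2: "s2 = - b1" using unimod_k Tk d by simp
  have form: "T1 * (\<alpha>\<^sup>2 * a1 + 2 * \<alpha> * \<beta> * b1 + \<beta>\<^sup>2 * s1) \<ge> 0" for \<alpha> \<beta>
  proof -
    let ?x = "\<alpha> *\<^sub>R f + \<beta> *\<^sub>R k"
    have "br (J ?x) ?x \<bullet> J n = \<alpha>\<^sup>2 * a1 + 2 * \<alpha> * \<beta> * b1 + \<beta>\<^sup>2 * s1"
      by (simp add: brs M inner_add_left d power2_eq_square algebra_simps)
    then show ?thesis using F_trace[OF \<tau> c refl, of \<alpha> \<beta>] \<Sigma>[of ?x] Tk by (simp add: mult.commute)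
  qed
  have lsa: "s1 * (2 * a1 + T1) = 2 * b1\<^sup>2" using lsa_coeffs(3) unimod_f unfolding d s2 by algebra
  have s: "s1 = 0" and b: "b1 = 0"
  proof -
    have Ta: "T1 * a1 \<ge> 0" "T1 * s1 \<ge> 0" using form[of 1 0] form[of 0 1] by simp_all
    \<comment> \<open>The semidefinite form is evaluated at \<open>(s1, - b1)\<close>, where it
      equals \<open>s1\<close> times its determinant; left-symmetry makes that determinant
      \<open>- T1 * s1 / 2\<close>.\<close>
    have "T1 * s1 * (a1 * s1 - b1\<^sup>2) \<ge> 0" using form[of s1 "- b1"] by (simp add: power2_eq_square algebra_simps)
    moreover have "a1 * s1 - b1\<^sup>2 = - (T1 * s1) / 2" using lsa by (simp add: algebra_simps)
    ultimately have "(T1 * s1)\<^sup>2 \<le> 0" by (simp add: power2_eq_square)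
    then show "s1 = 0" using T1 by simp
    then show "b1 = 0" using lsa by simp
  qed
  have Ta: "T1 * a1 \<ge> 0" using form[of 1 0] by simp
  \<comment> \<open>For a commutative product, left-symmetry and unimodularity give
    \<open>T1 = - a1\<close> or \<open>T1 = - 2 * a1\<close>, against \<open>T1 * a1 \<ge> 0\<close>
    and \<open>T1 \<noteq> 0\<close>.\<close>
  have \<kappa>: "b2 - d2 \<noteq> 0"
  proof
    assume k0: "b2 - d2 = 0"
    have "d2 * (d2 - a1) = 0" using lsa_coeffs(2) b d s2 s by (auto simp: algebra_simps)
    moreover have "T1 = - (a1 + b2)" using unimod_f k0 by simp
    ultimately have "T1 = - a1 \<or> T1 = - 2 * a1" using k0 by auto
    then have "a1 * a1 \<le> 0" using Ta by auto
    then have "a1 = 0" by (metis mult_eq_0_iff order_antisym zero_le_square)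
    then show False using \<open>T1 = - a1 \<or> T1 = - 2 * a1\<close> T1 by simp
  qed
  have bk: "br (J k) k = ukk" using M(4) by (simp add: s s2 b)
  have k: "k = 0 *\<^sub>R f + 1 *\<^sub>R k" by simp
  define G where "G b w = ((P b \<bullet> br k w - J (P b) \<bullet> br (J k) w)\<^sup>2 + (P b \<bullet> br (J k) w + J (P b) \<bullet> br k w)\<^sup>2) / 4" for b w
  have G_nonneg: "G b w \<ge> 0" for b w by (simp add: G_def)
  \<comment> \<open>For \<open>x = k\<close> the right-hand side of \<open>F_trace\<close> is zero,
    so every single square vanishes.\<close>
  have "(\<Sum>b\<in>Basis. \<Sum>w\<in>{n, J n, k, J k}. G b w) = 0" unfolding G_def using F_trace[OF \<tau> c k] Tk bk by simp
  then have "(\<Sum>w\<in>{n, J n, k, J k}. G b w) = 0" if "b \<in> Basis" for b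
    using that by (subst (asm) sum_nonneg_eq_0_iff) (auto simp del: sum.insert intro: sum_nonneg G_nonneg)
  then have "G b w = 0" if "b \<in> Basis" "w \<in> {n, J n, k, J k}" for b w
    using sum_nonneg_eq_0_iff[of "{n, J n, k, J k}" "G b"] G_nonneg that by blast
  then have cells: "(P b \<bullet> br k w - J (P b) \<bullet> br (J k) w)\<^sup>2 + (P b \<bullet> br (J k) w + J (P b) \<bullet> br k w)\<^sup>2 = 0" if "b \<in> Basis" "w \<in> {n, J n, k, J k}" for b w
    using that unfolding G_def by (metis div_by_0 divide_eq_0_iff zero_neq_numeral)
  have "P b \<bullet> ukk = 0" if "b \<in> Basis" for b
  proof -
    have "br k (J k) = - ukk" "br (J k) (J k) = 0" using br_k_Jk by (simp_all add: s s2 b)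
    then show ?thesis using cells[OF that, of "J k"] by (simp add: sum_power2_eq_zero_iff)
  qed
  moreover have "P b \<bullet> ukk = ukk \<bullet> b" for b by (simp add: P_sym inner_commute)
  ultimately have u: "ukk = 0" by (metis euclidean_eqI inner_zero_left)
  \<comment> \<open>Without the squares, \<open>F_mixed\<close> says that \<open>Ck\<close> is
    normal, while \<open>rep\<close> reads \<open>[C1, Ck] = (b2 - d2) Ck\<close>. Pairing this with
    the transpose of \<open>Ck\<close> under the trace gives
    \<open>(b2 - d2) |Ck|^2 = 0\<close>.\<close>
  have "Ck x = 0" for x
  proof -
    define C where "C u = Ck u" for u
    define Ct where "Ct u = P (S (J k) (P u))" for u
    have lin: "linear C" "linear Ct" "linear C1" unfolding C_def[abs_def] Ct_def[abs_def] using linear_C by (auto intro!: linearI)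
    have adj: "Ct u \<bullet> w = u \<bullet> C w" for u w
    proof -
      have "Ct u \<bullet> w = P u \<bullet> C w" unfolding Ct_def C_def Ck_def by (subst P_sym) (rule S_inner)
      also have "\<dots> = u \<bullet> C w" by (simp add: P_sym C_def)
      finally show ?thesis .
    qed
    have norm: "Ct u \<bullet> Ct u = C u \<bullet> C u" for u
    proof -
      have "(\<Sum>w\<in>{n, J n, k, J k}. ((P u \<bullet> br k w - J (P u) \<bullet> br (J k) w)\<^sup>2 + (P u \<bullet> br (J k) w + J (P u) \<bullet> br k w)\<^sup>2) / 4) = 0"
      proof (rule sum.neutral, rule ballI)
        fix w assume w: "w \<in> {n, J n, k, J k}"
        let ?l1 = "\<lambda>u. P u \<bullet> br k w - J (P u) \<bullet> br (J k) w" and ?l2 = "\<lambda>u. P u \<bullet> br (J k) w + J (P u) \<bullet> br k w"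
        have l: "linear ?l1" "linear ?l2" by (auto intro!: linearI simp: inner_add_left algebra_simps)
        have "?l1 b = 0" "?l2 b = 0" if "b \<in> Basis" for b using cells[OF that w] by (simp_all add: sum_power2_eq_zero_iff)
        then have "?l1 = (\<lambda>u. 0)" "?l2 = (\<lambda>u. 0)"
          by (intro linear_eq_stdbasis[OF l(1)] linear_eq_stdbasis[OF l(2)]; auto intro!: linearI)+
        then show "((P u \<bullet> br k w - J (P u) \<bullet> br (J k) w)\<^sup>2 + (P u \<bullet> br (J k) w + J (P u) \<bullet> br k w)\<^sup>2) / 4 = 0" by (metis add_0 div_0 zero_power2)
      qed
      then have "P (S (J k) (P u)) \<bullet> P (S (J k) (P u)) = br (J k) (P u) \<bullet> br (J k) (P u)"
        using F_mixed[OF \<tau> c k P_I, of u] bk by (simp del: sum.insert)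
      then show ?thesis by (simp add: Ct_def C_def Ck_def)
    qed
    have Cself: "C (Ct u) = Ct (C u)" for u
    proof -
      define D where "D v = C (Ct v) - Ct (C v)" for v
      have adj': "C v \<bullet> w = v \<bullet> Ct w" for v w using adj[of w v] by (simp add: inner_commute)
      have D0: "D v \<bullet> v = 0" for v using norm[of v] by (simp add: D_def inner_diff_left adj adj')
      have sym: "D v \<bullet> w = v \<bullet> D w" for v w unfolding D_def by (simp add: inner_diff_left inner_diff_right adj adj')
      have add: "D (v + w) = D v + D w" for v w unfolding D_def by (simp add: linear_add[OF lin(1)] linear_add[OF lin(2)])
      have "D v \<bullet> w = 0" for v w
        using D0[of "v + w"] D0[of v] D0[of w] sym[of w v] inner_commute[of w "D v"] by (simp add: add inner_add_left inner_add_right)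
      then have "D u = 0" by (metis inner_eq_zero_iff)
      then show ?thesis by (simp add: D_def)
    qed
    have "(b2 - d2) * linear_trace (\<lambda>x. Ct (C x)) = linear_trace (\<lambda>x. Ct ((b2 - d2) *\<^sub>R C x))"
      by (simp add: linear_scale[OF lin(2)] linear_trace_scale)
    also have "\<dots> = linear_trace (\<lambda>x. Ct (C1 (C x)) - Ct (C (C1 x)))"
      using rep d b by (simp add: C_def linear_diff[OF lin(2), symmetric])
    also have "\<dots> = linear_trace (\<lambda>x. Ct (C1 (C x))) - linear_trace (\<lambda>x. Ct (C (C1 x)))" by (rule linear_trace_diff)
    also have "linear_trace (\<lambda>x. Ct (C1 (C x))) = linear_trace (\<lambda>x. C (Ct (C1 x)))"
      using linear_trace_compose[OF linear_compose[OF lin(3,2), unfolded o_def] lin(1)] by simp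
    also have "\<dots> = linear_trace (\<lambda>x. Ct (C (C1 x)))" by (simp add: Cself)
    finally have "linear_trace (\<lambda>x. Ct (C x)) = 0" using \<kappa> by simp
    then have "(\<Sum>b\<in>Basis. C b \<bullet> C b) = 0" unfolding linear_trace_def by (simp add: adj)
    then show "Ck x = 0" using linear_zero_of_sum[OF lin(1), of x] by (simp add: C_def)
  qed
  then show "complex_ideal br J {x. x \<bullet> n = 0 \<and> x \<bullet> J n = 0} n \<tau> c"
    by (intro larger_complex_ideal) (use b d s s2 u in auto)
qed

text \<open>The quartic form at \<open>n\<close> kills \<open>a1\<close> and \<open>a2\<close>,
  after which left-symmetry and unimodularity kill \<open>d2\<close> and \<open>b2\<close>: brackets
  of the complement lie in \<open>I\<close>. There \<open>Q \<tau> x\<close> is a negative multiple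
  of \<open>|br x (J x)|^2\<close>, so the complement even commutes.\<close>

lemma trace_zero:
  assumes T: "T1 = 0" "Tk = 0" and z: "b1 = 0" "d1 = 0" "s1 = 0"
  shows "semidirect br J I P \<tau>"
proof -
  have s2: "s2 = 0" using unimod_k T z by simp
  \<comment> \<open>For \<open>I = {0}\<close> the line through \<open>k\<close> is enlarged to a
    complex abelian ideal, for which \<open>c = 0\<close> is known.\<close>
  have c: "c = 0"
  proof (cases "I = {0}")
    case True
    then have "ukk = 0" "\<And>x. Ck x = 0" using u_I(4) C_I(2) by blast+
    then interpret big: complex_ideal br J "{x. x \<bullet> n = 0 \<and> x \<bullet> J n = 0}" n \<tau> c
      using larger_complex_ideal z s2 by blast
    show ?thesis by (rule big.c_zero)
  qed (use c_zero T in blast)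
  have PS: "P (S x y) = 0" if "P y = 0" for x y
  proof (rule vector_eq_rdot[THEN iffD1], rule allI)
    fix v
    have "y \<bullet> br x (P v) = 0" using ideal[OF P_I, of x v] that by (metis P_id P_sym inner_zero_left)
    then show "P (S x y) \<bullet> v = 0 \<bullet> v" by (simp add: P_sym S_inner)
  qed
  have a: "a1 = 0" "a2 = 0"
  proof -
    define y where "y = br n (J n)"
    have y: "y \<bullet> n = 0" "y \<bullet> J n = - a1" "y \<bullet> k = - a2"
      unfolding y_def br_n_Jn z s2 by (simp_all add: inner_add_left inner_diff_left J_I)
    have b: "br n k = - (b2 *\<^sub>R k + u1k)" "br (J n) k = - (\<gamma> *\<^sub>R ukk)" "br n (J k) = - ((b2 - d2) *\<^sub>R J k + J (u1k - uk1) - \<gamma> *\<^sub>R ukk)"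
      "br (J n) (J k) = - (d2 *\<^sub>R k + uk1)" "br (J n) n = - y" "br n (J n) = y"
      unfolding br_anti[of n k] br_anti[of "J n" k] br_anti[of n "J k"] br_anti[of "J n" "J k"] br_anti[of "J n" n] br_k_n br_k_Jn br_Jk_n br_Jk_Jn z s2 y_def by simp_all
    have y': "n \<bullet> y = 0" "J n \<bullet> y = - a1" using y inner_commute[of n y] inner_commute[of "J n" y] by simp_all
    have S: "S n n = 0" "S (J n) n = 0" "S (J n) (J n) = a1 *\<^sub>R n" "S n (J n) = - a1 *\<^sub>R J n"
      by (rule eq_by_comps; simp add: PS S_inner b y' inner_add_right inner_diff_right J_I)+
    have "Q \<tau> n = - a1\<^sup>2 - (\<tau> + 2) / 4 * ((y + a1 *\<^sub>R J n) \<bullet> (y + a1 *\<^sub>R J n))"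
      unfolding Q_def Phi_def S b by (simp add: inner_add_left inner_add_right y y') (simp add: power2_eq_square field_simps)
    then have e: "a1\<^sup>2 + (\<tau> + 2) / 4 * ((y + a1 *\<^sub>R J n) \<bullet> (y + a1 *\<^sub>R J n)) = 0" using Qc[of n] c by simp
    have "(\<tau> + 2) / 4 * ((y + a1 *\<^sub>R J n) \<bullet> (y + a1 *\<^sub>R J n)) \<ge> 0" using tau_nonneg by simp
    then have "a1\<^sup>2 = 0" "(\<tau> + 2) / 4 * ((y + a1 *\<^sub>R J n) \<bullet> (y + a1 *\<^sub>R J n)) = 0" using e zero_le_power2[of a1] by linarith+
    then show "a1 = 0" and "a2 = 0" using tau_nonneg y by auto
  qed
  have d2: "d2 = 0" using lsa_coeffs(2) z s2 a by simp
  have b2: "b2 = 0" using unimod_f T a d2 by simp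
  note zs = z s2 a d2 b2
  have brI: "br x y \<in> I" if "P x = 0" "P y = 0" for x y
  proof -
    have x: "x = (x \<bullet> n) *\<^sub>R n + (x \<bullet> J n) *\<^sub>R J n + (x \<bullet> k) *\<^sub>R k + (x \<bullet> J k) *\<^sub>R J k" using split[of x] that by simp
    have y: "y = (y \<bullet> n) *\<^sub>R n + (y \<bullet> J n) *\<^sub>R J n + (y \<bullet> k) *\<^sub>R k + (y \<bullet> J k) *\<^sub>R J k" using split[of y] that by simp
    have p: "br k n \<in> I" "br k (J n) \<in> I" "br k (J k) \<in> I" "br (J k) n \<in> I" "br (J k) (J n) \<in> I" "br n (J n) \<in> I"
      unfolding br_k_n br_k_Jn br_k_Jk br_Jk_n br_Jk_Jn br_n_Jn zs by (simp_all add: I_closed)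
    have q: "br n k \<in> I" "br (J n) k \<in> I" "br (J k) k \<in> I" "br n (J k) \<in> I" "br (J n) (J k) \<in> I" "br (J n) n \<in> I"
      unfolding br_anti[of n k] br_anti[of "J n" k] br_anti[of "J k" k] br_anti[of n "J k"] br_anti[of "J n" "J k"] br_anti[of "J n" n]
      using p by (simp_all add: I_closed)
    show ?thesis by (subst x, subst y) (simp add: brs I_closed p q)
  qed
  have orth: "u \<bullet> x = 0" "x \<bullet> u = 0" if "u \<in> I" "P x = 0" for u x using that by (metis P_id P_sym inner_zero_right inner_zero_left)+
  have diag: "br x (J x) = 0" if x: "P x = 0" for x
  proof -
    have "S u w = 0" if uw: "P u = 0" "P w = 0" for u w
    proof (rule vector_eq_rdot[THEN iffD1], rule allI)
      fix v
      have "br u v = br u (P v) + br u (v - P v)" by simp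
      also have "\<dots> \<in> I" by (intro I_closed ideal P_I brI uw) simp
      finally have "br u v \<in> I" .
      then show "S u w \<bullet> v = 0 \<bullet> v" using orth(2)[OF _ uw(2)] by (simp add: S_inner)
    qed
    then have "Q \<tau> x = - ((\<tau> + 2) / 4) * (br x (J x) \<bullet> br x (J x))"
      using x unfolding Q_def Phi_def by (simp add: P_J) (simp add: field_simps)
    then show ?thesis using Qc[of x] c tau_nonneg by simp
  qed
  have "br (x - P x) (y - P y) = 0" for x y
  proof -
    \<comment> \<open>Polarization of \<open>br x (J x) = 0\<close> together with integrability
      makes the bracket complex bilinear on the complement. Since \<open>f\<close> and
      \<open>k\<close> span it over the complex numbers, \<open>br f k = 0\<close> annihilates
      everything.\<close>
    have polar: "br x (J y) = br (J x) y" if "P x = 0" "P y = 0" for x y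
      using diag[of "x + y"] diag[of x] diag[of y] that br_anti[of y "J x"] by simp
    have lin: "br (J x) y = J (br x y)" if "P x = 0" "P y = 0" for x y
    proof -
      have "br (J x) (J y) = - br x y" using polar[of x "J y"] that by (simp add: P_J)
      then have "2 *\<^sub>R (br x y + J (br (J x) y)) = 0" using integrable[of x y] polar[OF that] by (simp add: scaleR_2 algebra_simps)
      then have "J (br x y + J (br (J x) y)) = 0" by simp
      then show ?thesis by simp
    qed
    have "br f k = 0" "br (J f) k = 0" "br (J f) f = 0" "br (J k) k = 0" "br (J k) f = 0" "br (J f) (J k) = 0"
    proof -
      show f: "br f k = 0" "br (J f) k = 0" "br (J f) f = 0" "br (J k) k = 0" using lin[of f k] lin[of f f] lin[of k k] by simp_all
      show "br (J k) f = 0" using lin[of k f] by simp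
      show "br (J f) (J k) = 0" using polar[of f "J k"] f by (simp add: P_J polar[of "J f" k])
    qed
    then have v: "u11 = 0" "u1k = 0" "uk1 = 0" "ukk = 0" by (simp_all add: u11_def u1k_def uk1_def ukk_def)
    have p: "br k n = 0" "br k (J n) = 0" "br k (J k) = 0" "br (J k) n = 0" "br (J k) (J n) = 0" "br n (J n) = 0"
      unfolding br_k_n br_k_Jn br_k_Jk br_Jk_n br_Jk_Jn br_n_Jn zs v by simp_all
    have q: "br n k = 0" "br (J n) k = 0" "br (J k) k = 0" "br n (J k) = 0" "br (J n) (J k) = 0" "br (J n) n = 0"
      unfolding br_anti[of n k] br_anti[of "J n" k] br_anti[of "J k" k] br_anti[of n "J k"] br_anti[of "J n" "J k"] br_anti[of "J n" n] p by simp_all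
    have e: "w - P w = (w \<bullet> n) *\<^sub>R n + (w \<bullet> J n) *\<^sub>R J n + (w \<bullet> k) *\<^sub>R k + (w \<bullet> J k) *\<^sub>R J k" for w by (simp add: P_def)
    show ?thesis unfolding e by (simp add: brs p q)
  qed
  moreover have "br x (J v) = J (br x v)" if "v \<in> I" for x v
    unfolding br_v[OF that] br_v[OF J_I[OF that]] by simp
  ultimately show ?thesis
    by unfold_locales (use linear_P P_sym sub ideal abelian J_I Qc c in auto)
qed

text \<open>The vector \<open>y f + x k\<close> is to become the new \<open>k\<close>. The
  conditions say that its action on \<open>I\<close> has trace zero, that it is parallel to the
  commutator of the product and, in the traceless commutative case, that its line is stable under
  left multiplication.\<close>

lemma ideal_direction:
  obtains x y where "x \<noteq> 0 \<or> y \<noteq> 0" "x * Tk + y * T1 = 0" "x * (b1 - d1) - y * (b2 - d2) = 0"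
    "T1 = 0 \<and> Tk = 0 \<and> b1 = d1 \<and> b2 = d2 \<longrightarrow>
       x * (y * a1 + x * b1) - y * (y * a2 + x * b2) = 0 \<and> x * (y * d1 + x * s1) - y * (y * d2 + x * s2) = 0"
proof (cases "T1 = 0 \<and> Tk = 0")
  case False
  \<comment> \<open>The kernel of the trace functional, which contains the commutator by
    \<open>trace_rep\<close>.\<close>
  show ?thesis using that[of T1 "- Tk"] False trace_rep by (auto simp: algebra_simps)
next
  case T: True
  show ?thesis
  proof (cases "b1 = d1 \<and> b2 = d2")
    case False
    \<comment> \<open>The commutator of \<open>f\<close> and \<open>k\<close> itself.\<close>
    show ?thesis using that[of "b2 - d2" "b1 - d1"] False T by auto
  next
    case w: True
    have v: "s2 = - b1" "a1 = - b2" "d1 = b1" "d2 = b2" using w T unimod_f unimod_k by auto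
    have l: "b1 * b2 = a2 * s1" "b2\<^sup>2 = - b1 * a2" "b1\<^sup>2 = - s1 * b2"
      using lsa_coeffs(1-3) unfolding v by algebra+
    \<comment> \<open>Left multiplications are now commuting and traceless. If the product of
      \<open>f\<close> and \<open>k\<close> is nonzero, both left multiplications annihilate it;
      otherwise \<open>a2 * s1 = 0\<close>, so \<open>f\<close> or \<open>k\<close> has square
      zero.\<close>
    show ?thesis
    proof (cases "b1 = 0 \<and> b2 = 0")
      case False
      have "b2 * (b1 * a1 + b2 * b1) - b1 * (b1 * a2 + b2 * b2) = 0 \<and> b2 * (b1 * d1 + b2 * s1) - b1 * (b1 * d2 + b2 * s2) = 0"
        using l unfolding v by algebra
      then show ?thesis using that[of b2 b1] False T w by auto
    next
      case True
      then consider "a2 = 0" | "s1 = 0" using l(1) by auto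
      then show ?thesis
      proof cases
        case 1
        show ?thesis by (rule that[of 0 1]) (use 1 True v T in auto)
      next
        case 2
        show ?thesis by (rule that[of 1 0]) (use 2 True v T in auto)
      qed
    qed
  qed
qed

text \<open>If \<open>T1 = 0\<close> and the product is not commutative, unimodularity and
  left-symmetry already give \<open>b1 = s1 = 0\<close>, so only the commutative case relies on the
  choice of direction. A nonzero \<open>T1\<close> leads to the enlarged complex ideal.\<close>

lemma conclusion:
  assumes Tk: "Tk = 0" and bd: "b1 = d1" and comm: "T1 = 0 \<Longrightarrow> b2 = d2 \<Longrightarrow> b1 = 0 \<and> s1 = 0"
  shows "\<tau> > 0 \<Longrightarrow> kaehler_flat br J \<and> (\<forall>x y. br x y \<in> I)" and "\<tau> = 0 \<Longrightarrow> chern_flat br J"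
proof -
  have sd: "semidirect br J I P \<tau>" if T1: "T1 = 0"
  proof -
    have "b1 = 0 \<and> s1 = 0"
    proof (cases "b2 = d2")
      case False
      have s2: "s2 = - b1" and d1: "d1 = b1" and d2: "d2 = a1 + 2 * b2" using unimod_k unimod_f T1 Tk bd by simp_all
      have "s1 * (a1 + b2)\<^sup>2 = 0" "s1 * a1 = b1\<^sup>2"
        using lsa_coeffs(2-4) unfolding s2 d1 d2 by algebra+
      moreover have "a1 + b2 \<noteq> 0" using False d2 by auto
      ultimately show ?thesis by simp
    qed (use comm T1 in blast)
    then show ?thesis using trace_zero[OF T1 Tk] bd by simp
  qed
  show "kaehler_flat br J \<and> (\<forall>x y. br x y \<in> I)" if "\<tau> > 0"
  proof -
    have "T1 = 0" using trace_nonzero(1) Tk that by fastforce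
    then interpret D: semidirect br J I P \<tau> by (rule sd)
    show ?thesis using D.kaehler_flat[OF that] D.quotient by blast
  qed
  show "chern_flat br J" if "\<tau> = 0"
  proof (cases "T1 = 0")
    case True
    then interpret D: semidirect br J I P \<tau> by (rule sd)
    show ?thesis by (rule D.chern_flat[OF that])
  next
    case False
    then interpret D: complex_ideal br J "{x. x \<bullet> n = 0 \<and> x \<bullet> J n = 0}" n \<tau> c using trace_nonzero(2) Tk by blast
    show ?thesis by (rule D.chern_flat[OF that])
  qed
qed

end

text \<open>The complement of \<open>\<aa>\<close> is spanned by an orthonormal pair \<open>p\<close>, \<open>q\<close>. The angle \<open>\<langle>J p, q\<rangle> = \<theta>\<close> does not change
  when the pair is rotated, and a rotation moves \<open>k\<close> into any direction of the real part of \<open>\<aa>\<close>.\<close>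

locale real_ideal = hermitian_lie br J for br :: "'a::euclidean_space \<Rightarrow> 'a \<Rightarrow> 'a" and J +
  fixes \<aa> :: "'a set" and \<tau> c \<theta> \<rho> :: real
  assumes \<aa>: "abelian_lie_ideal br \<aa>"
    and \<rho>: "\<rho> > 0" "\<rho>\<^sup>2 = 1 - \<theta>\<^sup>2"
    and unimod: "linear_trace (br x) = 0"
    and Qc: "Q \<tau> x = c * (x \<bullet> x)\<^sup>2" and tau_nonneg: "\<tau> \<ge> 0"
begin

definition I where "I = {x. x \<in> \<aa> \<and> J x \<in> \<aa>}"
text \<open>\<open>J p\<close> made orthogonal to \<open>q\<close>, which puts it into the ideal,
  and divided by its length \<open>\<rho>\<close>.\<close>

definition kv where "kv p q = (1 / \<rho>) *\<^sub>R (J p - \<theta> *\<^sub>R q)"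

definition frame where "frame p q \<longleftrightarrow> p \<bullet> p = 1 \<and> q \<bullet> q = 1 \<and> p \<bullet> q = 0 \<and> J p \<bullet> q = \<theta> \<and> \<aa> = {x. x \<bullet> p = 0 \<and> x \<bullet> q = 0}"

text \<open>The value of \<open>\<gamma>\<close> is forced by orthogonality of
  \<open>J q + \<gamma> J k\<close> to \<open>p\<close>, because
  \<open>J q \<bullet> p = - \<theta>\<close> and \<open>J k \<bullet> p = - \<rho>\<close>.\<close>

lemma totally_real:
  assumes "frame p q"
  shows "totally_real br J I q (kv p q) (- \<theta> / \<rho>) \<tau> c"
proof -
  have pq: "p \<bullet> p = 1" "q \<bullet> q = 1" "p \<bullet> q = 0" "q \<bullet> p = 0" "J p \<bullet> q = \<theta>" and mem: "\<And>x. x \<in> \<aa> \<longleftrightarrow> x \<bullet> p = 0 \<and> x \<bullet> q = 0"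
    using assms by (auto simp: frame_def inner_commute)
  have sub: "subspace \<aa>" and ideal: "\<And>u x. u \<in> \<aa> \<Longrightarrow> br x u \<in> \<aa>" and ab: "\<And>u v. u \<in> \<aa> \<Longrightarrow> v \<in> \<aa> \<Longrightarrow> br u v = 0"
    using \<aa> by (auto simp: abelian_lie_ideal_def lie_ideal_def)
  define k where "k = kv p q"
  define g where "g = - \<theta> / \<rho>"
  have rn: "\<rho> \<noteq> 0" using \<rho> by simp
  have t: "q \<bullet> J p = \<theta>" "p \<bullet> J q = - \<theta>" "J q \<bullet> p = - \<theta>" "p \<bullet> J p = 0" "q \<bullet> J q = 0" "J p \<bullet> p = 0" "J q \<bullet> q = 0"
    using pq J_skew[of p q] J_skew[of q p] J_skew[of p p] J_skew[of q q] inner_commute[of q "J p"] inner_commute[of p "J p"] inner_commute[of q "J q"] by simp_all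
  have Jk: "J k = (1 / \<rho>) *\<^sub>R (- p - \<theta> *\<^sub>R J q)" by (simp add: k_def kv_def)
  have p_eq: "p = - \<rho> *\<^sub>R J k - \<theta> *\<^sub>R J q" and Jp_eq: "J p = \<rho> *\<^sub>R k + \<theta> *\<^sub>R q" using rn by (simp_all add: Jk k_def kv_def)
  have kk: "k \<bullet> k = 1" "q \<bullet> k = 0" "q \<bullet> J k = 0" "k \<bullet> q = 0" "J k \<bullet> q = 0"
  proof -
    have "k \<bullet> k = (1 / \<rho>) * ((1 / \<rho>) * (1 - \<theta>\<^sup>2))" unfolding k_def kv_def
      by (simp add: inner_diff_left inner_diff_right pq t power2_eq_square algebra_simps)
    then show "k \<bullet> k = 1" using \<rho>(2)[symmetric] rn by (simp add: power2_eq_square)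
    show "q \<bullet> k = 0" "q \<bullet> J k = 0" "k \<bullet> q = 0" "J k \<bullet> q = 0" unfolding Jk unfolding k_def kv_def by (simp_all add: inner_diff_right inner_diff_left pq t)
  qed
  have Jkk: "k \<bullet> J k = 0" "J k \<bullet> k = 0" "J q \<bullet> J k = 0" "J k \<bullet> J q = 0"
    using J_skew[of k k] inner_commute[of "J k" k] kk by simp_all
  have kJq: "k \<bullet> J q = 0" "J q \<bullet> k = 0" using J_skew[of q k] kk by (simp_all add: inner_commute)
  have kp: "k \<bullet> p = 0" "J k \<bullet> p = - \<rho>" "J k \<bullet> J p = 0"
    unfolding Jp_eq by (subst p_eq, use kk kJq Jkk in \<open>simp add: inner_add_right inner_diff_right\<close>)+ (use kk Jkk in \<open>simp add: inner_add_right\<close>)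
  have k_a: "k \<in> \<aa>" unfolding mem using kp kk by simp
  have gr: "g * \<rho> = - \<theta>" using rn by (simp add: g_def)
  have f_a: "J q + g *\<^sub>R J k \<in> \<aa>" unfolding mem using gr by (simp add: inner_add_left t kp kk)
  have I_mem: "x \<in> I \<longleftrightarrow> x \<bullet> q = 0 \<and> x \<bullet> J q = 0 \<and> x \<bullet> k = 0 \<and> x \<bullet> J k = 0" for x
  proof -
    have "x \<bullet> p = - \<rho> * (x \<bullet> J k) - \<theta> * (x \<bullet> J q)" by (subst p_eq) (simp add: inner_diff_right)
    moreover have "J x \<bullet> p = - (x \<bullet> (\<rho> *\<^sub>R k + \<theta> *\<^sub>R q))" unfolding J_skew Jp_eq ..
    ultimately show ?thesis unfolding I_def mem_Collect_eq mem using rn by (auto simp: J_skew inner_add_right)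
  qed
  have J_I: "J u \<in> I" if "u \<in> I" for u using that by (auto simp: I_mem J_skew)
  have subI: "subspace I" by (auto simp: subspace_def I_mem inner_add_left)
  note I_closed = subspace_add[OF subI] subspace_diff[OF subI] subspace_scale[OF subI] subspace_neg[OF subI]
  have decomp: "x - (x \<bullet> q) *\<^sub>R q - (x \<bullet> J q) *\<^sub>R J q - (x \<bullet> k) *\<^sub>R k - (x \<bullet> J k) *\<^sub>R J k \<in> I" for x
    unfolding I_mem by (simp add: inner_diff_left pq kk kJq Jkk t)
  have f_eq: "z - (z \<bullet> J q) *\<^sub>R (J q + g *\<^sub>R J k) - (z \<bullet> k) *\<^sub>R k \<in> I" if z: "z \<in> \<aa>" for z
  proof -
    have "z \<bullet> p = - \<rho> * (z \<bullet> J k) - \<theta> * (z \<bullet> J q)" by (subst p_eq) (simp add: inner_diff_right)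
    then have "\<rho> * (z \<bullet> J k) = - \<theta> * (z \<bullet> J q)" using z by (simp add: mem)
    then have zk: "z \<bullet> J k = (z \<bullet> J q) * g" using rn by (simp add: g_def field_simps)
    have zq: "z \<bullet> q = 0" using z by (simp add: mem)
    show ?thesis unfolding I_mem using zk zq by (simp add: inner_add_left inner_diff_left pq kk kJq Jkk t)
  qed
  have I_a: "u \<in> \<aa>" "J u \<in> \<aa>" if "u \<in> I" for u using that by (simp_all add: I_def)
  \<comment> \<open>\<open>y\<close> commutes with \<open>I\<close>, so integrability makes
    \<open>br (J y)\<close> complex linear there: the image and its multiple by \<open>J\<close>
    both stay in the ideal.\<close>
  have idJ: "br (J y) u \<in> I" if y: "y \<in> \<aa>" and u: "u \<in> I" for y u
  proof -
    have "br y u = 0" "br y (J u) = 0" using ab[OF y] I_a[OF u] by simp_all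
    then have "J (br (J y) u) = br (J y) (J u)" using integrable[of y u] by (simp add: eq_neg_iff_add_eq_0 algebra_simps)
    then show ?thesis unfolding I_def using ideal[OF I_a(1)[OF u], of "J y"] ideal[OF I_a(2)[OF u], of "J y"] by simp
  qed
  have idI: "br x u \<in> I" if u: "u \<in> I" for x u
  proof -
    define r where "r = x - (x \<bullet> q) *\<^sub>R q - (x \<bullet> J q) *\<^sub>R J q - (x \<bullet> k) *\<^sub>R k - (x \<bullet> J k) *\<^sub>R J k"
    have x: "x = r + (x \<bullet> q) *\<^sub>R q + (x \<bullet> J q) *\<^sub>R J q + (x \<bullet> k) *\<^sub>R k + (x \<bullet> J k) *\<^sub>R J k" by (simp add: r_def)
    have "br r u = 0" using ab I_a decomp[of x] u unfolding r_def by blast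
    moreover have ku: "br k u = 0" "br (J q + g *\<^sub>R J k) u = 0" using ab k_a f_a I_a u by blast+
    moreover have "br (J k) u \<in> I" "br (J (J q + g *\<^sub>R J k)) u \<in> I" using idJ k_a f_a u by blast+
    moreover have "br q u = - br (J (J q + g *\<^sub>R J k)) u" using ku by simp
    moreover have "br (J q) u = - g *\<^sub>R br (J k) u" using ku(2) by (simp add: eq_neg_iff_add_eq_0)
    ultimately show ?thesis by (subst x) (simp only: brs, simp add: I_closed del: brs Js)
  qed
  show ?thesis unfolding k_def[symmetric] g_def[symmetric]
  proof
    show "br (J q + g *\<^sub>R J k) k = 0" by (rule ab[OF f_a k_a])
    show "br u v = 0" if "u \<in> I" "v \<in> I" for u v using that ab I_a by blast
    show "br (J q + g *\<^sub>R J k) u = 0" "br k u = 0" if "u \<in> I" for u using that ab I_a f_a k_a by blast+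
    show "\<exists>\<alpha> \<beta>. br x y - \<alpha> *\<^sub>R (J q + g *\<^sub>R J k) - \<beta> *\<^sub>R k \<in> I" if "y \<in> {J q + g *\<^sub>R J k, k}" for x y
      using f_eq[of "br x y"] ideal[of y x] that f_a k_a by blast
  qed (use subI idI J_I decomp pq kk in \<open>auto simp: I_mem unimod Qc tau_nonneg\<close>)
qed

lemma rotate:
  assumes F: "frame p q" and xy: "x\<^sup>2 + y\<^sup>2 = 1"
  shows "frame (x *\<^sub>R p + y *\<^sub>R q) (x *\<^sub>R q - y *\<^sub>R p)"
proof -
  let ?p = "x *\<^sub>R p + y *\<^sub>R q" and ?q = "x *\<^sub>R q - y *\<^sub>R p"
  have pq: "p \<bullet> p = 1" "q \<bullet> q = 1" "p \<bullet> q = 0" "q \<bullet> p = 0" "J p \<bullet> q = \<theta>" and mem: "\<aa> = {x. x \<bullet> p = 0 \<and> x \<bullet> q = 0}"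
    using F by (auto simp: frame_def inner_commute)
  have t: "J q \<bullet> p = - \<theta>" "J p \<bullet> p = 0" "J q \<bullet> q = 0"
    using pq J_skew[of q p] J_skew[of p p] J_skew[of q q] inner_commute[of q "J p"] inner_commute[of p "J p"] inner_commute[of q "J q"] by simp_all
  have xy': "x * x + y * y = 1" using xy by (simp add: power2_eq_square)
  have "J ?p \<bullet> ?q = (x * x + y * y) * \<theta>" by (simp add: inner_add_left inner_diff_right pq t algebra_simps)
  then have "J ?p \<bullet> ?q = \<theta>" using xy' by simp
  moreover have "v \<bullet> ?p = 0 \<and> v \<bullet> ?q = 0 \<longleftrightarrow> v \<bullet> p = 0 \<and> v \<bullet> q = 0" for v
  proof -
    have "v \<bullet> p = (x * x + y * y) * (v \<bullet> p)" "v \<bullet> q = (x * x + y * y) * (v \<bullet> q)" using xy' by simp_all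
    moreover have "(x * x + y * y) * (v \<bullet> p) = x * (v \<bullet> ?p) - y * (v \<bullet> ?q)" "(x * x + y * y) * (v \<bullet> q) = y * (v \<bullet> ?p) + x * (v \<bullet> ?q)"
      by (simp_all add: inner_add_right inner_diff_right algebra_simps)
    ultimately show ?thesis by (auto simp: inner_add_right inner_diff_right)
  qed
  ultimately show ?thesis unfolding frame_def unfolding mem using xy'
    by (simp add: inner_add_left inner_add_right inner_diff_left inner_diff_right pq algebra_simps)
qed

text \<open>\<open>A\<close> is the given frame and \<open>B\<close> the one rotated so that
  \<open>kB\<close> has the direction found by \<open>ideal_direction\<close>. The structure
  constants of \<open>B\<close> are rewritten in those of \<open>A\<close>, which turns that lemma
  into the hypotheses of \<open>conclusion\<close>.\<close>

lemma flatness: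
  assumes F: "frame p q"
  shows "\<tau> > 0 \<Longrightarrow> kaehler_flat br J \<and> (\<forall>x y. br x y \<in> \<aa>)" and "\<tau> = 0 \<Longrightarrow> chern_flat br J"
proof -
  define \<gamma> where "\<gamma> = - \<theta> / \<rho>"
  define kA where "kA = kv p q"
  interpret A: totally_real br J I q kA \<gamma> \<tau> c unfolding kA_def \<gamma>_def by (rule totally_real[OF F])
  have rn: "\<rho> \<noteq> 0" using \<rho> by simp
  obtain X Y where XY: "X \<noteq> 0 \<or> Y \<noteq> 0" "X * A.Tk + Y * A.T1 = 0" "X * (A.b1 - A.d1) - Y * (A.b2 - A.d2) = 0"
    and XY0: "A.T1 = 0 \<and> A.Tk = 0 \<and> A.b1 = A.d1 \<and> A.b2 = A.d2 \<longrightarrow>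
       X * (Y * A.a1 + X * A.b1) - Y * (Y * A.a2 + X * A.b2) = 0 \<and> X * (Y * A.d1 + X * A.s1) - Y * (Y * A.d2 + X * A.s2) = 0"
    by (rule A.ideal_direction)
  define l where "l = sqrt (X\<^sup>2 + (Y / \<rho>)\<^sup>2)"
  have "X\<^sup>2 + (Y / \<rho>)\<^sup>2 > 0" using XY(1) rn by (auto simp: sum_power2_gt_zero_iff)
  then have l: "l \<noteq> 0" "l\<^sup>2 = X\<^sup>2 + (Y / \<rho>)\<^sup>2"
    unfolding l_def by (metis less_irrefl real_sqrt_gt_zero) simp
  define x y where "x = X / l" and "y = Y / \<rho> / l"
  have xy: "x\<^sup>2 + y\<^sup>2 = 1"
  proof -
    have "x\<^sup>2 + y\<^sup>2 = (X\<^sup>2 + (Y / \<rho>)\<^sup>2) / l\<^sup>2" by (simp add: x_def y_def power_divide power_mult_distrib add_divide_distrib)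
    then show ?thesis using l XY(1) rn by simp
  qed
  \<comment> \<open>The rotated vector is \<open>kB = x kA + (y * \<rho>) A.f\<close>; the factor
    \<open>\<rho>\<close> compensates for the length \<open>1 / \<rho>\<close> of
    \<open>A.f\<close>.\<close>
  have X: "X = l * x" "Y = l * (y * \<rho>)" using l rn by (simp_all add: x_def y_def)
  define p' q' where "p' = x *\<^sub>R p + y *\<^sub>R q" and "q' = x *\<^sub>R q - y *\<^sub>R p"
  have F': "frame p' q'" unfolding p'_def q'_def by (rule rotate[OF F xy])
  define kB where "kB = kv p' q'"
  interpret B: totally_real br J I q' kB \<gamma> \<tau> c unfolding kB_def \<gamma>_def by (rule totally_real[OF F'])
  have rho1: "1 = \<rho> * \<rho> + \<theta> * \<theta>" using \<rho>(2) by (simp add: power2_eq_square)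
  have fA: "A.f = (1 / (\<rho> * \<rho>)) *\<^sub>R (J q + \<theta> *\<^sub>R p)" and fB: "B.f = (1 / (\<rho> * \<rho>)) *\<^sub>R (J q' + \<theta> *\<^sub>R p')"
  proof -
    have "J r + (- \<theta> / \<rho>) *\<^sub>R J (kv u r) = (1 / (\<rho> * \<rho>)) *\<^sub>R (J r + \<theta> *\<^sub>R u)" for u r
    proof -
      have "J r + (- \<theta> / \<rho>) *\<^sub>R J (kv u r) = (1 + \<theta> * \<theta> / (\<rho> * \<rho>)) *\<^sub>R J r + (\<theta> / (\<rho> * \<rho>)) *\<^sub>R u"
        by (simp add: kv_def algebra_simps)
      also have "1 + \<theta> * \<theta> / (\<rho> * \<rho>) = 1 / (\<rho> * \<rho>)" using rho1 rn by (simp add: field_simps)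
      finally show ?thesis by (simp add: algebra_simps)
    qed
    then show "A.f = (1 / (\<rho> * \<rho>)) *\<^sub>R (J q + \<theta> *\<^sub>R p)" "B.f = (1 / (\<rho> * \<rho>)) *\<^sub>R (J q' + \<theta> *\<^sub>R p')"
      unfolding A.f_def B.f_def unfolding kA_def kB_def \<gamma>_def by simp_all
  qed
  have kB: "kB = x *\<^sub>R kA + (y * \<rho>) *\<^sub>R A.f" and fB': "B.f = x *\<^sub>R A.f - (y / \<rho>) *\<^sub>R kA"
    unfolding fA fB unfolding kA_def kB_def kv_def unfolding p'_def q'_def using rn by (simp_all add: algebra_simps)
  have xy': "x * x + y * y = 1" using xy by (simp add: power2_eq_square)
  have fA': "A.f = x *\<^sub>R B.f + (y / \<rho>) *\<^sub>R kB" and kA': "kA = x *\<^sub>R kB - (y * \<rho>) *\<^sub>R B.f"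
  proof -
    have "x *\<^sub>R B.f + (y / \<rho>) *\<^sub>R kB = (x * x + y * y) *\<^sub>R A.f" "x *\<^sub>R kB - (y * \<rho>) *\<^sub>R B.f = (x * x + y * y) *\<^sub>R kA"
      unfolding fB' unfolding kB using rn by (simp_all add: algebra_simps)
    then show "A.f = x *\<^sub>R B.f + (y / \<rho>) *\<^sub>R kB" "kA = x *\<^sub>R kB - (y * \<rho>) *\<^sub>R B.f" using xy' by simp_all
  qed
  have P: "A.P = B.P"
  proof
    fix v
    have "A.P v - B.P v \<in> I" by (intro A.I_closed A.P_I B.P_I)
    moreover have "w \<bullet> (A.P v - B.P v) = 0" if "w \<in> I" for w
      using A.P_sym[of w v] B.P_sym[of w v] that by (simp add: inner_diff_right)
    ultimately have "A.P v - B.P v = 0" by (metis inner_eq_zero_iff)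
    then show "A.P v = B.P v" by simp
  qed
  have T: "B.Tk = x * A.Tk + y * \<rho> * A.T1" "B.T1 = x * A.T1 - y / \<rho> * A.Tk"
  proof -
    have "B.Ck = (\<lambda>v. x *\<^sub>R A.Ck v + (y * \<rho>) *\<^sub>R A.C1 v)" "B.C1 = (\<lambda>v. x *\<^sub>R A.C1 v - (y / \<rho>) *\<^sub>R A.Ck v)"
      unfolding B.Ck_def[abs_def] B.C1_def[abs_def] A.Ck_def[abs_def] A.C1_def[abs_def] unfolding P[symmetric] unfolding fB' unfolding kB by simp_all
    then show "B.Tk = x * A.Tk + y * \<rho> * A.T1" "B.T1 = x * A.T1 - y / \<rho> * A.Tk"
      unfolding B.Tk_def B.T1_def A.Tk_def A.T1_def by (simp_all add: linear_trace_add linear_trace_diff linear_trace_scale)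
  qed
  have TA: "A.T1 = x * B.T1 + y / \<rho> * B.Tk" "A.Tk = x * B.Tk - y * \<rho> * B.T1"
  proof -
    have "x * B.T1 + y / \<rho> * B.Tk = (x * x + y * y) * A.T1" "x * B.Tk - y * \<rho> * B.T1 = (x * x + y * y) * A.Tk"
      unfolding T using rn by (simp_all add: algebra_simps)
    then show "A.T1 = x * B.T1 + y / \<rho> * B.Tk" "A.Tk = x * B.Tk - y * \<rho> * B.T1" using xy' by simp_all
  qed
  have comps: "A.f \<bullet> J q' = x" "A.f \<bullet> kB = y / \<rho>" "kA \<bullet> J q' = - (y * \<rho>)" "kA \<bullet> kB = x"
    unfolding fA' unfolding kA' by (simp_all add: inner_add_left inner_diff_left)
  have Icomps: "u \<bullet> J q' = 0" "u \<bullet> kB = 0" if "u \<in> I" for u using that by simp_all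
  note M = A.M
  \<comment> \<open>An alternating expression in the pair \<open>f\<close>, \<open>k\<close>, hence
    invariant under a change of basis of determinant \<open>x * x + y * y = 1\<close>.\<close>
  have w: "br (J B.f) kB - br (J kB) B.f = br (J A.f) kA - br (J kA) A.f"
  proof -
    have "br (J B.f) kB - br (J kB) B.f = (x * x + y * y) *\<^sub>R (br (J A.f) kA - br (J kA) A.f)"
      unfolding fB' unfolding kB using rn by (simp add: algebra_simps)
    then show ?thesis using xy' by simp
  qed
  have wB: "B.b1 - B.d1 = x * (A.b1 - A.d1) - y * \<rho> * (A.b2 - A.d2)" "B.b2 - B.d2 = y / \<rho> * (A.b1 - A.d1) + x * (A.b2 - A.d2)"
  proof -
    have e: "br (J A.f) kA - br (J kA) A.f = (A.b1 - A.d1) *\<^sub>R A.f + (A.b2 - A.d2) *\<^sub>R kA + (A.u1k - A.uk1)"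
      unfolding M by (simp add: algebra_simps)
    have u: "A.u1k - A.uk1 \<in> I" by (intro A.I_closed A.u_I)
    have "B.b1 - B.d1 = (br (J B.f) kB - br (J kB) B.f) \<bullet> J q'" "B.b2 - B.d2 = (br (J B.f) kB - br (J kB) B.f) \<bullet> kB"
      unfolding B.b1_def B.d1_def B.b2_def B.d2_def by (simp_all add: inner_diff_left)
    then show "B.b1 - B.d1 = x * (A.b1 - A.d1) - y * \<rho> * (A.b2 - A.d2)" "B.b2 - B.d2 = y / \<rho> * (A.b1 - A.d1) + x * (A.b2 - A.d2)"
      unfolding w e inner_add_left Icomps[OF u] by (simp_all add: comps algebra_simps)
  qed
  have "l * B.Tk = 0" using XY(2) unfolding X T by algebra
  then have Tk0: "B.Tk = 0" using l by simp
  have "l * (B.b1 - B.d1) = 0" using XY(3) unfolding X wB by algebra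
  then have bd0: "B.b1 = B.d1" using l by simp
  have last: "B.b1 = 0 \<and> B.s1 = 0" if T10: "B.T1 = 0" and k0: "B.b2 = B.d2"
  proof -
    have "A.T1 = 0" "A.Tk = 0" using TA T10 Tk0 by simp_all
    moreover have "A.b1 = A.d1" "A.b2 = A.d2"
    proof -
      have e: "x * (B.b1 - B.d1) + y * \<rho> * (B.b2 - B.d2) = (x * x + y * y) * (A.b1 - A.d1)"
        "x * (B.b2 - B.d2) - y / \<rho> * (B.b1 - B.d1) = (x * x + y * y) * (A.b2 - A.d2)"
        unfolding wB using rn by (simp_all add: algebra_simps)
      show "A.b1 = A.d1" "A.b2 = A.d2" using e unfolding xy' using bd0 k0 by simp_all
    qed
    ultimately have XYz: "X * (Y * A.a1 + X * A.b1) - Y * (Y * A.a2 + X * A.b2) = 0" "X * (Y * A.d1 + X * A.s1) - Y * (Y * A.d2 + X * A.s2) = 0"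
      using XY0 by blast+
    have L: "br (J A.f) kB = (y * \<rho> * A.a1 + x * A.b1) *\<^sub>R A.f + (y * \<rho> * A.a2 + x * A.b2) *\<^sub>R kA + ((y * \<rho>) *\<^sub>R A.u11 + x *\<^sub>R A.u1k)"
      "br (J kA) kB = (y * \<rho> * A.d1 + x * A.s1) *\<^sub>R A.f + (y * \<rho> * A.d2 + x * A.s2) *\<^sub>R kA + ((y * \<rho>) *\<^sub>R A.uk1 + x *\<^sub>R A.ukk)"
      unfolding kB by (simp_all add: M algebra_simps)
    have u: "(y * \<rho>) *\<^sub>R A.u11 + x *\<^sub>R A.u1k \<in> I" "(y * \<rho>) *\<^sub>R A.uk1 + x *\<^sub>R A.ukk \<in> I" by (intro A.I_closed A.u_I)+
    have v: "br (J A.f) kB \<bullet> J q' = (y * \<rho> * A.a1 + x * A.b1) * x - (y * \<rho> * A.a2 + x * A.b2) * (y * \<rho>)"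
      "br (J kA) kB \<bullet> J q' = (y * \<rho> * A.d1 + x * A.s1) * x - (y * \<rho> * A.d2 + x * A.s2) * (y * \<rho>)"
      unfolding L by (simp_all add: inner_add_left comps Icomps)
    have "l * l * (br (J A.f) kB \<bullet> J q') = 0" using XYz(1) unfolding X v by algebra
    moreover have "l * l * (br (J kA) kB \<bullet> J q') = 0" using XYz(2) unfolding X v by algebra
    ultimately have z: "br (J A.f) kB \<bullet> J q' = 0" "br (J kA) kB \<bullet> J q' = 0" using l by simp_all
    have "B.b1 = br (J B.f) kB \<bullet> J q'" "B.s1 = br (J kB) kB \<bullet> J q'" by (simp_all add: B.b1_def B.s1_def)
    moreover have "br (J B.f) kB = x *\<^sub>R br (J A.f) kB - (y / \<rho>) *\<^sub>R br (J kA) kB" unfolding fB' by simp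
    moreover have "br (J kB) kB = x *\<^sub>R br (J kA) kB + (y * \<rho>) *\<^sub>R br (J A.f) kB" by (subst (1) kB) simp
    ultimately show ?thesis using z by (simp add: inner_diff_left inner_add_left)
  qed
  show "kaehler_flat br J \<and> (\<forall>x y. br x y \<in> \<aa>)" if "\<tau> > 0"
    using B.conclusion(1)[OF Tk0 bd0 last that] by (auto simp: I_def)
  show "chern_flat br J" if "\<tau> = 0" by (rule B.conclusion(2)[OF Tk0 bd0 last that])
qed

end

theorem theorem1:
  fixes br :: "'a::euclidean_space \<Rightarrow> 'a \<Rightarrow> 'a"
    and J :: "'a \<Rightarrow> 'a" and \<aa> :: "'a set" and r s :: real
  assumes "hermitian_lie_algebra br J"
    and "unimodular br"
    and "abelian_lie_ideal br \<aa>"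
    and "dim \<aa> + 2 = DIM('a)"
    and "(r, s) \<in> Omega"
    and "constant_hol_sec_curvature br J (canonical_connection br J r s)"
  shows "((r, s) \<noteq> (1, 0) \<longrightarrow> kaehler_flat br J \<and> quotient_abelian br \<aa>) \<and>
         ((r, s) = (1, 0) \<longrightarrow> chern_flat br J)"
proof -
  interpret hermitian_lie br J by unfold_locales (rule assms(1))
  have ideal: "lie_ideal br \<aa>" and sub: "subspace \<aa>" and id: "\<And>u x. u \<in> \<aa> \<Longrightarrow> br x u \<in> \<aa>" and ab: "\<And>u v. u \<in> \<aa> \<Longrightarrow> v \<in> \<aa> \<Longrightarrow> br u v = 0"
    using assms(3) by (auto simp: abelian_lie_ideal_def lie_ideal_def)
  have unimod: "linear_trace (br x) = 0" for x using assms(2) by (simp add: unimodular_def)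
  define \<tau> where "\<tau> = (1 - (1 - s) * (1 + r) / 2)\<^sup>2 + ((1 - s) * (1 - r) / 2)\<^sup>2"
  obtain c where Qc: "\<And>x. Q \<tau> x = c * (x \<bullet> x)\<^sup>2"
    using constant_hol_sec_curvatureD[OF assms(6)] unfolding \<tau>_def by blast
  have \<tau>: "\<tau> \<ge> 0" by (simp add: \<tau>_def)
  have \<tau>0: "\<tau> = 0 \<longleftrightarrow> (r, s) = (1, 0)"
  proof
    assume "\<tau> = 0"
    then have "(1 - s) * (1 + r) = 2" "(1 - s) * (1 - r) = 0" unfolding \<tau>_def by (simp_all add: sum_power2_eq_zero_iff)
    then show "(r, s) = (1, 0)" by auto
  qed (simp add: \<tau>_def)
  obtain p q where pq: "p \<bullet> p = 1" "q \<bullet> q = 1" "p \<bullet> q = 0" and mem: "\<aa> = {x. x \<bullet> p = 0 \<and> x \<bullet> q = 0}"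
  proof -
    define W where "W = orthogonal_comp \<aa>"
    have "W = {y \<in> UNIV. \<forall>x\<in>\<aa>. orthogonal x y}" by (simp add: W_def orthogonal_comp_def)
    then have "dim W + dim \<aa> = DIM('a)" using dim_subspace_orthogonal_to_vectors[OF sub subspace_UNIV] by simp
    then have dW: "dim W = 2" using assms(4) by simp
    have sW: "subspace W" unfolding W_def by (rule subspace_orthogonal_comp)
    obtain B where B: "pairwise orthogonal B" "\<And>x. x \<in> B \<Longrightarrow> norm x = 1" "card B = dim W" "span B = W"
      using orthonormal_basis_subspace[OF sW] by metis
    obtain p q where Bpq: "B = {p, q}" "p \<noteq> q" using B(3) dW by (auto simp: card_2_iff)
    show ?thesis
    proof
      show "p \<bullet> p = 1" "q \<bullet> q = 1" using B(2) Bpq by (simp_all add: norm_eq_1)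
      show "p \<bullet> q = 0" using B(1) Bpq by (simp add: pairwise_def orthogonal_def)
      have "x \<in> \<aa> \<longleftrightarrow> (\<forall>y\<in>W. orthogonal y x)" for x
        using orthogonal_comp_self[OF sub] unfolding W_def[symmetric] by (auto simp: orthogonal_comp_def)
      also have "(\<forall>y\<in>W. orthogonal y x) \<longleftrightarrow> x \<bullet> p = 0 \<and> x \<bullet> q = 0" for x
        unfolding B(4)[symmetric] Bpq(1)
      proof
        assume "\<forall>y\<in>span {p, q}. orthogonal y x"
        then have "orthogonal p x" "orthogonal q x" by (simp_all add: span_base)
        then show "x \<bullet> p = 0 \<and> x \<bullet> q = 0" by (simp add: orthogonal_def inner_commute)
      next
        assume x: "x \<bullet> p = 0 \<and> x \<bullet> q = 0"
        have "orthogonal x y" if "y \<in> span {p, q}" for y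
          by (rule orthogonal_to_span[OF that]) (use x in \<open>auto simp: orthogonal_def\<close>)
        then show "\<forall>y\<in>span {p, q}. orthogonal y x" by (simp add: orthogonal_commute)
      qed
      finally show "\<aa> = {x. x \<bullet> p = 0 \<and> x \<bullet> q = 0}" by blast
    qed
  qed
  define \<theta> where "\<theta> = J p \<bullet> q"
  have Jpq: "(J p - \<theta> *\<^sub>R q) \<bullet> (J p - \<theta> *\<^sub>R q) = 1 - \<theta>\<^sup>2"
    by (simp add: inner_diff_left inner_diff_right pq \<theta>_def inner_commute[of q "J p"] power2_eq_square)
  have main: "(\<tau> > 0 \<longrightarrow> kaehler_flat br J \<and> (\<forall>x y. br x y \<in> \<aa>)) \<and> (\<tau> = 0 \<longrightarrow> chern_flat br J)"
  proof (cases "\<theta>\<^sup>2 = 1")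
    case True
    \<comment> \<open>Equality in Cauchy-Schwarz: \<open>J p\<close> is a multiple of
      \<open>q\<close>, so the orthogonal complement of the ideal, and with it the ideal, is
      complex.\<close>
    then have "J p - \<theta> *\<^sub>R q = 0" using Jpq by simp
    then have Jp: "J p = \<theta> *\<^sub>R q" by simp
    then have "J (J p) = \<theta> *\<^sub>R J q" by simp
    then have "\<theta> *\<^sub>R (- p) = \<theta> *\<^sub>R \<theta> *\<^sub>R J q" by simp
    then have Jq: "J q = - \<theta> *\<^sub>R p" using True by (simp add: power2_eq_square)
    interpret C: complex_ideal br J \<aa> q \<tau> c
    proof
      show "J u \<in> \<aa>" if "u \<in> \<aa>" for u using that unfolding mem by (simp add: J_skew Jp Jq)
      show "x - (x \<bullet> q) *\<^sub>R q - (x \<bullet> J q) *\<^sub>R J q \<in> \<aa>" for x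
        unfolding mem Jq using pq True inner_commute[of q p] by (simp add: inner_diff_left inner_add_left power2_eq_square)
      show "u \<bullet> q = 0" if "u \<in> \<aa>" for u using that by (simp add: mem)
    qed (use sub id ab pq unimod Qc \<tau> in auto)
    show ?thesis using C.kaehler_flat C.chern_flat C.br_in_I by blast
  next
    case False
    have "1 - \<theta>\<^sup>2 \<ge> 0" unfolding Jpq[symmetric] by simp
    with False have pos: "1 - \<theta>\<^sup>2 > 0" by simp
    interpret R: real_ideal br J \<aa> \<tau> c \<theta> "sqrt (1 - \<theta>\<^sup>2)"
      by unfold_locales (use assms(3) pos unimod Qc \<tau> in auto)
    have "R.frame p q" unfolding R.frame_def using pq mem by (simp add: \<theta>_def)
    then show ?thesis using R.flatness by blast
  qed
  have "bilinear br" "\<And>x. br x x = 0" using assms(1) by (auto simp: hermitian_lie_algebra_def lie_bracket_def)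
  then have "quotient_abelian br \<aa> \<longleftrightarrow> (\<forall>x y. br x y \<in> \<aa>)" using ideal by (intro quotient_abelian_iff)
  then show ?thesis using main \<tau>0 \<tau> by (auto simp: less_le)
qed

end
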